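(* Let $d\ge 1$ and let $(X_{\mathbf u})_{\mathbf u\in\mathbb Z^d}$ be a stationary collection of real random variables with mean zero and finite variance which obeys the FKG inequalities and has finite susceptibility, i.e. $v=\sum_{\mathbf u\in\mathbb Z^d}\mathrm{Cov}(X_{\mathbf 0},X_{\mathbf u})<\infty$. Fix $\tau>0$ and let $V^{(\tau)}_{\mathbf x}$ be the normalized sums of the Gaussian-perturbed variables over the boxes $B_{\mathbf x}$. Then $$\lim_{n\to\infty}\Big(\sup_{\mathbf x:\,|\mathbf x|=n}J_{\rm st}\big(V^{(\tau)}_{\mathbf x}\big)\Big)=0$$ if and only if the following uniform integrability condition holds: there exists a function $\psi$ with $\psi(R)\to0$ as $R\to\infty$ such that $V^{(\tau)}_{\mathbf x}\in\mathcal C_\psi$ for all $\mathbf x$.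
   Context: Stationary means that the joint law of $(X_{\mathbf u})_{\mathbf u\in\mathbb Z^d}$ is invariant under translations of $\mathbb Z^d$. Random variables $\{X_1,\dots,X_m\}$ are FKG if $\mathrm{Cov}(F(X_1,\dots,X_m),G(X_1,\dots,X_m))\ge0$ for all (coordinatewise) increasing functions $F,G$ (for which the covariance is defined); an infinite collection obeys the FKG inequalities if every finite subcollection is FKG. For a vector $\mathbf x=(x_1,\dots,x_d)$ of positive integers, $B_{\mathbf x}=\{\mathbf y\in\mathbb Z^d:1\le y_i\le x_i\text{ for all }i\}$ and $|\mathbf x|=|B_{\mathbf x}|=\prod_i x_i$. Let $Z^{(\tau)}_{\mathbf u}$, $\mathbf u\in\mathbb Z^d$, be $N(0,\tau)$ variables (variance $\tau$) independent of each other and of all the $X_{\mathbf u}$; $Y^{(\tau)}_{\mathbf u}=X_{\mathbf u}+Z^{(\tau)}_{\mathbf u}$ and $V^{(\tau)}_{\mathbf x}=|\mathbf x|^{-1/2}\sum_{\mathbf u\in B_{\mathbf x}}Y^{(\tau)}_{\mathbf u}$. For a random variable $U$ with variance $\sigma^2$ and smooth density $f$: score function $\rho=f'/f$, Fisher information $J(U)=\mathbb E\rho(U)^2$, standardised Fisher information $J_{\rm st}(U)=\sigma^2J(U)-1$. For a function $\psi$, $\mathcal C_\psi$ is the class of random variables $X$, with variance denoted $\sigma^2$, such that $\mathbb E\,X^2 I(|X|\ge R\sigma)\le\sigma^2\psi(R)$ for all $R$. *)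

theory Defs
  imports "HOL-Probability.Probability"
begin

section \<open>Random fields on the lattice\<close>

definition covariance :: "'a measure \<Rightarrow> ('a \<Rightarrow> real) \<Rightarrow> ('a \<Rightarrow> real) \<Rightarrow> real" where
  "covariance M U W =
     (\<integral>\<omega>. (U \<omega> - (\<integral>\<omega>'. U \<omega>' \<partial>M)) * (W \<omega> - (\<integral>\<omega>'. W \<omega>' \<partial>M)) \<partial>M)"

definition stationary :: "'a measure \<Rightarrow> ('i :: ab_group_add \<Rightarrow> 'a \<Rightarrow> real) \<Rightarrow> bool" where
  "stationary M X \<longleftrightarrow>
     (\<forall>h. distr M (\<Pi>\<^sub>M u\<in>UNIV. borel) (\<lambda>\<omega> u. X (u + h) \<omega>)
        = distr M (\<Pi>\<^sub>M u\<in>UNIV. borel) (\<lambda>\<omega> u. X u \<omega>))"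

text \<open>
  A function of the finitely many variables indexed by \<open>S\<close> is a function on \<open>S \<rightarrow>\<^sub>E UNIV\<close>, on which
  the pointwise order of functions is the coordinatewise order. The covariance of \<open>F\<close> and
  \<open>G\<close> is defined if \<open>F\<close>, \<open>G\<close> and their product are integrable; \<open>F\<close> and \<open>G\<close> are taken
  Borel measurable, which monotonicity alone does not imply for more than one variable.
\<close>

definition FKG_on :: "'a measure \<Rightarrow> 'i set \<Rightarrow> ('i \<Rightarrow> 'a \<Rightarrow> real) \<Rightarrow> bool" where
  "FKG_on M S X \<longleftrightarrow>
     (\<forall>F G :: ('i \<Rightarrow> real) \<Rightarrow> real.
        F \<in> borel_measurable (\<Pi>\<^sub>M i\<in>S. borel) \<longrightarrow> G \<in> borel_measurable (\<Pi>\<^sub>M i\<in>S. borel) \<longrightarrow>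
        mono_on (S \<rightarrow>\<^sub>E UNIV) F \<longrightarrow> mono_on (S \<rightarrow>\<^sub>E UNIV) G \<longrightarrow>
        integrable M (\<lambda>\<omega>. F (\<lambda>i\<in>S. X i \<omega>)) \<longrightarrow>
        integrable M (\<lambda>\<omega>. G (\<lambda>i\<in>S. X i \<omega>)) \<longrightarrow>
        integrable M (\<lambda>\<omega>. F (\<lambda>i\<in>S. X i \<omega>) * G (\<lambda>i\<in>S. X i \<omega>)) \<longrightarrow>
        covariance M (\<lambda>\<omega>. F (\<lambda>i\<in>S. X i \<omega>)) (\<lambda>\<omega>. G (\<lambda>i\<in>S. X i \<omega>)) \<ge> 0)"

definition FKG :: "'a measure \<Rightarrow> ('i \<Rightarrow> 'a \<Rightarrow> real) \<Rightarrow> bool" where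
  "FKG M X \<longleftrightarrow> (\<forall>S. finite S \<longrightarrow> FKG_on M S X)"

text \<open>Box sizes are vectors of natural numbers, required to be positive where they are used.\<close>

definition box_sites :: "nat ^ 'd \<Rightarrow> (int ^ 'd) set" where
  "box_sites x = {y. \<forall>i. 1 \<le> y $ i \<and> y $ i \<le> int (x $ i)}"

definition box_size :: "nat ^ 'd \<Rightarrow> nat" where
  "box_size x = (\<Prod>i\<in>UNIV. x $ i)"

definition normalized_sum :: "(int ^ 'd \<Rightarrow> 'a \<Rightarrow> real) \<Rightarrow> nat ^ 'd \<Rightarrow> 'a \<Rightarrow> real" where
  "normalized_sum Y x \<omega> = (\<Sum>u\<in>box_sites x. Y u \<omega>) / sqrt (real (box_size x))"


section \<open>Fisher information\<close>

definition smooth :: "(real \<Rightarrow> real) \<Rightarrow> bool" where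
  "smooth f \<longleftrightarrow> (\<forall>k x. (deriv ^^ k) f differentiable (at x))"

definition has_smooth_density :: "'a measure \<Rightarrow> ('a \<Rightarrow> real) \<Rightarrow> (real \<Rightarrow> real) \<Rightarrow> bool" where
  "has_smooth_density M U f \<longleftrightarrow>
     (\<forall>x. 0 \<le> f x) \<and> smooth f \<and> distributed M lborel U (\<lambda>x. ennreal (f x))"

lemma smooth_imp_continuous:
  assumes "smooth f"
  shows "continuous_on UNIV f"
proof -
  have "f differentiable (at x)" for x
    using assms[unfolded smooth_def, rule_format, of 0 x] by simp
  then show ?thesis
    by (auto simp: continuous_on_eq_continuous_at differentiable_imp_continuous_within)
qed

lemma has_smooth_density_unique:
  assumes "has_smooth_density M U f" and "has_smooth_density M U g"
  shows "f = g"
proof -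
  have cont: "continuous_on UNIV f" "continuous_on UNIV g"
    using assms smooth_imp_continuous by (auto simp: has_smooth_density_def)
  then have [measurable]: "f \<in> borel_measurable borel" "g \<in> borel_measurable borel"
    by (auto intro: borel_measurable_continuous_onI)
  have nonneg: "0 \<le> f x" "0 \<le> g x" for x
    using assms by (auto simp: has_smooth_density_def)
  have "density lborel (\<lambda>x. ennreal (f x)) = density lborel (\<lambda>x. ennreal (g x))"
    using assms by (simp add: has_smooth_density_def distributed_def)
  then have "AE x in lborel. ennreal (f x) = ennreal (g x)"
    by (intro sigma_finite_measure.density_unique[OF lborel.sigma_finite_measure_axioms]) auto
  then have ae: "AE x in lborel. f x = g x"
    by eventually_elim (use nonneg in simp)
  have op: "open {x. f x \<noteq> g x}"
    using cont by (intro open_Collect_neq)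
  have "{x. f x \<noteq> g x} \<in> null_sets lborel"
    using ae by (simp add: AE_iff_null_sets)
  then have "negligible {x. f x \<noteq> g x}"
    by (simp add: negligible_iff_null_sets null_sets_completionI)
  with op have "{x. f x \<noteq> g x} = {}"
    using open_not_negligible by blast
  then show ?thesis by auto
qed

text \<open>
  By the preceding lemma the description below is unambiguous whenever a smooth density exists.
  It says nothing about a variable without a smooth density.
\<close>

definition smooth_density :: "'a measure \<Rightarrow> ('a \<Rightarrow> real) \<Rightarrow> real \<Rightarrow> real" where
  "smooth_density M U = (THE f. has_smooth_density M U f)"

definition score :: "'a measure \<Rightarrow> ('a \<Rightarrow> real) \<Rightarrow> real \<Rightarrow> real" where
  "score M U y = deriv (smooth_density M U) y / smooth_density M U y"

text \<open>
  The expectation of the squared score is taken in \<open>[0, \<infinity>]\<close>, so that an infinite Fisher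
  information is not confused with the default value of the Bochner integral.
\<close>

definition fisher_information :: "'a measure \<Rightarrow> ('a \<Rightarrow> real) \<Rightarrow> ennreal" where
  "fisher_information M U = (\<integral>\<^sup>+\<omega>. ennreal ((score M U (U \<omega>))\<^sup>2) \<partial>M)"

definition std_fisher_information :: "'a measure \<Rightarrow> ('a \<Rightarrow> real) \<Rightarrow> ereal" where
  "std_fisher_information M U =
     ereal (prob_space.variance M U) * enn2ereal (fisher_information M U) - 1"


section \<open>Uniform control of second-moment tails\<close>

definition tail_class :: "'a measure \<Rightarrow> (real \<Rightarrow> real) \<Rightarrow> ('a \<Rightarrow> real) set" where
  "tail_class M \<psi> =
     {U. U \<in> borel_measurable M \<and> integrable M (\<lambda>\<omega>. (U \<omega>)\<^sup>2) \<and>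
         (\<forall>R. (\<integral>\<omega>. (U \<omega>)\<^sup>2 * indicator {\<omega>'. \<bar>U \<omega>'\<bar> \<ge> R * sqrt (prob_space.variance M U)} \<omega> \<partial>M)
               \<le> prob_space.variance M U * \<psi> R)}"

end

theory Submission
  imports Defs "HOL-Computational_Algebra.Polynomial"
begin

text \<open>
  Write \<open>W\<close> for the normalized sum of the \<open>X u\<close> over a finite block \<open>B\<close> of sites, and \<open>V = W + G\<close>, where
  the averaged noise \<open>G\<close> is \<open>N(0, \<tau>)\<close> and independent of \<open>W\<close>. The two conditions are not derived from
  each other. Both hold, and both are consequences of a central limit theorem that is uniform
  in the shape of the block: for fixed \<open>t\<close> the characteristic function of \<open>W\<close> at \<open>t\<close> differs from
  \<open>exp (- Var W * t\<^sup>2 / 2)\<close> by a quantity that tends to 0 as the number of sites of \<open>B\<close> grows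
  (\<open>char_block_sum_near_gaussian\<close>).

  For a bounded field \<open>\<xi>\<close> this is Stein's method on characteristic functions. Take a finite set \<open>H\<close> of
  lags that carries almost all of the summable covariances, and in \<open>E[\<xi> u * exp (i t W)]\<close> remove from
  \<open>W\<close> the contribution \<open>D u\<close> of the sites whose lag from \<open>u\<close> lies in \<open>H\<close>. The FKG inequalities, applied
  to linear functions plus or minus a Lipschitz function, bound covariances of Lipschitz functions
  by sums of covariances (\<open>FKG_covariance_dominated\<close>). So \<open>\<xi> u\<close> is nearly uncorrelated with what is
  left, while the first-order effect of \<open>D u\<close>, summed over \<open>u\<close>, is a quadratic form in \<open>\<xi>\<close> that by the
  same bound concentrates at its mean, approximately \<open>Var W\<close>. This gives
  \<open>\<phi>' t = - t * Var W * \<phi> t\<close> up to a small error, and integrating the differential equation gives the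
  Gaussian characteristic function (\<open>stein_identity_error\<close>, \<open>gaussian_ode_stability\<close>).

  The general field is reduced to a bounded one by clipping at level \<open>K\<close>. The clipped part and the
  remainder are both increasing functions of \<open>X\<close>, so the covariances of the remainder lie between 0
  and those of \<open>X\<close>. They vanish as \<open>K\<close> grows, and by domination so does their sum; hence the normalized
  sums of the remainder are small in \<open>L\<^sup>2\<close> uniformly over all blocks (\<open>rest_uniformly_small\<close>).

  For the passage to the theorem, take any sequence of growing blocks. The variances of \<open>W\<close> are
  bounded by the susceptibility, so along a subsequence \<open>Var W\<close> tends to some \<open>s\<^sup>2\<close> and \<open>W\<close> tends in law
  to \<open>N(0, s\<^sup>2)\<close>. The density \<open>f\<close> of \<open>V\<close> at \<open>y\<close> is the expectation of the Gaussian kernel at \<open>y - W\<close>, so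
  \<open>f\<close> and \<open>f'\<close> converge pointwise to those of \<open>N(0, s\<^sup>2 + \<tau>)\<close>. The variance bound dominates both \<open>f\<close> and
  \<open>(f')\<^sup>2 / f\<close> by a multiple of \<open>1 / (1 + y\<^sup>2)\<close>. Dominated convergence then gives
  \<open>J(V) \<longlonglongrightarrow> 1 / (s\<^sup>2 + \<tau>)\<close>, that is, vanishing standardised Fisher information, and also convergence
  of \<open>E[min (V\<^sup>2) b]\<close>, which together with the convergence of \<open>E[V\<^sup>2]\<close> controls the second-moment tails.
  Since every sequence of growing blocks has such a subsequence, both conclusions are uniform over large
  blocks. The finitely many boxes with few sites enter only in the tail condition, where each of them
  has a tail that tends to 0.
\<close>

section \<open>Smoothing a distribution with a Gaussian kernel\<close>

text \<open>
  Derivatives of expectations are obtained below from a second-order Taylor bound that is uniform in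
  the integration variable: it survives integration as it stands.
\<close>

lemma has_vector_derivative_quadratic_error:
  fixes F :: "real \<Rightarrow> 'a :: real_normed_vector"
  assumes "\<And>h. norm (F (y + h) - F y - h *\<^sub>R D) \<le> C * h\<^sup>2"
  shows "(F has_vector_derivative D) (at y)"
  unfolding has_vector_derivative_def has_derivative_at
proof (intro conjI bounded_linear_scaleR_left)
  have bound: "norm (norm (F (y + h) - F y - h *\<^sub>R D) / norm h) \<le> \<bar>C\<bar> * \<bar>h\<bar>" for h
  proof -
    have "C * h\<^sup>2 \<le> \<bar>C\<bar> * \<bar>h\<bar> * \<bar>h\<bar>"
      by (simp add: power2_eq_square mult.assoc abs_mult[symmetric] mult_right_mono)
    then have "norm (F (y + h) - F y - h *\<^sub>R D) \<le> \<bar>C\<bar> * \<bar>h\<bar> * \<bar>h\<bar>"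
      using assms order_trans by blast
    then show ?thesis by (cases "h = 0") (simp_all add: divide_le_eq)
  qed
  have "((\<lambda>h::real. \<bar>C\<bar> * \<bar>h\<bar>) \<longlongrightarrow> \<bar>C\<bar> * \<bar>0\<bar>) (at 0)"
    by (intro tendsto_intros)
  then have lim: "((\<lambda>h::real. \<bar>C\<bar> * \<bar>h\<bar>) \<longlongrightarrow> 0) (at 0)" by simp
  show "((\<lambda>h. norm (F (y + h) - F y - h *\<^sub>R D) / norm h) \<longlongrightarrow> 0) (at 0)"
    by (rule Lim_null_comparison[OF always_eventually lim]) (rule allI, rule bound)
qed

text \<open>
  The functions \<open>gauss_poly t p\<close>, polynomials times the centred Gaussian density of variance \<open>t\<close>, are closed
  under differentiation; \<open>gauss_poly_deriv t\<close> is the effect of differentiation on the polynomial. All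
  derivatives of a smoothed density are therefore of the single form \<open>smoothed t p \<mu>\<close>.
\<close>

definition gauss_poly :: "real \<Rightarrow> real poly \<Rightarrow> real \<Rightarrow> real" where
  "gauss_poly t p z = poly p z * normal_density 0 (sqrt t) z"

definition gauss_poly_deriv :: "real \<Rightarrow> real poly \<Rightarrow> real poly" where
  "gauss_poly_deriv t p = pderiv p - smult (1 / t) ([:0, 1:] * p)"

definition smoothed :: "real \<Rightarrow> real poly \<Rightarrow> real measure \<Rightarrow> real \<Rightarrow> real" where
  "smoothed t p \<mu> y = (\<integral>w. gauss_poly t p (y - w) \<partial>\<mu>)"

lemma gauss_poly_measurable [measurable]: "gauss_poly t p \<in> borel_measurable borel"
  unfolding gauss_poly_def
  by (intro borel_measurable_times borel_measurable_normal_density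
        borel_measurable_continuous_onI continuous_intros)

text \<open>
  One term of the exponential series gives \<open>x ^ k \<le> fact k * exp x\<close>, here with \<open>x = z\<^sup>2 / (2 * t)\<close>.
\<close>

lemma power_times_gauss_bounded:
  assumes "t > 0"
  shows "\<exists>C. \<forall>z. \<bar>z ^ k * normal_density 0 (sqrt t) z\<bar> \<le> C"
proof -
  define c where "c = 1 / sqrt (2 * pi * t)"
  have c: "c \<ge> 0" using assms by (simp add: c_def)
  have nd: "normal_density 0 (sqrt t) z = c * exp (- (z\<^sup>2 / (2 * t)))" for z
    using assms by (simp add: normal_density_def c_def)
  have "\<bar>z ^ k * normal_density 0 (sqrt t) z\<bar> \<le> c * (1 + fact k * (2 * t) ^ k)" for z
  proof -
    define x where "x = z\<^sup>2 / (2 * t)"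
    have x: "x \<ge> 0" using assms by (simp add: x_def)
    have "(\<Sum>n\<in>{k}. x ^ n /\<^sub>R fact n) \<le> exp x"
      unfolding exp_def by (rule sum_le_suminf) (use x summable_exp_generic[of x] in auto)
    then have e: "x ^ k \<le> fact k * exp x" by (simp add: field_simps)
    have "z\<^sup>2 = x * (2 * t)" using assms by (simp add: x_def)
    then have "(z\<^sup>2) ^ k = x ^ k * (2 * t) ^ k" by (simp add: power_mult_distrib)
    also have "\<dots> \<le> fact k * exp x * (2 * t) ^ k" using e assms by (intro mult_right_mono) auto
    finally have 1: "(z\<^sup>2) ^ k \<le> fact k * (2 * t) ^ k * exp x" by (simp add: mult_ac)
    have "\<bar>z ^ k\<bar> \<le> 1 + (z\<^sup>2) ^ k"
    proof -
      have "0 \<le> (\<bar>z ^ k\<bar> - 1)\<^sup>2 + \<bar>z ^ k\<bar>" by simp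
      then have "\<bar>z ^ k\<bar> \<le> 1 + \<bar>z ^ k\<bar>\<^sup>2" by (simp add: power2_eq_square algebra_simps)
      then show ?thesis by (simp add: power_mult[symmetric] mult.commute)
    qed
    also have "\<dots> \<le> exp x + fact k * (2 * t) ^ k * exp x" using 1 x by (intro add_mono) auto
    finally have "\<bar>z ^ k\<bar> \<le> (1 + fact k * (2 * t) ^ k) * exp x" by (simp add: algebra_simps)
    then have "\<bar>z ^ k\<bar> * exp (- x) \<le> 1 + fact k * (2 * t) ^ k"
      by (simp add: exp_minus field_simps)
    then have "c * (\<bar>z ^ k\<bar> * exp (- x)) \<le> c * (1 + fact k * (2 * t) ^ k)"
      by (rule mult_left_mono[OF _ c])
    then show ?thesis unfolding nd x_def[symmetric] using c by (simp add: abs_mult mult_ac)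
  qed
  then show ?thesis by blast
qed

lemma gauss_poly_bounded:
  assumes "t > 0"
  shows "\<exists>C\<ge>0. \<forall>z. \<bar>gauss_poly t p z\<bar> \<le> C"
proof -
  obtain C where C: "\<And>k z. \<bar>z ^ k * normal_density 0 (sqrt t) z\<bar> \<le> C k"
    using power_times_gauss_bounded[OF assms] by metis
  have "\<bar>gauss_poly t p z\<bar> \<le> (\<Sum>i\<le>degree p. \<bar>coeff p i\<bar> * C i)" for z
  proof -
    have "gauss_poly t p z = (\<Sum>i\<le>degree p. coeff p i * (z ^ i * normal_density 0 (sqrt t) z))"
      by (simp add: gauss_poly_def poly_altdef sum_distrib_right mult.assoc)
    also have "\<bar>\<dots>\<bar> \<le> (\<Sum>i\<le>degree p. \<bar>coeff p i * (z ^ i * normal_density 0 (sqrt t) z)\<bar>)"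
      by (rule sum_abs)
    also have "\<dots> \<le> (\<Sum>i\<le>degree p. \<bar>coeff p i\<bar> * C i)"
      using C by (intro sum_mono) (simp add: abs_mult mult_left_mono)
    finally show ?thesis .
  qed
  then show ?thesis by (meson abs_ge_zero order_trans)
qed

lemma gauss_poly_has_deriv:
  assumes "t > 0"
  shows "(gauss_poly t p has_real_derivative gauss_poly t (gauss_poly_deriv t p) z) (at z)"
  unfolding gauss_poly_def gauss_poly_deriv_def normal_density_def
  by (rule derivative_eq_intros refl | use assms in \<open>simp add: field_simps\<close>)+

context real_distribution
begin

lemma integrable_gauss_poly:
  assumes "t > 0"
  shows "integrable M (\<lambda>w. gauss_poly t p (y - w))"
proof -
  obtain C where "\<And>z. \<bar>gauss_poly t p z\<bar> \<le> C" using gauss_poly_bounded[OF assms] by metis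
  then show ?thesis by (intro integrable_const_bound[of _ C]) auto
qed

text \<open>
  The second derivative of the kernel is bounded, so its first-order Taylor remainder is quadratic
  uniformly in the point.
\<close>

lemma smoothed_has_deriv:
  assumes t: "t > 0"
  shows "(smoothed t p M has_real_derivative smoothed t (gauss_poly_deriv t p) M y) (at y)"
proof -
  let ?g = "gauss_poly t p" and ?g' = "gauss_poly t (gauss_poly_deriv t p)"
    and ?g'' = "gauss_poly t (gauss_poly_deriv t (gauss_poly_deriv t p))"
  obtain C where C: "C \<ge> 0" "\<And>z. \<bar>?g'' z\<bar> \<le> C" using gauss_poly_bounded[OF t] by metis
  have lip: "\<bar>?g' x - ?g' z\<bar> \<le> C * \<bar>x - z\<bar>" for x z
    using field_differentiable_bound[of UNIV ?g' ?g'' C x z] gauss_poly_has_deriv[OF t] C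
    by (auto simp: has_field_derivative_at_within)
  have taylor: "\<bar>?g (z + h) - ?g z - h * ?g' z\<bar> \<le> C * h\<^sup>2" for z h
  proof -
    have "\<exists>s. \<bar>s - z\<bar> \<le> \<bar>h\<bar> \<and> ?g (z + h) - ?g z = h * ?g' s"
    proof (cases "h = 0")
      case False
      then consider "z < z + h" | "z + h < z" by linarith
      then show ?thesis
      proof cases
        case 1
        then obtain s where "z < s" "s < z + h" "?g (z + h) - ?g z = (z + h - z) * ?g' s"
          using MVT2[OF 1, of ?g ?g'] gauss_poly_has_deriv[OF t] by blast
        then show ?thesis by (intro exI[of _ s]) auto
      next
        case 2
        then obtain s where "z + h < s" "s < z" "?g z - ?g (z + h) = (z - (z + h)) * ?g' s"
          using MVT2[OF 2, of ?g ?g'] gauss_poly_has_deriv[OF t] by blast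
        then show ?thesis by (intro exI[of _ s]) auto
      qed
    qed auto
    then obtain s where s: "\<bar>s - z\<bar> \<le> \<bar>h\<bar>" "?g (z + h) - ?g z = h * ?g' s" by blast
    then have "\<bar>?g (z + h) - ?g z - h * ?g' z\<bar> = \<bar>h\<bar> * \<bar>?g' s - ?g' z\<bar>"
      by (simp add: right_diff_distrib[symmetric] abs_mult)
    also have "\<dots> \<le> \<bar>h\<bar> * (C * \<bar>h\<bar>)"
      using order_trans[OF lip[of s z] mult_left_mono[OF s(1) C(1)]] by (intro mult_left_mono) auto
    finally show ?thesis by (simp add: power2_eq_square mult_ac)
  qed
  have "\<bar>smoothed t p M (y + h) - smoothed t p M y - h * smoothed t (gauss_poly_deriv t p) M y\<bar> \<le> C * h\<^sup>2" for h
  proof -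
    have eq: "smoothed t p M (y + h) - smoothed t p M y - h * smoothed t (gauss_poly_deriv t p) M y =
      (\<integral>w. ?g ((y - w) + h) - ?g (y - w) - h * ?g' (y - w) \<partial>M)"
      using integrable_gauss_poly[OF t, of p "y + h"] integrable_gauss_poly[OF t, of p y] integrable_gauss_poly[OF t, of _ y]
      by (simp add: smoothed_def algebra_simps)
    have "\<bar>\<integral>w. ?g ((y - w) + h) - ?g (y - w) - h * ?g' (y - w) \<partial>M\<bar> \<le> (\<integral>w. \<bar>?g ((y - w) + h) - ?g (y - w) - h * ?g' (y - w)\<bar> \<partial>M)"
      by (rule integral_abs_bound)
    also have "\<dots> \<le> (\<integral>w. C * h\<^sup>2 \<partial>M)"
    proof (rule integral_mono)
      show "integrable M (\<lambda>w. \<bar>?g ((y - w) + h) - ?g (y - w) - h * ?g' (y - w)\<bar>)"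
        using integrable_gauss_poly[OF t, of p "y + h"] integrable_gauss_poly[OF t, of _ y]
        unfolding diff_add_eq
        by (intro integrable_abs Bochner_Integration.integrable_diff integrable_mult_right)
      show "integrable M (\<lambda>w. C * h\<^sup>2)" by simp
      show "\<bar>?g ((y - w) + h) - ?g (y - w) - h * ?g' (y - w)\<bar> \<le> C * h\<^sup>2" for w by (rule taylor)
    qed
    finally show ?thesis unfolding eq using prob_space by simp
  qed
  then have "norm (smoothed t p M (y + h) - smoothed t p M y - h *\<^sub>R smoothed t (gauss_poly_deriv t p) M y) \<le> C * h\<^sup>2" for h
    unfolding real_norm_def real_scaleR_def .
  then show ?thesis
    unfolding has_real_derivative_iff_has_vector_derivative
    by (rule has_vector_derivative_quadratic_error[where F = "smoothed t p M" and y = y and C = C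
          and D = "smoothed t (gauss_poly_deriv t p) M y"])
qed

lemma smooth_smoothed:
  assumes t: "t > 0"
  shows "smooth (smoothed t p M)"
proof -
  have deriv: "deriv (smoothed t p M) = smoothed t (gauss_poly_deriv t p) M" for p
    by (rule ext) (rule DERIV_imp_deriv[OF smoothed_has_deriv[OF t]])
  have "(deriv ^^ k) (smoothed t p M) = smoothed t ((gauss_poly_deriv t ^^ k) p) M" for k
    by (induction k) (simp_all add: deriv)
  moreover have "smoothed t p M differentiable (at x)" for p x
    unfolding real_differentiable_def using smoothed_has_deriv[OF t] by blast
  ultimately show ?thesis unfolding smooth_def by simp
qed

lemma smoothed_one_pos:
  assumes t: "t > 0"
  shows "smoothed t 1 M y > 0"
proof -
  have int: "integrable M (\<lambda>w. gauss_poly t 1 (y - w))" by (rule integrable_gauss_poly[OF t])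
  have pos: "gauss_poly t 1 z > 0" for z using t by (simp add: gauss_poly_def normal_density_pos)
  have "smoothed t 1 M y \<ge> 0" unfolding smoothed_def using pos by (simp add: less_imp_le)
  moreover have "smoothed t 1 M y \<noteq> 0"
  proof
    assume "smoothed t 1 M y = 0"
    then have "AE w in M. gauss_poly t 1 (y - w) = 0"
      unfolding smoothed_def using integral_nonneg_eq_0_iff_AE[OF int] pos by (simp add: less_imp_le)
    then have "AE w in M. False" by eventually_elim (use pos less_imp_neq in metis)
    then show False by simp
  qed
  ultimately show ?thesis by simp
qed

text \<open>
  The Cauchy-Schwarz inequality for the weights \<open>gauss_poly t 1 (y - w)\<close>. It bounds the integrand
  \<open>(f')\<^sup>2 / f\<close> of the Fisher information by a smoothed function in which no division occurs.
\<close>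

lemma smoothed_deriv_square_le:
  assumes t: "t > 0"
  shows "(smoothed t (gauss_poly_deriv t 1) M y)\<^sup>2 \<le> smoothed t 1 M y * smoothed t ((gauss_poly_deriv t 1)\<^sup>2) M y"
proof -
  have nn: "normal_density 0 (sqrt t) z \<ge> 0" for z by simp
  let ?D = "gauss_poly_deriv t 1"
  define a b c where "a = smoothed t 1 M y" and "b = smoothed t ?D M y" and "c = smoothed t (?D\<^sup>2) M y"
  have "0 \<le> (\<integral>w. gauss_poly t ((smult a ?D - smult b 1)\<^sup>2) (y - w) \<partial>M)"
    by (intro integral_nonneg_AE) (auto simp: gauss_poly_def)
  also have "\<dots> = (\<integral>w. a\<^sup>2 * gauss_poly t (?D\<^sup>2) (y - w) - 2 * a * b * gauss_poly t ?D (y - w) + b\<^sup>2 * gauss_poly t 1 (y - w) \<partial>M)"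
    by (intro Bochner_Integration.integral_cong) (auto simp: gauss_poly_def power2_eq_square algebra_simps)
  also have "\<dots> = a\<^sup>2 * c - 2 * a * b * b + b\<^sup>2 * a"
    using integrable_gauss_poly[OF t, of _ y] by (simp add: a_def b_def c_def smoothed_def)
  finally have "0 \<le> a * (a * c - b\<^sup>2)" by (simp add: power2_eq_square algebra_simps)
  moreover have "a > 0" unfolding a_def by (rule smoothed_one_pos[OF t])
  ultimately show ?thesis unfolding a_def b_def c_def
    by (simp add: zero_le_mult_iff)
qed

end

text \<open>
  Since \<open>1 + y\<^sup>2 \<le> 2 * (1 + (y - w)\<^sup>2) * (1 + w\<^sup>2)\<close> and the kernel decays faster than any power, a bound on the
  second moment of \<open>\<mu>\<close> gives quadratic decay of the smoothed function, with a constant that does not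
  depend on \<open>\<mu>\<close>. This supplies the dominating functions for all limits of densities below.
\<close>

lemma smoothed_decay:
  assumes t: "t > 0"
  shows "\<exists>C\<ge>0. \<forall>\<mu> y. real_distribution \<mu> \<longrightarrow> integrable \<mu> (\<lambda>w. w\<^sup>2) \<longrightarrow>
     \<bar>smoothed t p \<mu> y\<bar> \<le> C * (1 + (\<integral>w. w\<^sup>2 \<partial>\<mu>)) * inverse (1 + y\<^sup>2)"
proof -
  obtain C where C: "C \<ge> 0" "\<And>z. \<bar>gauss_poly t ([:1, 0, 1:] * p) z\<bar> \<le> C" using gauss_poly_bounded[OF t] by metis
  have *: "\<bar>gauss_poly t p (y - w)\<bar> \<le> 2 * C * inverse (1 + y\<^sup>2) * (1 + w\<^sup>2)" for y w
  proof -
    have pos: "0 < 1 + y\<^sup>2" by (simp add: add_pos_nonneg)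
    have "0 \<le> (y - 2 * w)\<^sup>2 + 1 + 2 * (w * (y - w))\<^sup>2" by simp
    then have "1 + y\<^sup>2 \<le> 2 * (1 + (y - w)\<^sup>2) * (1 + w\<^sup>2)"
      by (simp add: power2_eq_square algebra_simps)
    then have "(1 + y\<^sup>2) * \<bar>gauss_poly t p (y - w)\<bar> \<le> 2 * (1 + (y - w)\<^sup>2) * (1 + w\<^sup>2) * \<bar>gauss_poly t p (y - w)\<bar>"
      by (rule mult_right_mono) simp
    also have "\<dots> = 2 * (1 + w\<^sup>2) * \<bar>gauss_poly t ([:1, 0, 1:] * p) (y - w)\<bar>"
    proof -
      have "gauss_poly t ([:1, 0, 1:] * p) (y - w) = (1 + (y - w)\<^sup>2) * gauss_poly t p (y - w)"
        by (simp add: gauss_poly_def power2_eq_square algebra_simps)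
      then have "\<bar>gauss_poly t ([:1, 0, 1:] * p) (y - w)\<bar> = (1 + (y - w)\<^sup>2) * \<bar>gauss_poly t p (y - w)\<bar>"
        by (simp only: abs_mult) simp
      then show ?thesis by (simp only: mult_ac)
    qed
    also have "\<dots> \<le> 2 * (1 + w\<^sup>2) * C" using C by (intro mult_left_mono) auto
    finally show ?thesis using pos by (simp add: field_simps)
  qed
  have "\<bar>smoothed t p \<mu> y\<bar> \<le> (2 * C) * (1 + (\<integral>w. w\<^sup>2 \<partial>\<mu>)) * inverse (1 + y\<^sup>2)"
    if \<mu>: "real_distribution \<mu>" and int: "integrable \<mu> (\<lambda>w. w\<^sup>2)" for \<mu> y
  proof -
    interpret real_distribution \<mu> by fact
    have "\<bar>smoothed t p \<mu> y\<bar> \<le> (\<integral>w. \<bar>gauss_poly t p (y - w)\<bar> \<partial>\<mu>)"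
      unfolding smoothed_def by (rule integral_abs_bound)
    also have "\<dots> \<le> (\<integral>w. 2 * C * inverse (1 + y\<^sup>2) * (1 + w\<^sup>2) \<partial>\<mu>)"
      using int by (intro integral_mono * integrable_abs integrable_gauss_poly t) auto
    also have "\<dots> = 2 * C * inverse (1 + y\<^sup>2) * (1 + (\<integral>w. w\<^sup>2 \<partial>\<mu>))"
      using int prob_space by simp
    finally show ?thesis by (simp add: algebra_simps)
  qed
  then show ?thesis using C by (intro exI[of _ "2 * C"]) auto
qed

lemma smoothed_tendsto:
  assumes t: "t > 0" and "\<And>n. real_distribution (\<mu> n)" "real_distribution \<nu>" "weak_conv_m \<mu> \<nu>"
  shows "(\<lambda>n. smoothed t p (\<mu> n) y) \<longlonglongrightarrow> smoothed t p \<nu> y"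
proof -
  obtain C where C: "\<And>z. \<bar>gauss_poly t p z\<bar> \<le> C" using gauss_poly_bounded[OF t] by metis
  have "isCont (\<lambda>w. y - w) x" for x by (intro continuous_intros)
  then have cont: "isCont (\<lambda>w. gauss_poly t p (y - w)) x" for x
    using isCont_o2[of x "\<lambda>w. y - w" "gauss_poly t p"] DERIV_isCont[OF gauss_poly_has_deriv[OF t, of p "y - x"]]
    by simp
  have "norm (gauss_poly t p (y - w)) \<le> C" for w using C by simp
  then show ?thesis unfolding smoothed_def
    by (rule weak_conv_imp_integral_bdd_continuous_conv[OF assms(2-4) cont])
qed

section \<open>Fisher information after Gaussian smoothing\<close>

text \<open>
  By independence and translation invariance the law of \<open>W + G\<close> is the mixture of the translates of
  the Gaussian law by the values of \<open>W\<close>; Tonelli's theorem moves the mixture into the density.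
\<close>

lemma (in prob_space) has_smooth_density_add_gaussian:
  assumes t: "t > 0" and indep: "indep_var borel W borel G"
    and G: "distributed M lborel G (\<lambda>z. ennreal (normal_density 0 (sqrt t) z))"
  shows "has_smooth_density M (\<lambda>\<omega>. W \<omega> + G \<omega>) (smoothed t 1 (distr M borel W))"
proof -
  let ?\<mu> = "distr M borel W" and ?\<phi> = "normal_density 0 (sqrt t)"
  have [measurable]: "W \<in> borel_measurable M" "G \<in> borel_measurable M"
    using indep_var_rv1[OF indep] indep_var_rv2[OF indep] by auto
  interpret \<mu>: real_distribution ?\<mu>
    by (rule real_distribution_distr) simp
  have f: "\<And>y. 0 \<le> smoothed t 1 ?\<mu> y" "smooth (smoothed t 1 ?\<mu>)"
    using \<mu>.smoothed_one_pos[OF t] \<mu>.smooth_smoothed[OF t] by (auto simp: less_imp_le)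
  have [measurable]: "smoothed t 1 ?\<mu> \<in> borel_measurable borel"
    using smooth_imp_continuous[OF f(2)] by (rule borel_measurable_continuous_onI)
  have eq: "ennreal (smoothed t 1 ?\<mu> y) = (\<integral>\<^sup>+w. ennreal (?\<phi> (y - w)) \<partial>?\<mu>)" for y
    unfolding smoothed_def
    using nn_integral_eq_integral[OF \<mu>.integrable_gauss_poly[OF t, of 1 y]]
    by (simp add: gauss_poly_def)
  have distrG: "distr M borel G = density lborel (\<lambda>z. ennreal (?\<phi> z))"
    using distributed_distr_eq_density[OF G] by (simp cong: distr_cong)
  interpret P: pair_sigma_finite lborel ?\<mu> ..
  interpret P2: pair_sigma_finite ?\<mu> "density lborel (\<lambda>z. ennreal (?\<phi> z))"
  proof -
    interpret G: prob_space "density lborel (\<lambda>z. ennreal (?\<phi> z))"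
      using prob_space_normal_density[of "sqrt t" 0] t by simp
    show "pair_sigma_finite ?\<mu> (density lborel (\<lambda>z. ennreal (?\<phi> z)))" ..
  qed
  have "distr M lborel (\<lambda>\<omega>. W \<omega> + G \<omega>) = density lborel (\<lambda>y. ennreal (smoothed t 1 ?\<mu> y))"
  proof (rule measure_eqI)
    fix A assume "A \<in> sets (distr M lborel (\<lambda>\<omega>. W \<omega> + G \<omega>))"
    then have [measurable]: "A \<in> sets borel" by simp
    have "emeasure (distr M lborel (\<lambda>\<omega>. W \<omega> + G \<omega>)) A = (\<integral>\<^sup>+y. indicator A y \<partial>distr M lborel (\<lambda>\<omega>. W \<omega> + G \<omega>))"
      by simp
    also have "\<dots> = (\<integral>\<^sup>+\<omega>. indicator A (W \<omega> + G \<omega>) \<partial>M)"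
      by (rule nn_integral_distr) simp_all
    also have "\<dots> = (\<integral>\<^sup>+p. indicator A (fst p + snd p) \<partial>distr M (borel \<Otimes>\<^sub>M borel) (\<lambda>\<omega>. (W \<omega>, G \<omega>)))"
      by (subst nn_integral_distr) simp_all
    also have "distr M (borel \<Otimes>\<^sub>M borel) (\<lambda>\<omega>. (W \<omega>, G \<omega>)) = ?\<mu> \<Otimes>\<^sub>M density lborel (\<lambda>z. ennreal (?\<phi> z))"
      using indep indep_var_distribution_eq[of borel W borel G] distrG by simp
    also have "(\<integral>\<^sup>+p. indicator A (fst p + snd p) \<partial>(?\<mu> \<Otimes>\<^sub>M density lborel (\<lambda>z. ennreal (?\<phi> z)))) =
        (\<integral>\<^sup>+w. \<integral>\<^sup>+z. indicator A (w + z) \<partial>density lborel (\<lambda>z. ennreal (?\<phi> z)) \<partial>?\<mu>)"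
      by (subst P2.M2.nn_integral_fst[symmetric]) simp_all
    also have "\<dots> = (\<integral>\<^sup>+w. \<integral>\<^sup>+z. ennreal (?\<phi> z) * indicator A (w + z) \<partial>lborel \<partial>?\<mu>)"
      by (intro nn_integral_cong) (simp add: nn_integral_density)
    also have "\<dots> = (\<integral>\<^sup>+w. \<integral>\<^sup>+y. ennreal (?\<phi> (y - w)) * indicator A y \<partial>lborel \<partial>?\<mu>)"
    proof (rule nn_integral_cong)
      fix w :: real
      show "(\<integral>\<^sup>+z. ennreal (?\<phi> z) * indicator A (w + z) \<partial>lborel) = (\<integral>\<^sup>+y. ennreal (?\<phi> (y - w)) * indicator A y \<partial>lborel)"
        using nn_integral_real_affine[of "\<lambda>y. ennreal (?\<phi> (y - w)) * indicator A y" 1 w] by simp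
    qed
    also have "\<dots> = (\<integral>\<^sup>+y. \<integral>\<^sup>+w. ennreal (?\<phi> (y - w)) * indicator A y \<partial>?\<mu> \<partial>lborel)"
      by (rule P.Fubini') simp
    also have "\<dots> = (\<integral>\<^sup>+y. ennreal (smoothed t 1 ?\<mu> y) * indicator A y \<partial>lborel)"
      by (intro nn_integral_cong) (simp add: eq nn_integral_multc)
    also have "\<dots> = emeasure (density lborel (\<lambda>y. ennreal (smoothed t 1 ?\<mu> y))) A"
      by (simp add: emeasure_density)
    finally show "emeasure (distr M lborel (\<lambda>\<omega>. W \<omega> + G \<omega>)) A = emeasure (density lborel (\<lambda>y. ennreal (smoothed t 1 ?\<mu> y))) A" .
  qed simp
  then show ?thesis
    using f by (simp add: has_smooth_density_def distributed_def)
qed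

text \<open>
  The Fisher information of the density \<open>f = smoothed t 1 \<mu>\<close>, written as the integral of \<open>(f')\<^sup>2 / f\<close>.
\<close>

definition fisher_integral :: "real \<Rightarrow> real measure \<Rightarrow> real" where
  "fisher_integral t \<mu> =
     (\<integral>y. (smoothed t (gauss_poly_deriv t 1) \<mu> y)\<^sup>2 / smoothed t 1 \<mu> y \<partial>lborel)"

lemma integrable_cauchy_kernel: "integrable lborel (\<lambda>y::real. C * inverse (1 + y\<^sup>2))"
  using integrable_inverse_1_plus_square unfolding set_integrable_def einterval_def by simp

lemma (in real_distribution) smoothed_measurable:
  assumes t: "t > 0"
  shows "smoothed t p M \<in> borel_measurable borel"
  using smooth_imp_continuous[OF smooth_smoothed[OF t]] by (rule borel_measurable_continuous_onI)

lemma (in real_distribution) fisher_integrand_bounds: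
  assumes t: "t > 0"
  shows "0 \<le> (smoothed t (gauss_poly_deriv t 1) M y)\<^sup>2 / smoothed t 1 M y"
    and "(smoothed t (gauss_poly_deriv t 1) M y)\<^sup>2 / smoothed t 1 M y \<le> smoothed t ((gauss_poly_deriv t 1)\<^sup>2) M y"
  using smoothed_deriv_square_le[OF t, of y] smoothed_one_pos[OF t, of y]
  by (simp_all add: divide_le_eq mult.commute)

lemma (in prob_space) fisher_information_add_gaussian:
  assumes t: "t > 0" and indep: "indep_var borel W borel G"
    and G: "distributed M lborel G (\<lambda>z. ennreal (normal_density 0 (sqrt t) z))"
    and W2: "integrable M (\<lambda>\<omega>. (W \<omega>)\<^sup>2)"
  shows "fisher_information M (\<lambda>\<omega>. W \<omega> + G \<omega>) = ennreal (fisher_integral t (distr M borel W))"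
    and "fisher_integral t (distr M borel W) \<ge> 0"
proof -
  let ?V = "\<lambda>\<omega>. W \<omega> + G \<omega>" and ?\<mu> = "distr M borel W"
  define f g where "f = smoothed t 1 ?\<mu>" and "g = smoothed t (gauss_poly_deriv t 1) ?\<mu>"
  have [measurable]: "W \<in> borel_measurable M" using indep_var_rv1[OF indep] by auto
  interpret \<mu>: real_distribution ?\<mu> by (rule real_distribution_distr) simp
  have [measurable]: "f \<in> borel_measurable borel" "g \<in> borel_measurable borel"
    unfolding f_def g_def using \<mu>.smoothed_measurable[OF t] by auto
  have pos: "f y > 0" for y unfolding f_def by (rule \<mu>.smoothed_one_pos[OF t])
  have hsd: "has_smooth_density M ?V f"
    unfolding f_def by (rule has_smooth_density_add_gaussian[OF t indep G])
  have sd: "smooth_density M ?V = f"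
    unfolding smooth_density_def using hsd has_smooth_density_unique[OF _ hsd] by (rule the_equality)
  have score: "score M ?V y = g y / f y" for y
    unfolding score_def sd using DERIV_imp_deriv[OF \<mu>.smoothed_has_deriv[OF t, of 1 y]]
    by (simp add: f_def g_def)
  have dist: "distributed M lborel ?V (\<lambda>y. ennreal (f y))"
    using hsd by (simp add: has_smooth_density_def)
  have \<mu>2: "integrable ?\<mu> (\<lambda>w. w\<^sup>2)" using W2 by (simp add: integrable_distr_eq)
  obtain C where C: "C \<ge> 0" "\<And>\<mu> y. real_distribution \<mu> \<Longrightarrow> integrable \<mu> (\<lambda>w. w\<^sup>2) \<Longrightarrow>
     \<bar>smoothed t ((gauss_poly_deriv t 1)\<^sup>2) \<mu> y\<bar> \<le> C * (1 + (\<integral>w. w\<^sup>2 \<partial>\<mu>)) * inverse (1 + y\<^sup>2)"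
    using smoothed_decay[OF t, of "(gauss_poly_deriv t 1)\<^sup>2"] by metis
  have int: "integrable lborel (\<lambda>y. (g y)\<^sup>2 / f y)"
  proof (rule Bochner_Integration.integrable_bound[OF integrable_cauchy_kernel[of "C * (1 + (\<integral>w. w\<^sup>2 \<partial>?\<mu>))"]])
    show "AE y in lborel. norm ((g y)\<^sup>2 / f y) \<le> norm (C * (1 + (\<integral>w. w\<^sup>2 \<partial>?\<mu>)) * inverse (1 + y\<^sup>2))"
      using \<mu>.fisher_integrand_bounds[OF t, folded f_def g_def] C(2)[OF \<mu>.real_distribution_axioms \<mu>2]
      by (intro always_eventually allI) (smt (verit) real_norm_def)
  qed simp
  have "fisher_information M ?V = (\<integral>\<^sup>+y. ennreal (f y) * ennreal ((g y / f y)\<^sup>2) \<partial>lborel)"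
    unfolding fisher_information_def score
    by (rule distributed_nn_integral[OF dist, symmetric]) simp
  also have "\<dots> = (\<integral>\<^sup>+y. ennreal ((g y)\<^sup>2 / f y) \<partial>lborel)"
  proof (rule nn_integral_cong)
    show "ennreal (f y) * ennreal ((g y / f y)\<^sup>2) = ennreal ((g y)\<^sup>2 / f y)" for y
      using pos[of y] by (simp add: ennreal_mult[symmetric] power2_eq_square)
  qed
  also have "\<dots> = ennreal (\<integral>y. (g y)\<^sup>2 / f y \<partial>lborel)"
    by (rule nn_integral_eq_integral[OF int]) (simp add: pos less_imp_le)
  finally show "fisher_information M (\<lambda>\<omega>. W \<omega> + G \<omega>) = ennreal (fisher_integral t (distr M borel W))"
    by (simp add: fisher_integral_def f_def g_def)
  show "fisher_integral t (distr M borel W) \<ge> 0"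
    unfolding fisher_integral_def f_def[symmetric] g_def[symmetric]
    by (intro integral_nonneg_AE) (simp add: pos less_imp_le)
qed

text \<open>
  Weak convergence gives pointwise convergence of the density and of its derivative, because both
  are integrals of bounded continuous functions. The second-moment bound makes the convergence dominated.
\<close>

lemma fisher_integral_tendsto:
  assumes t: "t > 0" and \<mu>: "\<And>n. real_distribution (\<mu> n)" and \<nu>: "real_distribution \<nu>"
    and conv: "weak_conv_m \<mu> \<nu>"
    and \<mu>2: "\<And>n. integrable (\<mu> n) (\<lambda>w. w\<^sup>2)" "\<And>n. (\<integral>w. w\<^sup>2 \<partial>\<mu> n) \<le> B"
  shows "(\<lambda>n. fisher_integral t (\<mu> n)) \<longlonglongrightarrow> fisher_integral t \<nu>"
  unfolding fisher_integral_def
proof -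
  let ?D = "gauss_poly_deriv t 1"
  obtain C where C: "C \<ge> 0" "\<And>\<mu> y. real_distribution \<mu> \<Longrightarrow> integrable \<mu> (\<lambda>w. w\<^sup>2) \<Longrightarrow>
     \<bar>smoothed t (?D\<^sup>2) \<mu> y\<bar> \<le> C * (1 + (\<integral>w. w\<^sup>2 \<partial>\<mu>)) * inverse (1 + y\<^sup>2)"
    using smoothed_decay[OF t, of "?D\<^sup>2"] by metis
  have meas: "smoothed t p (\<mu> n) \<in> borel_measurable lborel" "smoothed t p \<nu> \<in> borel_measurable lborel" for p n
    using real_distribution.smoothed_measurable[OF \<mu> t] real_distribution.smoothed_measurable[OF \<nu> t] by auto
  show "(\<lambda>n. \<integral>y. (smoothed t ?D (\<mu> n) y)\<^sup>2 / smoothed t 1 (\<mu> n) y \<partial>lborel) \<longlonglongrightarrow>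
      (\<integral>y. (smoothed t ?D \<nu> y)\<^sup>2 / smoothed t 1 \<nu> y \<partial>lborel)"
  proof (rule integral_dominated_convergence[where w = "\<lambda>y. C * (1 + B) * inverse (1 + y\<^sup>2)"])
    show "AE y in lborel. (\<lambda>n. (smoothed t ?D (\<mu> n) y)\<^sup>2 / smoothed t 1 (\<mu> n) y) \<longlonglongrightarrow> (smoothed t ?D \<nu> y)\<^sup>2 / smoothed t 1 \<nu> y"
    proof (intro always_eventually allI tendsto_divide tendsto_power smoothed_tendsto[OF t \<mu> \<nu> conv])
      show "smoothed t 1 \<nu> y \<noteq> 0" for y
        using real_distribution.smoothed_one_pos[OF \<nu> t, of y] by simp
    qed
    show "AE y in lborel. norm ((smoothed t ?D (\<mu> n) y)\<^sup>2 / smoothed t 1 (\<mu> n) y) \<le> C * (1 + B) * inverse (1 + y\<^sup>2)" for n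
    proof (intro always_eventually allI)
      fix y :: real
      have "C * (1 + (\<integral>w. w\<^sup>2 \<partial>\<mu> n)) * inverse (1 + y\<^sup>2) \<le> C * (1 + B) * inverse (1 + y\<^sup>2)"
        using \<mu>2(2)[of n] C(1) by (intro mult_right_mono mult_left_mono) auto
      then show "norm ((smoothed t ?D (\<mu> n) y)\<^sup>2 / smoothed t 1 (\<mu> n) y) \<le> C * (1 + B) * inverse (1 + y\<^sup>2)"
        using real_distribution.fisher_integrand_bounds[OF \<mu> t, of n y] C(2)[OF \<mu> \<mu>2(1), of n y]
        by (smt (verit) real_norm_def)
    qed
    show "integrable lborel (\<lambda>y. C * (1 + B) * inverse (1 + y\<^sup>2))" by (rule integrable_cauchy_kernel)
  qed (intro borel_measurable_divide borel_measurable_power meas)+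
qed

lemma integral_smoothed_tendsto:
  assumes t: "t > 0" and \<mu>: "\<And>n. real_distribution (\<mu> n)" and \<nu>: "real_distribution \<nu>"
    and conv: "weak_conv_m \<mu> \<nu>"
    and \<mu>2: "\<And>n. integrable (\<mu> n) (\<lambda>w. w\<^sup>2)" "\<And>n. (\<integral>w. w\<^sup>2 \<partial>\<mu> n) \<le> B"
    and q: "q \<in> borel_measurable borel" "\<And>y. \<bar>q y\<bar> \<le> b"
  shows "(\<lambda>n. \<integral>y. smoothed t 1 (\<mu> n) y * q y \<partial>lborel) \<longlonglongrightarrow> (\<integral>y. smoothed t 1 \<nu> y * q y \<partial>lborel)"
proof -
  obtain C where C: "C \<ge> 0" "\<And>\<mu> y. real_distribution \<mu> \<Longrightarrow> integrable \<mu> (\<lambda>w. w\<^sup>2) \<Longrightarrow>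
     \<bar>smoothed t 1 \<mu> y\<bar> \<le> C * (1 + (\<integral>w. w\<^sup>2 \<partial>\<mu>)) * inverse (1 + y\<^sup>2)"
    using smoothed_decay[OF t, of 1] by metis
  have b: "b \<ge> 0" using q(2)[of 0] by linarith
  have meas: "smoothed t p (\<mu> n) \<in> borel_measurable lborel" "smoothed t p \<nu> \<in> borel_measurable lborel" for p n
    using real_distribution.smoothed_measurable[OF \<mu> t] real_distribution.smoothed_measurable[OF \<nu> t] by auto
  have qm: "q \<in> borel_measurable lborel" using q(1) by simp
  show ?thesis
  proof (rule integral_dominated_convergence[where w = "\<lambda>y. (C * (1 + B) * b) * inverse (1 + y\<^sup>2)"])
    show "AE y in lborel. (\<lambda>n. smoothed t 1 (\<mu> n) y * q y) \<longlonglongrightarrow> smoothed t 1 \<nu> y * q y"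
      by (intro always_eventually allI tendsto_mult_right smoothed_tendsto[OF t \<mu> \<nu> conv])
    show "AE y in lborel. norm (smoothed t 1 (\<mu> n) y * q y) \<le> (C * (1 + B) * b) * inverse (1 + y\<^sup>2)" for n
    proof (intro always_eventually allI)
      fix y :: real
      have "C * (1 + (\<integral>w. w\<^sup>2 \<partial>\<mu> n)) * inverse (1 + y\<^sup>2) \<le> C * (1 + B) * inverse (1 + y\<^sup>2)"
        using \<mu>2(2)[of n] C(1) by (intro mult_right_mono mult_left_mono) auto
      then have "\<bar>smoothed t 1 (\<mu> n) y\<bar> \<le> C * (1 + B) * inverse (1 + y\<^sup>2)"
        using C(2)[OF \<mu> \<mu>2(1), of n y] by linarith
      then have "\<bar>smoothed t 1 (\<mu> n) y\<bar> * \<bar>q y\<bar> \<le> C * (1 + B) * inverse (1 + y\<^sup>2) * b"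
        using q(2)[of y] by (intro mult_mono) auto
      then show "norm (smoothed t 1 (\<mu> n) y * q y) \<le> (C * (1 + B) * b) * inverse (1 + y\<^sup>2)"
        by (simp add: abs_mult mult_ac)
    qed
    show "integrable lborel (\<lambda>y. (C * (1 + B) * b) * inverse (1 + y\<^sup>2))" by (rule integrable_cauchy_kernel)
  qed (intro borel_measurable_times meas qm)+
qed

text \<open>
  The law \<open>N(0, s\<^sup>2)\<close>, as an image of the standard normal law so that the degenerate case \<open>s = 0\<close> is
  included: the variances of block sums may tend to 0.
\<close>

definition centred_gaussian :: "real \<Rightarrow> real measure" where
  "centred_gaussian s = distr std_normal_distribution borel (\<lambda>x. s * x)"

lemma real_distribution_centred_gaussian: "real_distribution (centred_gaussian s)"
proof -
  interpret std: real_distribution std_normal_distribution by (rule real_dist_normal_dist)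
  show ?thesis unfolding centred_gaussian_def by (rule std.real_distribution_distr) simp
qed

lemma char_centred_gaussian: "char (centred_gaussian s) t = of_real (exp (- (s\<^sup>2 * t\<^sup>2 / 2)))"
proof -
  have "char (centred_gaussian s) t = char std_normal_distribution (t * s)"
    unfolding centred_gaussian_def char_def by (subst integral_distr) (simp_all add: mult.assoc)
  then show ?thesis by (simp add: char_std_normal_distribution power_mult_distrib mult.commute)
qed

lemma smoothed_centred_gaussian:
  assumes t: "t > 0" and s: "s \<ge> 0"
  shows "smoothed t 1 (centred_gaussian s) y = normal_density 0 (sqrt (s\<^sup>2 + t)) y"
proof (cases "s = 0")
  case True
  interpret std: prob_space std_normal_distribution
    using real_dist_normal_dist by (simp add: real_distribution_def)
  show ?thesis using std.prob_space
    by (simp add: True centred_gaussian_def smoothed_def integral_distr gauss_poly_def integral_return)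
next
  case False
  with s have s: "s > 0" by simp
  interpret std: prob_space std_normal_distribution
    using real_dist_normal_dist by (simp add: real_distribution_def)
  have "distributed std_normal_distribution lborel (\<lambda>x. x) std_normal_density"
    by (simp add: distributed_def distr_id2)
  from std.normal_density_affine[OF this _ False, of 0] s
  have D: "distributed std_normal_distribution lborel (\<lambda>x. s * x) (normal_density 0 s)" by simp
  have int: "integrable lborel (\<lambda>w. normal_density 0 s w * gauss_poly t 1 (y - w))"
  proof -
    have "integrable (centred_gaussian s) (\<lambda>w. gauss_poly t 1 (y - w))"
      by (rule real_distribution.integrable_gauss_poly[OF real_distribution_centred_gaussian t])
    then have "integrable std_normal_distribution (\<lambda>x. gauss_poly t 1 (y - s * x))"
      unfolding centred_gaussian_def by (subst (asm) integrable_distr_eq) simp_all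
    then show ?thesis by (subst distributed_integrable[OF D]) simp_all
  qed
  have "smoothed t 1 (centred_gaussian s) y = (\<integral>x. gauss_poly t 1 (y - s * x) \<partial>std_normal_distribution)"
    unfolding smoothed_def centred_gaussian_def by (subst integral_distr) simp_all
  also have "\<dots> = (\<integral>w. normal_density 0 s w * gauss_poly t 1 (y - w) \<partial>lborel)"
    by (rule distributed_integral[OF D, symmetric]) simp_all
  finally have *: "smoothed t 1 (centred_gaussian s) y = \<dots>" .
  have "ennreal (smoothed t 1 (centred_gaussian s) y) = (\<integral>\<^sup>+w. ennreal (normal_density 0 s w * gauss_poly t 1 (y - w)) \<partial>lborel)"
    unfolding * by (rule nn_integral_eq_integral[symmetric, OF int]) (simp add: gauss_poly_def)
  also have "\<dots> = (\<integral>\<^sup>+w. ennreal (normal_density 0 (sqrt t) (y - w) * normal_density 0 s w) \<partial>lborel)"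
    by (simp add: gauss_poly_def mult.commute)
  also have "\<dots> = ennreal (normal_density 0 (sqrt (s\<^sup>2 + t)) y)"
    using fun_cong[OF conv_normal_density_zero_mean[of "sqrt t" s], of y] s t by (simp add: add.commute)
  finally show ?thesis
    using real_distribution.smoothed_one_pos[OF real_distribution_centred_gaussian t, of s y]
    by (simp add: less_imp_le)
qed

lemma fisher_integral_centred_gaussian:
  assumes t: "t > 0" and s: "s \<ge> 0"
  shows "fisher_integral t (centred_gaussian s) = 1 / (s\<^sup>2 + t)"
proof -
  define r where "r = s\<^sup>2 + t"
  have r: "r > 0" using t by (simp add: r_def add_nonneg_pos)
  have f: "smoothed t 1 (centred_gaussian s) = normal_density 0 (sqrt r)"
    unfolding r_def by (rule ext) (rule smoothed_centred_gaussian[OF t s])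
  have "smoothed t (gauss_poly_deriv t 1) (centred_gaussian s) y = - (y / r) * normal_density 0 (sqrt r) y" for y
  proof (rule DERIV_unique)
    show "(normal_density 0 (sqrt r) has_real_derivative smoothed t (gauss_poly_deriv t 1) (centred_gaussian s) y) (at y)"
      unfolding f[symmetric] by (rule real_distribution.smoothed_has_deriv[OF real_distribution_centred_gaussian t])
    show "(normal_density 0 (sqrt r) has_real_derivative - (y / r) * normal_density 0 (sqrt r) y) (at y)"
      using gauss_poly_has_deriv[OF r, of 1 y] by (simp add: gauss_poly_def[abs_def] gauss_poly_deriv_def)
  qed
  then have g: "smoothed t (gauss_poly_deriv t 1) (centred_gaussian s) = (\<lambda>y. - (y / r) * normal_density 0 (sqrt r) y)" by auto
  have "(- (y / r) * normal_density 0 (sqrt r) y)\<^sup>2 / normal_density 0 (sqrt r) y =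
      (1 / r\<^sup>2) * (normal_density 0 (sqrt r) y * (y - 0) ^ (2 * 1))" for y
    using normal_density_pos[of "sqrt r" 0 y] r by (simp add: power2_eq_square field_simps)
  then have "fisher_integral t (centred_gaussian s) = (\<integral>y. (1 / r\<^sup>2) * (normal_density 0 (sqrt r) y * (y - 0) ^ (2 * 1)) \<partial>lborel)"
    unfolding fisher_integral_def f g by (simp only:)
  also have "\<dots> = (1 / r\<^sup>2) * r"
    using integral_normal_moment_even[of "sqrt r" 0 1] r by (simp add: fact_numeral)
  finally show ?thesis using r unfolding r_def[symmetric] by (simp add: power2_eq_square)
qed

section \<open>Covariance inequalities under FKG\<close>

lemma square_integrable_mult:
  fixes f g :: "'a \<Rightarrow> real"
  assumes [measurable]: "f \<in> borel_measurable M" "g \<in> borel_measurable M"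
    and "integrable M (\<lambda>x. (f x)\<^sup>2)" "integrable M (\<lambda>x. (g x)\<^sup>2)"
  shows "integrable M (\<lambda>x. f x * g x)"
proof (rule Bochner_Integration.integrable_bound[OF Bochner_Integration.integrable_add[OF assms(3,4)]])
  show "AE x in M. norm (f x * g x) \<le> norm ((f x)\<^sup>2 + (g x)\<^sup>2)"
  proof (intro always_eventually allI)
    fix x
    have "0 \<le> (\<bar>f x\<bar> - \<bar>g x\<bar>)\<^sup>2" "0 \<le> \<bar>f x\<bar> * \<bar>g x\<bar>" by simp_all
    then have "\<bar>f x\<bar> * \<bar>g x\<bar> \<le> (f x)\<^sup>2 + (g x)\<^sup>2" unfolding power2_diff power2_abs by linarith
    then show "norm (f x * g x) \<le> norm ((f x)\<^sup>2 + (g x)\<^sup>2)" by (simp add: abs_mult)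
  qed
qed simp

lemma square_integrable_add:
  fixes f g :: "'a \<Rightarrow> real"
  assumes [measurable]: "f \<in> borel_measurable M" "g \<in> borel_measurable M"
    and "integrable M (\<lambda>x. (f x)\<^sup>2)" "integrable M (\<lambda>x. (g x)\<^sup>2)"
  shows "integrable M (\<lambda>x. (f x + g x)\<^sup>2)"
  using assms(3,4) square_integrable_mult[OF assms]
  by (simp add: power2_sum mult.assoc)

lemma square_integrable_sum:
  fixes f :: "'i \<Rightarrow> 'a \<Rightarrow> real"
  assumes "\<And>i. i \<in> I \<Longrightarrow> f i \<in> borel_measurable M" "\<And>i. i \<in> I \<Longrightarrow> integrable M (\<lambda>x. (f i x)\<^sup>2)"
  shows "integrable M (\<lambda>x. (\<Sum>i\<in>I. f i x)\<^sup>2)"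
  using assms
proof (induction I rule: infinite_finite_induct)
  case (insert i I)
  then show ?case by (auto intro!: square_integrable_add)
qed auto

context prob_space
begin

lemma covariance_eq:
  assumes "f \<in> borel_measurable M" "g \<in> borel_measurable M"
    and "integrable M (\<lambda>x. (f x)\<^sup>2)" "integrable M (\<lambda>x. (g x)\<^sup>2)"
  shows "covariance M f g = expectation (\<lambda>x. f x * g x) - expectation f * expectation g"
proof -
  have [simp]: "integrable M f" "integrable M g"
    using square_integrable_imp_integrable assms by blast+
  have [simp]: "integrable M (\<lambda>x. f x * g x)" by (rule square_integrable_mult[OF assms])
  show ?thesis unfolding covariance_def
    by (simp add: left_diff_distrib right_diff_distrib prob_space)
qed

lemma covariance_add_left:
  assumes "f \<in> borel_measurable M" "g \<in> borel_measurable M" "h \<in> borel_measurable M"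
    and "integrable M (\<lambda>x. (f x)\<^sup>2)" "integrable M (\<lambda>x. (g x)\<^sup>2)" "integrable M (\<lambda>x. (h x)\<^sup>2)"
  shows "covariance M (\<lambda>x. f x + g x) h = covariance M f h + covariance M g h"
proof -
  have "integrable M f" "integrable M g" "integrable M h"
    using square_integrable_imp_integrable assms by blast+
  moreover have "integrable M (\<lambda>x. f x * h x)" "integrable M (\<lambda>x. g x * h x)"
    using square_integrable_mult assms by blast+
  ultimately show ?thesis using assms
    by (simp add: covariance_eq square_integrable_add algebra_simps)
qed

lemma covariance_commute: "covariance M f g = covariance M g f"
  unfolding covariance_def by (simp add: mult.commute)

lemma covariance_add_right:
  assumes "f \<in> borel_measurable M" "g \<in> borel_measurable M" "h \<in> borel_measurable M"
    and "integrable M (\<lambda>x. (f x)\<^sup>2)" "integrable M (\<lambda>x. (g x)\<^sup>2)" "integrable M (\<lambda>x. (h x)\<^sup>2)"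
  shows "covariance M h (\<lambda>x. f x + g x) = covariance M h f + covariance M h g"
  using covariance_add_left[OF assms] by (simp add: covariance_commute)

lemma covariance_scale_left: "covariance M (\<lambda>x. c * f x) g = c * covariance M f g"
proof -
  have "(c * f x - c * expectation f) * (g x - expectation g) = c * ((f x - expectation f) * (g x - expectation g))" for x
    by (simp only: right_diff_distrib[symmetric] mult.assoc)
  then show ?thesis unfolding covariance_def by (simp only: integral_mult_right_zero)
qed

lemma covariance_scale_right: "covariance M g (\<lambda>x. c * f x) = c * covariance M g f"
  using covariance_scale_left covariance_commute by metis

lemma covariance_sum_left:
  assumes "\<And>i. i \<in> I \<Longrightarrow> f i \<in> borel_measurable M" "\<And>i. i \<in> I \<Longrightarrow> integrable M (\<lambda>x. (f i x)\<^sup>2)"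
    and "g \<in> borel_measurable M" "integrable M (\<lambda>x. (g x)\<^sup>2)"
  shows "covariance M (\<lambda>x. \<Sum>i\<in>I. f i x) g = (\<Sum>i\<in>I. covariance M (f i) g)"
  using assms(1,2)
proof (induction I rule: infinite_finite_induct)
  case (insert i I)
  have "covariance M (\<lambda>x. f i x + (\<Sum>i\<in>I. f i x)) g = covariance M (f i) g + covariance M (\<lambda>x. \<Sum>i\<in>I. f i x) g"
    using insert.prems assms(3,4) by (intro covariance_add_left square_integrable_sum) auto
  with insert show ?case by simp
qed (simp_all add: covariance_def)

lemma covariance_sum_sum:
  assumes "\<And>i. i \<in> I \<Longrightarrow> f i \<in> borel_measurable M" "\<And>i. i \<in> I \<Longrightarrow> integrable M (\<lambda>x. (f i x)\<^sup>2)"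
    and "\<And>j. j \<in> J \<Longrightarrow> g j \<in> borel_measurable M" "\<And>j. j \<in> J \<Longrightarrow> integrable M (\<lambda>x. (g j x)\<^sup>2)"
  shows "covariance M (\<lambda>x. \<Sum>i\<in>I. a i * f i x) (\<lambda>x. \<Sum>j\<in>J. b j * g j x) =
    (\<Sum>i\<in>I. \<Sum>j\<in>J. a i * b j * covariance M (f i) (g j))"
proof -
  have g: "(\<lambda>x. \<Sum>j\<in>J. b j * g j x) \<in> borel_measurable M" "integrable M (\<lambda>x. (\<Sum>j\<in>J. b j * g j x)\<^sup>2)"
    using assms(3,4) by (auto intro!: square_integrable_sum simp: power_mult_distrib)
  have "covariance M (\<lambda>x. \<Sum>i\<in>I. a i * f i x) (\<lambda>x. \<Sum>j\<in>J. b j * g j x) =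
      (\<Sum>i\<in>I. covariance M (\<lambda>x. a i * f i x) (\<lambda>x. \<Sum>j\<in>J. b j * g j x))"
    using assms(1,2) g by (intro covariance_sum_left) (auto simp: power_mult_distrib)
  also have "\<dots> = (\<Sum>i\<in>I. \<Sum>j\<in>J. covariance M (\<lambda>x. a i * f i x) (\<lambda>x. b j * g j x))"
  proof (rule sum.cong[OF refl])
    fix i assume "i \<in> I"
    then show "covariance M (\<lambda>x. a i * f i x) (\<lambda>x. \<Sum>j\<in>J. b j * g j x) =
        (\<Sum>j\<in>J. covariance M (\<lambda>x. a i * f i x) (\<lambda>x. b j * g j x))"
      unfolding covariance_commute[of "\<lambda>x. a i * f i x"]
      using assms by (intro covariance_sum_left) (auto simp: power_mult_distrib)
  qed
  finally show ?thesis by (simp add: covariance_scale_left covariance_scale_right mult.assoc)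
qed

end

lemma FKG_increasing_transform:
  fixes X :: "'i \<Rightarrow> 'a \<Rightarrow> real"
  assumes FKG: "FKG M X" and "mono g" and [measurable]: "g \<in> borel_measurable borel"
  shows "FKG M (\<lambda>u \<omega>. g (X u \<omega>))"
  unfolding FKG_def FKG_on_def
proof (intro allI impI)
  fix S and F G :: "('i \<Rightarrow> real) \<Rightarrow> real"
  assume S: "finite S"
    and [measurable]: "F \<in> borel_measurable (\<Pi>\<^sub>M i\<in>S. borel)" "G \<in> borel_measurable (\<Pi>\<^sub>M i\<in>S. borel)"
    and mono: "mono_on (S \<rightarrow>\<^sub>E UNIV) F" "mono_on (S \<rightarrow>\<^sub>E UNIV) G"
    and int: "integrable M (\<lambda>\<omega>. F (\<lambda>i\<in>S. g (X i \<omega>)))" "integrable M (\<lambda>\<omega>. G (\<lambda>i\<in>S. g (X i \<omega>)))"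
      "integrable M (\<lambda>\<omega>. F (\<lambda>i\<in>S. g (X i \<omega>)) * G (\<lambda>i\<in>S. g (X i \<omega>)))"
  let ?h = "\<lambda>H x. H (\<lambda>i\<in>S. g (x i))"
  have meas: "?h H \<in> borel_measurable (\<Pi>\<^sub>M i\<in>S. borel)"
    if [measurable]: "H \<in> borel_measurable (\<Pi>\<^sub>M i\<in>S. borel)" for H :: "('i \<Rightarrow> real) \<Rightarrow> real"
    by measurable
  have hmono: "mono_on (S \<rightarrow>\<^sub>E UNIV) (?h H)" if H: "mono_on (S \<rightarrow>\<^sub>E UNIV) H" for H :: "('i \<Rightarrow> real) \<Rightarrow> real"
  proof (rule mono_onI)
    fix x y :: "'i \<Rightarrow> real" assume "x \<le> y"
    then have "(\<lambda>i\<in>S. g (x i)) \<le> (\<lambda>i\<in>S. g (y i))"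
      using \<open>mono g\<close> by (auto simp: le_fun_def monoD)
    then show "?h H x \<le> ?h H y" by (intro mono_onD[OF H]) auto
  qed
  have r: "(\<lambda>i\<in>S. g ((\<lambda>i\<in>S. X i \<omega>) i)) = (\<lambda>i\<in>S. g (X i \<omega>))" for \<omega> by auto
  have "FKG_on M S X" using FKG S by (simp add: FKG_def)
  from this[unfolded FKG_on_def, rule_format, of "?h F" "?h G"]
  show "0 \<le> covariance M (\<lambda>\<omega>. F (\<lambda>i\<in>S. g (X i \<omega>))) (\<lambda>\<omega>. G (\<lambda>i\<in>S. g (X i \<omega>)))"
    unfolding r using meas hmono mono int by simp
qed

text \<open>
  If \<open>f\<close> is dominated by the weights \<open>a\<close>, the linear function with coefficients \<open>a\<close> stays
  increasing after \<open>f\<close> is added to it or subtracted from it. This is what the FKG inequalities can use.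
\<close>

definition dominated_on :: "'i set \<Rightarrow> ('i \<Rightarrow> real) \<Rightarrow> (('i \<Rightarrow> real) \<Rightarrow> real) \<Rightarrow> bool" where
  "dominated_on S a f \<longleftrightarrow>
     (\<forall>x\<in>S \<rightarrow>\<^sub>E UNIV. \<forall>y\<in>S \<rightarrow>\<^sub>E UNIV. x \<le> y \<longrightarrow> \<bar>f y - f x\<bar> \<le> (\<Sum>u\<in>S. a u * (y u - x u)))"

text \<open>
  With \<open>L\<^sub>a\<close> and \<open>L\<^sub>b\<close> the dominating linear functions, FKG applies to \<open>L\<^sub>a + f\<close> and \<open>L\<^sub>b + g\<close>, and to
  \<open>L\<^sub>a - f\<close> and \<open>L\<^sub>b - g\<close>. Adding the two covariances cancels the mixed terms and leaves
  \<open>Cov(f, g) \<ge> - Cov(L\<^sub>a, L\<^sub>b)\<close>; the two opposite choices of sign give the upper bound.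
\<close>

lemma (in prob_space) FKG_covariance_dominated:
  fixes \<xi> :: "'i \<Rightarrow> 'a \<Rightarrow> real"
  assumes FKG: "FKG M \<xi>" and S: "finite S"
    and \<xi>[measurable]: "\<And>u. \<xi> u \<in> borel_measurable M" and \<xi>2: "\<And>u. integrable M (\<lambda>\<omega>. (\<xi> u \<omega>)\<^sup>2)"
    and f: "dominated_on S a f" "f \<in> borel_measurable (\<Pi>\<^sub>M i\<in>S. borel)"
      "integrable M (\<lambda>\<omega>. (f (\<lambda>i\<in>S. \<xi> i \<omega>))\<^sup>2)"
    and g: "dominated_on S b g" "g \<in> borel_measurable (\<Pi>\<^sub>M i\<in>S. borel)"
      "integrable M (\<lambda>\<omega>. (g (\<lambda>i\<in>S. \<xi> i \<omega>))\<^sup>2)"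
  shows "\<bar>covariance M (\<lambda>\<omega>. f (\<lambda>i\<in>S. \<xi> i \<omega>)) (\<lambda>\<omega>. g (\<lambda>i\<in>S. \<xi> i \<omega>))\<bar>
    \<le> (\<Sum>u\<in>S. \<Sum>v\<in>S. a u * b v * covariance M (\<xi> u) (\<xi> v))"
proof -
  define L where "L a x = (\<Sum>u\<in>S. a u * x u)" for a x :: "'i \<Rightarrow> real"
  have [measurable]: "L a \<in> borel_measurable (\<Pi>\<^sub>M i\<in>S. borel)" for a unfolding L_def by measurable
  note [measurable] = f(2) g(2)
  let ?r = "\<lambda>F \<omega>. F (\<lambda>i\<in>S. \<xi> i \<omega>) :: real"
  have rm: "?r F \<in> borel_measurable M" if [measurable]: "F \<in> borel_measurable (\<Pi>\<^sub>M i\<in>S. borel)" for F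
    by measurable
  have rL: "?r (L a) \<omega> = (\<Sum>u\<in>S. a u * \<xi> u \<omega>)" for a \<omega> by (auto simp: L_def)
  have L2: "integrable M (\<lambda>\<omega>. (?r (L a) \<omega>)\<^sup>2)" for a
    unfolding rL using \<xi>2 by (intro square_integrable_sum) (auto simp: power_mult_distrib)
  have up: "mono_on (S \<rightarrow>\<^sub>E UNIV) (\<lambda>x. L c x + e * h x)" if h: "dominated_on S c h" and e: "\<bar>e\<bar> = 1" for c h e
  proof (rule mono_onI)
    fix x y :: "'i \<Rightarrow> real" assume xy: "x \<in> S \<rightarrow>\<^sub>E UNIV" "y \<in> S \<rightarrow>\<^sub>E UNIV" "x \<le> y"
    have "\<bar>h y - h x\<bar> \<le> (\<Sum>u\<in>S. c u * (y u - x u))"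
      using h xy by (simp add: dominated_on_def)
    also have "\<dots> = L c y - L c x" by (simp add: L_def right_diff_distrib sum_subtractf)
    finally have "\<bar>h y - h x\<bar> \<le> L c y - L c x" .
    moreover have "e = 1 \<or> e = -1" using e by linarith
    ultimately show "L c x + e * h x \<le> L c y + e * h y" by auto
  qed
  have *: "0 \<le> covariance M (\<lambda>\<omega>. ?r (L a) \<omega> + e * ?r f \<omega>) (\<lambda>\<omega>. ?r (L b) \<omega> + e' * ?r g \<omega>)"
    if e: "\<bar>e\<bar> = 1" "\<bar>e'\<bar> = 1" for e e'
  proof -
    have F2: "integrable M (\<lambda>\<omega>. (?r (L a) \<omega> + e * ?r f \<omega>)\<^sup>2)"
      using f(3) L2 by (intro square_integrable_add) (auto simp: power_mult_distrib intro!: rm)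
    have G2: "integrable M (\<lambda>\<omega>. (?r (L b) \<omega> + e' * ?r g \<omega>)\<^sup>2)"
      using g(3) L2 by (intro square_integrable_add) (auto simp: power_mult_distrib intro!: rm)
    have Fm: "(\<lambda>\<omega>. ?r (L a) \<omega> + e * ?r f \<omega>) \<in> borel_measurable M" and Gm: "(\<lambda>\<omega>. ?r (L b) \<omega> + e' * ?r g \<omega>) \<in> borel_measurable M"
      by measurable
    have "FKG_on M S \<xi>" using FKG S by (simp add: FKG_def)
    from this[unfolded FKG_on_def, rule_format, of "\<lambda>x. L a x + e * f x" "\<lambda>x. L b x + e' * g x"]
    show ?thesis
      using up[OF f(1) e(1)] up[OF g(1) e(2)] square_integrable_mult[OF Fm Gm F2 G2]
        square_integrable_imp_integrable[OF Fm F2] square_integrable_imp_integrable[OF Gm G2] by simp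
  qed
  have expand: "covariance M (\<lambda>\<omega>. ?r (L a) \<omega> + e * ?r f \<omega>) (\<lambda>\<omega>. ?r (L b) \<omega> + e' * ?r g \<omega>) =
      covariance M (?r (L a)) (?r (L b)) + e' * covariance M (?r (L a)) (?r g)
      + e * covariance M (?r f) (?r (L b)) + e * e' * covariance M (?r f) (?r g)" for e e'
  proof -
    have i: "integrable M (\<lambda>\<omega>. (e * ?r f \<omega>)\<^sup>2)" "integrable M (\<lambda>\<omega>. (e' * ?r g \<omega>)\<^sup>2)"
      using f(3) g(3) by (simp_all add: power_mult_distrib)
    have m: "(\<lambda>\<omega>. e * ?r f \<omega>) \<in> borel_measurable M" "(\<lambda>\<omega>. e' * ?r g \<omega>) \<in> borel_measurable M"
      "?r (L a) \<in> borel_measurable M" "?r (L b) \<in> borel_measurable M" by measurable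
    have "(\<lambda>\<omega>. ?r (L b) \<omega> + e' * ?r g \<omega>) \<in> borel_measurable M" by measurable
    then show ?thesis
      using covariance_add_left[of "?r (L a)" "\<lambda>\<omega>. e * ?r f \<omega>" "\<lambda>\<omega>. ?r (L b) \<omega> + e' * ?r g \<omega>"]
        covariance_add_right[of "?r (L b)" "\<lambda>\<omega>. e' * ?r g \<omega>" "?r (L a)"]
        covariance_add_right[of "?r (L b)" "\<lambda>\<omega>. e' * ?r g \<omega>" "\<lambda>\<omega>. e * ?r f \<omega>"]
        square_integrable_add[OF m(4,2) L2 i(2)] m i L2
      by (simp add: covariance_scale_left covariance_scale_right)
  qed
  have "covariance M (?r (L a)) (?r (L b)) = (\<Sum>u\<in>S. \<Sum>v\<in>S. a u * b v * covariance M (\<xi> u) (\<xi> v))"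
    unfolding rL using \<xi>2 by (intro covariance_sum_sum) auto
  then show ?thesis
    using *[of 1 1, unfolded expand] *[of "-1" "-1", unfolded expand]
      *[of 1 "-1", unfolded expand] *[of "-1" 1, unfolded expand] by simp
qed

lemma (in prob_space) expectation_abs_le_sqrt:
  assumes [measurable]: "Y \<in> borel_measurable M" and Y2: "integrable M (\<lambda>\<omega>. (Y \<omega>)\<^sup>2)"
  shows "expectation (\<lambda>\<omega>. \<bar>Y \<omega>\<bar>) \<le> sqrt (expectation (\<lambda>\<omega>. (Y \<omega>)\<^sup>2))"
proof (rule real_le_rsqrt)
  have "integrable M Y" by (rule square_integrable_imp_integrable[OF _ Y2]) simp
  then have "0 \<le> expectation (\<lambda>\<omega>. (\<bar>Y \<omega>\<bar>)\<^sup>2) - (expectation (\<lambda>\<omega>. \<bar>Y \<omega>\<bar>))\<^sup>2"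
    using variance_positive[of "\<lambda>\<omega>. \<bar>Y \<omega>\<bar>"] Y2 by (subst variance_eq[symmetric]) simp_all
  then show "(expectation (\<lambda>\<omega>. \<bar>Y \<omega>\<bar>))\<^sup>2 \<le> expectation (\<lambda>\<omega>. (Y \<omega>)\<^sup>2)" by simp
qed

lemma (in prob_space) FKG_covariance_Lipschitz_sum:
  fixes \<xi> :: "'i \<Rightarrow> 'a \<Rightarrow> real" and g :: "real \<Rightarrow> real"
  assumes FKG: "FKG M \<xi>" and A: "finite A"
    and \<xi>[measurable]: "\<And>u. \<xi> u \<in> borel_measurable M" and \<xi>2: "\<And>u. integrable M (\<lambda>\<omega>. (\<xi> u \<omega>)\<^sup>2)"
    and lip: "\<And>x y. \<bar>g x - g y\<bar> \<le> L * \<bar>x - y\<bar>" and L: "L \<ge> 0"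
    and [measurable]: "g \<in> borel_measurable borel"
    and g2: "integrable M (\<lambda>\<omega>. (g (\<Sum>v\<in>A. \<xi> v \<omega>))\<^sup>2)"
  shows "\<bar>covariance M (\<xi> u) (\<lambda>\<omega>. g (\<Sum>v\<in>A. \<xi> v \<omega>))\<bar> \<le> L * (\<Sum>v\<in>A. covariance M (\<xi> u) (\<xi> v))"
proof -
  let ?S = "insert u A"
  define f h where "f x = (x u :: real)" and "h x = g (\<Sum>v\<in>A. x v)" for x :: "'i \<Rightarrow> real"
  define a b where "a w = (of_bool (w = u) :: real)" and "b w = L * of_bool (w \<in> A)" for w
  have S: "finite ?S" using A by simp
  have sa: "(\<Sum>w\<in>?S. a w * k w) = k u" for k :: "'i \<Rightarrow> real"
    using S by (simp add: a_def sum.delta if_distrib[of "\<lambda>x. x * _"] flip: of_bool_def cong: if_cong)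
  have sb: "(\<Sum>w\<in>?S. b w * k w) = L * (\<Sum>w\<in>A. k w)" for k :: "'i \<Rightarrow> real"
  proof -
    have "(\<Sum>w\<in>?S. b w * k w) = (\<Sum>w\<in>A. b w * k w)"
      using A by (intro sum.mono_neutral_right) (auto simp: b_def)
    then show ?thesis by (simp add: b_def sum_distrib_left)
  qed
  have df: "dominated_on ?S a f"
    unfolding dominated_on_def sa by (simp add: f_def le_fun_def)
  have dh: "dominated_on ?S b h"
    unfolding dominated_on_def sb
  proof (intro ballI impI)
    fix x y :: "'i \<Rightarrow> real" assume "x \<le> y"
    then have "0 \<le> (\<Sum>v\<in>A. y v - x v)" by (intro sum_nonneg) (simp add: le_fun_def)
    then show "\<bar>h y - h x\<bar> \<le> L * (\<Sum>v\<in>A. y v - x v)"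
      using lip[of "\<Sum>v\<in>A. y v" "\<Sum>v\<in>A. x v"] by (simp add: h_def sum_subtractf)
  qed
  have fm: "f \<in> borel_measurable (\<Pi>\<^sub>M i\<in>?S. borel)" unfolding f_def by measurable
  have hm: "h \<in> borel_measurable (\<Pi>\<^sub>M i\<in>?S. borel)" unfolding h_def by measurable
  have rf: "f (\<lambda>i\<in>?S. \<xi> i \<omega>) = \<xi> u \<omega>" for \<omega> by (simp add: f_def)
  have rh: "h (\<lambda>i\<in>?S. \<xi> i \<omega>) = g (\<Sum>v\<in>A. \<xi> v \<omega>)" for \<omega> by (auto simp: h_def intro!: arg_cong[of _ _ g] sum.cong)
  have "\<bar>covariance M (\<xi> u) (\<lambda>\<omega>. g (\<Sum>v\<in>A. \<xi> v \<omega>))\<bar>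
      \<le> (\<Sum>w\<in>?S. \<Sum>v\<in>?S. a w * b v * covariance M (\<xi> w) (\<xi> v))"
    using FKG_covariance_dominated[OF FKG S \<xi> \<xi>2 df fm _ dh hm] \<xi>2 g2 unfolding rf rh by simp
  also have "\<dots> = L * (\<Sum>v\<in>A. covariance M (\<xi> u) (\<xi> v))"
    by (simp add: mult.assoc sum_distrib_left[symmetric] sa sb)
  finally show ?thesis .
qed

lemma (in prob_space) FKG_covariance_nonneg:
  fixes \<xi> :: "'i \<Rightarrow> 'a \<Rightarrow> real"
  assumes "FKG M \<xi>" "\<And>u. \<xi> u \<in> borel_measurable M" "\<And>u. integrable M (\<lambda>\<omega>. (\<xi> u \<omega>)\<^sup>2)"
  shows "0 \<le> covariance M (\<xi> u) (\<xi> v)"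
  using FKG_covariance_Lipschitz_sum[of \<xi> "{v}" "\<lambda>x. x" 1 u] assms by force

section \<open>The characteristic function of block sums of a bounded field\<close>

text \<open>
  Multiplying \<open>\<phi>\<close> by \<open>exp (r * s\<^sup>2 / 2)\<close> turns the left-hand side of the approximate differential equation
  into a derivative, which the mean value inequality integrates from \<open>0\<close> to \<open>t\<close>.
\<close>

lemma gaussian_ode_stability:
  fixes \<phi> :: "real \<Rightarrow> complex"
  assumes deriv: "\<And>s. (\<phi> has_vector_derivative \<phi>' s) (at s)"
    and \<phi>0: "\<phi> 0 = 1" and r: "r \<ge> 0"
    and err: "\<And>s. \<bar>s\<bar> \<le> \<bar>t\<bar> \<Longrightarrow> norm (\<phi>' s + (s * r) *\<^sub>R \<phi> s) \<le> E"
  shows "norm (\<phi> t - of_real (exp (- (r * t\<^sup>2 / 2)))) \<le> \<bar>t\<bar> * E"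
proof -
  define \<psi> where "\<psi> s = exp (r * s\<^sup>2 / 2) *\<^sub>R \<phi> s" for s
  define \<psi>' where "\<psi>' s = exp (r * s\<^sup>2 / 2) *\<^sub>R (\<phi>' s + (s * r) *\<^sub>R \<phi> s)" for s
  let ?S = "closed_segment 0 t"
  have abs: "\<bar>s\<bar> \<le> \<bar>t\<bar>" if "s \<in> ?S" for s using that by (auto simp: closed_segment_eq_real_ivl split: if_splits)
  have d: "(\<psi> has_vector_derivative \<psi>' s) (at s within ?S)" for s
  proof -
    have "((\<lambda>s. exp (r * s\<^sup>2 / 2)) has_real_derivative exp (r * s\<^sup>2 / 2) * (s * r)) (at s)"
      by (auto intro!: derivative_eq_intros)
    from has_vector_derivative_scaleR[OF this deriv[of s]]
    have "(\<psi> has_vector_derivative \<psi>' s) (at s)"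
      unfolding \<psi>_def[abs_def] \<psi>'_def by (simp add: scaleR_add_right)
    then show ?thesis by (rule has_vector_derivative_at_within)
  qed
  have "norm (\<psi> t - \<psi> 0) \<le> (exp (r * t\<^sup>2 / 2) * E) * norm (t - 0)"
  proof (rule differentiable_bound[of ?S \<psi> "\<lambda>s h. h *\<^sub>R \<psi>' s"])
    fix s assume s: "s \<in> ?S"
    show "(\<psi> has_derivative (\<lambda>h. h *\<^sub>R \<psi>' s)) (at s within ?S)"
      using d by (simp add: has_vector_derivative_def)
    show "onorm (\<lambda>h. h *\<^sub>R \<psi>' s) \<le> exp (r * t\<^sup>2 / 2) * E"
    proof (rule onorm_le)
      fix h :: real
      have "norm (\<psi>' s) \<le> exp (r * t\<^sup>2 / 2) * E"
        unfolding \<psi>'_def norm_scaleR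
      proof (rule mult_mono)
        have "s\<^sup>2 \<le> t\<^sup>2" using abs[OF s] by (rule abs_le_square_iff[THEN iffD1])
        then show "\<bar>exp (r * s\<^sup>2 / 2)\<bar> \<le> exp (r * t\<^sup>2 / 2)" using r by (simp add: mult_left_mono)
      qed (use err[OF abs[OF s]] in auto)
      then show "norm (h *\<^sub>R \<psi>' s) \<le> exp (r * t\<^sup>2 / 2) * E * norm h"
        by (simp add: mult.commute mult_left_mono)
    qed
  qed (use convex_closed_segment in auto)
  then have b: "norm (\<psi> t - 1) \<le> exp (r * t\<^sup>2 / 2) * E * \<bar>t\<bar>" by (simp add: \<psi>_def \<phi>0)
  have "exp (- (r * t\<^sup>2 / 2)) *\<^sub>R (\<psi> t - 1) = \<phi> t - of_real (exp (- (r * t\<^sup>2 / 2)))"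
    by (simp add: \<psi>_def exp_minus scaleR_conv_of_real field_simps)
  then have "norm (\<phi> t - of_real (exp (- (r * t\<^sup>2 / 2)))) = exp (- (r * t\<^sup>2 / 2)) * norm (\<psi> t - 1)"
    by (metis abs_exp_cancel norm_scaleR)
  also have "\<dots> \<le> exp (- (r * t\<^sup>2 / 2)) * (exp (r * t\<^sup>2 / 2) * E * \<bar>t\<bar>)"
    using b by (intro mult_left_mono) auto
  also have "\<dots> = \<bar>t\<bar> * E" by (simp add: exp_minus)
  finally show ?thesis .
qed

text \<open>
  The covariances are compared with a summable function \<open>c\<close> of the lag. Summability is expressed through
  its finite sums: a bound \<open>v\<close> on all of them, and smallness of those that avoid a suitable finite set.
\<close>

locale bounded_FKG_field = prob_space M for M :: "'a measure" +
  fixes \<xi> :: "'i::ab_group_add \<Rightarrow> 'a \<Rightarrow> real" and K :: real and c :: "'i \<Rightarrow> real" and v :: real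
  assumes \<xi>_measurable [measurable]: "\<And>u. \<xi> u \<in> borel_measurable M"
    and \<xi>_bounded: "\<And>u \<omega>. \<bar>\<xi> u \<omega>\<bar> \<le> K"
    and \<xi>_centred: "\<And>u. expectation (\<xi> u) = 0"
    and \<xi>_FKG: "FKG M \<xi>"
    and \<xi>_cov: "\<And>u v. covariance M (\<xi> u) (\<xi> v) \<le> c (v - u)"
    and c_sum: "\<And>F. finite F \<Longrightarrow> sum c F \<le> v"
    and c_tail: "\<And>\<epsilon>. \<epsilon> > 0 \<Longrightarrow> \<exists>H. finite H \<and> (\<forall>F. finite F \<longrightarrow> F \<inter> H = {} \<longrightarrow> sum c F \<le> \<epsilon>)"
begin

lemma K_nonneg: "K \<ge> 0" using \<xi>_bounded[of 0 undefined] by linarith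

lemma \<xi>_square_integrable: "integrable M (\<lambda>\<omega>. (\<xi> u \<omega>)\<^sup>2)"
  using \<xi>_bounded abs_le_square_iff[of "\<xi> u _" K] K_nonneg by (intro integrable_const_bound[of _ "K\<^sup>2"]) auto

lemma cov_nonneg: "0 \<le> covariance M (\<xi> u) (\<xi> w)"
  by (rule FKG_covariance_nonneg[OF \<xi>_FKG \<xi>_measurable \<xi>_square_integrable])

lemma cov_eq: "covariance M (\<xi> u) (\<xi> w) = expectation (\<lambda>\<omega>. \<xi> u \<omega> * \<xi> w \<omega>)"
  by (subst covariance_eq) (auto simp: \<xi>_square_integrable \<xi>_centred)

lemma cov_sum_le:
  assumes "finite B" and "\<And>w. w \<in> B \<Longrightarrow> w - u \<notin> H"
    and \<epsilon>: "\<And>F. finite F \<Longrightarrow> F \<inter> H = {} \<Longrightarrow> sum c F \<le> \<epsilon>"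
  shows "(\<Sum>w\<in>B. covariance M (\<xi> u) (\<xi> w)) \<le> \<epsilon>"
proof -
  have "(\<Sum>w\<in>B. covariance M (\<xi> u) (\<xi> w)) \<le> (\<Sum>w\<in>B. c (w - u))"
    by (intro sum_mono \<xi>_cov)
  also have "\<dots> = sum c ((\<lambda>w. w - u) ` B)"
    by (subst sum.reindex) (auto simp: inj_on_def)
  also have "\<dots> \<le> \<epsilon>" using assms by (intro \<epsilon>) auto
  finally show ?thesis .
qed

lemma v_nonneg: "v \<ge> 0" using c_sum[of "{}"] by simp

definition nsum :: "'i set \<Rightarrow> 'a \<Rightarrow> real" where
  "nsum B \<omega> = (\<Sum>u\<in>B. \<xi> u \<omega>) / sqrt (card B)"

definition near :: "'i set \<Rightarrow> 'i set \<Rightarrow> 'i \<Rightarrow> 'i set" where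
  "near H B u = {w\<in>B. w - u \<in> H}"

text \<open>
  \<open>local_form H B\<close> is the quadratic form \<open>\<Sum>u. \<xi> u * D u\<close>, up to normalization, where \<open>D u\<close> is the sum over
  the sites near \<open>u\<close>. Its mean is nearly the variance of \<open>nsum B\<close>.
\<close>

definition local_form :: "'i set \<Rightarrow> 'i set \<Rightarrow> 'a \<Rightarrow> real" where
  "local_form H B \<omega> = (\<Sum>u\<in>B. \<Sum>w\<in>near H B u. \<xi> u \<omega> * \<xi> w \<omega>) / card B"

lemma nsum_measurable [measurable]: "nsum B \<in> borel_measurable M"
  unfolding nsum_def by measurable

lemma local_form_measurable [measurable]: "local_form H B \<in> borel_measurable M"
  unfolding local_form_def by measurable

lemma card_near: "finite H \<Longrightarrow> card (near H B u) \<le> card H"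
  by (rule card_inj_on_le[of "\<lambda>w. w - u"]) (auto simp: near_def inj_on_def)

lemma card_near_rev: "finite H \<Longrightarrow> card {u\<in>B. w \<in> near H B u} \<le> card H"
  by (rule card_inj_on_le[of "\<lambda>u. w - u"]) (auto simp: near_def inj_on_def)

lemma local_form_bounded:
  assumes "finite B" "finite H"
  shows "\<bar>local_form H B \<omega>\<bar> \<le> K\<^sup>2 * card H"
proof -
  have "\<bar>\<Sum>u\<in>B. \<Sum>w\<in>near H B u. \<xi> u \<omega> * \<xi> w \<omega>\<bar> \<le> (\<Sum>u\<in>B. \<Sum>w\<in>near H B u. \<bar>\<xi> u \<omega> * \<xi> w \<omega>\<bar>)"
    by (intro order_trans[OF sum_abs] sum_mono) simp
  also have "\<dots> \<le> (\<Sum>u\<in>B. \<Sum>w\<in>near H B u. K\<^sup>2)"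
    unfolding abs_mult power2_eq_square using K_nonneg by (intro sum_mono mult_mono \<xi>_bounded) auto
  also have "\<dots> \<le> (\<Sum>u\<in>B. K\<^sup>2 * card H)"
    using card_near[OF assms(2)] by (intro sum_mono) (simp add: mult.commute[of _ "K\<^sup>2"] mult_left_mono)
  also have "\<dots> = card B * (K\<^sup>2 * card H)" by simp
  finally show ?thesis using K_nonneg unfolding local_form_def
    by (cases "card B = 0") (auto simp: abs_divide divide_le_eq mult.commute)
qed

text \<open>
  The form has \<open>card B * card H\<close> terms at most, and each site occurs in at most \<open>2 * card H\<close> of them.
  On the range of the field it is therefore dominated by a linear function with coefficients of
  order \<open>1 / card B\<close>, and the covariance inequality makes its variance of order \<open>1 / card B\<close>. Products are
  not Lipschitz on the whole space, so for this argument the coordinates are clipped at \<open>K\<close>, which does not change the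
  values on the field. The mean absolute deviation is at most the square root of the variance.
\<close>

lemma local_form_variance:
  assumes B: "finite B" "B \<noteq> {}" and H: "finite H"
  shows "expectation (\<lambda>\<omega>. \<bar>local_form H B \<omega> - expectation (local_form H B)\<bar>) \<le> 2 * K * card H * sqrt (v / card B)"
proof -
  define n where "n = real (card B)"
  have n: "n > 0" using B by (simp add: n_def card_gt_0_iff)
  define T where "T x = max (-K) (min K x)" for x :: real
  define f where "f x = (\<Sum>u\<in>B. \<Sum>w\<in>near H B u. T (x u) * T (x w)) / n" for x :: "'i \<Rightarrow> real"
  define a where "a = 2 * K * card H / n"
  have a: "a \<ge> 0" using K_nonneg n by (simp add: a_def)
  have T\<xi>: "T (\<xi> u \<omega>) = \<xi> u \<omega>" for u \<omega> using \<xi>_bounded[of u \<omega>] by (auto simp: T_def abs_le_iff)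
  have TK: "\<bar>T x\<bar> \<le> K" for x using K_nonneg by (auto simp: T_def abs_le_iff)
  have Tlip: "\<bar>T y - T x\<bar> \<le> y - x" if "x \<le> y" for x y using that by (auto simp: T_def min_def max_def)
  have [measurable]: "T \<in> borel_measurable borel" unfolding T_def by measurable
  have near_B: "w \<in> B" if "w \<in> near H B u" for u w using that by (simp add: near_def)
  have rf: "f (\<lambda>i\<in>B. \<xi> i \<omega>) = local_form H B \<omega>" for \<omega>
    unfolding f_def local_form_def n_def[symmetric]
    by (intro arg_cong2[of _ _ _ _ "(/)"] sum.cong refl) (auto simp: T\<xi> near_B)
  have fm: "f \<in> borel_measurable (\<Pi>\<^sub>M i\<in>B. borel)"
    unfolding f_def by (intro borel_measurable_divide borel_measurable_sum borel_measurable_times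
        measurable_compose[OF measurable_component_singleton[of _ B "\<lambda>_. borel"]] borel_measurable_const)
      (auto simp: near_B)
  have dom: "dominated_on B (\<lambda>_. a) f"
    unfolding dominated_on_def
  proof (intro ballI impI)
    fix x y :: "'i \<Rightarrow> real" assume "x \<le> y"
    define d where "d u = y u - x u" for u
    have d: "d u \<ge> 0" for u using \<open>x \<le> y\<close> by (simp add: d_def le_fun_def)
    have prod: "\<bar>T (y u) * T (y w) - T (x u) * T (x w)\<bar> \<le> K * (d u + d w)" for u w
    proof -
      have "T (y u) * T (y w) - T (x u) * T (x w) = (T (y u) - T (x u)) * T (y w) + T (x u) * (T (y w) - T (x w))"
        by (simp add: algebra_simps)
      also have "\<bar>\<dots>\<bar> \<le> d u * K + K * d w"
        using d Tlip \<open>x \<le> y\<close>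
        by (intro order_trans[OF abs_triangle_ineq] add_mono) (auto simp: abs_mult d_def le_fun_def intro!: mult_mono TK K_nonneg)
      finally show ?thesis by (simp add: algebra_simps)
    qed
    have "\<bar>f y - f x\<bar> = \<bar>\<Sum>u\<in>B. \<Sum>w\<in>near H B u. T (y u) * T (y w) - T (x u) * T (x w)\<bar> / n"
      using n by (simp add: f_def diff_divide_distrib[symmetric] sum_subtractf)
    also have "\<dots> \<le> (\<Sum>u\<in>B. \<Sum>w\<in>near H B u. K * (d u + d w)) / n"
      using n by (intro divide_right_mono order_trans[OF sum_abs] sum_mono prod) auto
    also have "(\<Sum>u\<in>B. \<Sum>w\<in>near H B u. K * (d u + d w)) =
        K * (\<Sum>u\<in>B. card (near H B u) * d u) + K * (\<Sum>w\<in>B. card {u\<in>B. w \<in> near H B u} * d w)"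
    proof -
      have "(\<Sum>u\<in>B. \<Sum>w\<in>near H B u. d w) = (\<Sum>u\<in>B. \<Sum>w | w \<in> B \<and> w \<in> near H B u. d w)"
        by (intro sum.cong) (auto simp: near_def)
      also have "\<dots> = (\<Sum>w\<in>B. \<Sum>u | u \<in> B \<and> w \<in> near H B u. d w)"
        by (rule sum.swap_restrict) (use B in auto)
      finally show ?thesis
        by (simp add: sum_distrib_left[symmetric] sum.distrib distrib_left mult.left_commute[of _ K])
    qed
    also have "\<dots> \<le> K * (\<Sum>u\<in>B. card H * d u) + K * (\<Sum>w\<in>B. card H * d w)"
      using K_nonneg d card_near[OF H] card_near_rev[OF H]
      by (intro add_mono mult_left_mono sum_mono mult_right_mono) auto
    finally have "\<bar>f y - f x\<bar> \<le> (K * (\<Sum>u\<in>B. card H * d u) + K * (\<Sum>w\<in>B. card H * d w)) / n"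
      using n by (simp add: divide_right_mono)
    also have "\<dots> = (\<Sum>u\<in>B. a * (y u - x u))"
      unfolding sum_distrib_left[symmetric] by (simp add: a_def d_def)
    finally show "\<bar>f y - f x\<bar> \<le> (\<Sum>u\<in>B. a * (y u - x u))" .
  qed
  have sq: "integrable M (\<lambda>\<omega>. (local_form H B \<omega>)\<^sup>2)"
    using local_form_bounded[OF B(1) H] K_nonneg
    by (intro integrable_const_bound[of _ "(K\<^sup>2 * card H)\<^sup>2"]) (auto intro!: power2_le_iff_abs_le[THEN iffD2])
  let ?m = "expectation (local_form H B)"
  have sq': "integrable M (\<lambda>\<omega>. (local_form H B \<omega> - ?m)\<^sup>2)"
    using square_integrable_add[of "local_form H B" M "\<lambda>_. - ?m"] sq by simp
  have "expectation (\<lambda>\<omega>. (local_form H B \<omega> - ?m)\<^sup>2) = covariance M (local_form H B) (local_form H B)"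
    by (simp add: covariance_def power2_eq_square)
  also have "\<dots> \<le> (\<Sum>u\<in>B. \<Sum>w\<in>B. a * a * covariance M (\<xi> u) (\<xi> w))"
    using FKG_covariance_dominated[OF \<xi>_FKG B(1) \<xi>_measurable \<xi>_square_integrable dom fm _ dom fm] sq
    unfolding rf by simp
  also have "\<dots> = a\<^sup>2 * (\<Sum>u\<in>B. \<Sum>w\<in>B. covariance M (\<xi> u) (\<xi> w))"
    by (simp add: sum_distrib_left power2_eq_square)
  also have "\<dots> \<le> a\<^sup>2 * (\<Sum>u\<in>B. v)"
    using cov_sum_le[of B _ "{}" v] B(1) c_sum by (intro mult_left_mono sum_mono) auto
  also have "\<dots> = (2 * K * card H)\<^sup>2 * (v / n)"
    using n by (simp add: a_def n_def[symmetric] power_divide power2_eq_square)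
  finally have "sqrt (expectation (\<lambda>\<omega>. (local_form H B \<omega> - ?m)\<^sup>2)) \<le> sqrt ((2 * K * card H)\<^sup>2 * (v / n))"
    by (rule real_sqrt_le_mono)
  also have "\<dots> = 2 * K * card H * sqrt (v / n)"
    using K_nonneg by (subst real_sqrt_mult) simp
  finally show ?thesis
    using expectation_abs_le_sqrt[OF _ sq'] by (simp add: n_def)
qed

lemma nsum_bounded: "\<bar>nsum B \<omega>\<bar> \<le> card B * K / sqrt (card B)"
proof -
  have "\<bar>\<Sum>u\<in>B. \<xi> u \<omega>\<bar> \<le> (\<Sum>u\<in>B. K)" by (intro order_trans[OF sum_abs] sum_mono \<xi>_bounded)
  then show ?thesis by (simp add: nsum_def divide_right_mono)
qed

lemma integrable_nsum_square: "integrable M (\<lambda>\<omega>. (nsum B \<omega>)\<^sup>2)"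
  unfolding nsum_def power_divide
  by (intro integrable_divide square_integrable_sum \<xi>_square_integrable \<xi>_measurable)

lemma integrable_iexp_mult:
  assumes [measurable]: "f \<in> borel_measurable M" "g \<in> borel_measurable M" and "\<And>\<omega>. \<bar>f \<omega>\<bar> \<le> b"
  shows "complex_integrable M (\<lambda>\<omega>. of_real (f \<omega>) * iexp (g \<omega>))"
  using assms(3) by (intro integrable_const_bound[of _ b]) (auto simp: norm_mult)

lemma nsum_variance:
  assumes "finite B"
  shows "expectation (\<lambda>\<omega>. (nsum B \<omega>)\<^sup>2) = (\<Sum>u\<in>B. \<Sum>w\<in>B. covariance M (\<xi> u) (\<xi> w)) / card B"
proof -
  have "expectation (\<lambda>\<omega>. (nsum B \<omega>)\<^sup>2) = expectation (\<lambda>\<omega>. (\<Sum>u\<in>B. \<Sum>w\<in>B. \<xi> u \<omega> * \<xi> w \<omega>)) / card B"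
    by (simp add: nsum_def power_divide power2_eq_square sum_product)
  also have "expectation (\<lambda>\<omega>. (\<Sum>u\<in>B. \<Sum>w\<in>B. \<xi> u \<omega> * \<xi> w \<omega>)) = (\<Sum>u\<in>B. \<Sum>w\<in>B. covariance M (\<xi> u) (\<xi> w))"
    by (simp add: cov_eq Bochner_Integration.integral_sum square_integrable_mult \<xi>_square_integrable)
  finally show ?thesis .
qed

text \<open>
  The difference collects the covariances of pairs of sites whose lag lies outside \<open>H\<close>.
\<close>

lemma local_form_mean:
  assumes B: "finite B" "B \<noteq> {}"
    and \<epsilon>: "\<And>F. finite F \<Longrightarrow> F \<inter> H = {} \<Longrightarrow> sum c F \<le> \<epsilon>"
  shows "\<bar>expectation (local_form H B) - expectation (\<lambda>\<omega>. (nsum B \<omega>)\<^sup>2)\<bar> \<le> \<epsilon>"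
proof -
  define n where "n = real (card B)"
  have n: "n > 0" using B by (simp add: n_def card_gt_0_iff)
  let ?C = "\<lambda>u w. covariance M (\<xi> u) (\<xi> w)"
  have m: "expectation (local_form H B) = (\<Sum>u\<in>B. \<Sum>w\<in>near H B u. ?C u w) / n"
    unfolding local_form_def n_def
    by (simp add: cov_eq Bochner_Integration.integral_sum square_integrable_mult \<xi>_square_integrable)
  have "(\<Sum>w\<in>B. ?C u w) = (\<Sum>w\<in>near H B u. ?C u w) + (\<Sum>w\<in>B - near H B u. ?C u w)" for u
    by (subst sum.subset_diff[of "near H B u" B]) (use B in \<open>auto simp: near_def\<close>)
  then have "expectation (\<lambda>\<omega>. (nsum B \<omega>)\<^sup>2) - expectation (local_form H B) = (\<Sum>u\<in>B. \<Sum>w\<in>B - near H B u. ?C u w) / n"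
    unfolding nsum_variance[OF B(1)] m n_def[symmetric]
    by (simp add: sum.distrib diff_divide_distrib[symmetric])
  moreover have "0 \<le> (\<Sum>u\<in>B. \<Sum>w\<in>B - near H B u. ?C u w) / n"
    using n by (intro divide_nonneg_pos sum_nonneg cov_nonneg)
  moreover have "(\<Sum>u\<in>B. \<Sum>w\<in>B - near H B u. ?C u w) \<le> (\<Sum>u\<in>B. \<epsilon>)"
    using B by (intro sum_mono cov_sum_le[OF _ _ \<epsilon>]) (auto simp: near_def)
  then have "(\<Sum>u\<in>B. \<Sum>w\<in>B - near H B u. ?C u w) / n \<le> \<epsilon>"
    using n by (simp add: divide_le_eq n_def mult.commute)
  ultimately show ?thesis by linarith
qed

text \<open>
  Real and imaginary parts are covariances of \<open>\<xi> u\<close> with the cosine and the sine of the scaled sum over \<open>A\<close>, both Lipschitz.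
\<close>

lemma far_term:
  assumes A: "finite A"
  shows "norm (\<integral>\<omega>. of_real (\<xi> u \<omega>) * iexp (s * (\<Sum>w\<in>A. \<xi> w \<omega>)) \<partial>M) \<le> 2 * \<bar>s\<bar> * (\<Sum>w\<in>A. covariance M (\<xi> u) (\<xi> w))"
proof -
  have bd: "\<bar>expectation (\<lambda>\<omega>. \<xi> u \<omega> * g (s * (\<Sum>w\<in>A. \<xi> w \<omega>)))\<bar> \<le> \<bar>s\<bar> * (\<Sum>w\<in>A. covariance M (\<xi> u) (\<xi> w))"
    if lip: "\<And>x y. \<bar>g x - g y\<bar> \<le> \<bar>x - y\<bar>" and g: "\<And>x. \<bar>g x\<bar> \<le> 1" and [measurable]: "g \<in> borel_measurable borel"
    for g :: "real \<Rightarrow> real"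
  proof -
    have i: "integrable M (\<lambda>\<omega>. (g (s * (\<Sum>w\<in>A. \<xi> w \<omega>)))\<^sup>2)"
      using g by (intro integrable_const_bound[of _ 1]) (auto simp: abs_square_le_1)
    have "covariance M (\<xi> u) (\<lambda>\<omega>. g (s * (\<Sum>w\<in>A. \<xi> w \<omega>))) = expectation (\<lambda>\<omega>. \<xi> u \<omega> * g (s * (\<Sum>w\<in>A. \<xi> w \<omega>)))"
      by (subst covariance_eq) (use i in \<open>auto simp: \<xi>_square_integrable \<xi>_centred\<close>)
    moreover have "\<bar>g (s * x) - g (s * y)\<bar> \<le> \<bar>s\<bar> * \<bar>x - y\<bar>" for x y
      using lip[of "s * x" "s * y"] by (simp add: right_diff_distrib[symmetric] abs_mult)
    ultimately show ?thesis
      using FKG_covariance_Lipschitz_sum[OF \<xi>_FKG A \<xi>_measurable \<xi>_square_integrable, of "\<lambda>x. g (s * x)" "\<bar>s\<bar>" u] i by simp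
  qed
  have lipc: "\<bar>cos x - cos y\<bar> \<le> \<bar>x - y\<bar>" for x y :: real
    using field_differentiable_bound[of UNIV cos "\<lambda>x. - sin x" 1 x y]
    by (auto intro!: derivative_eq_intros)
  have lips: "\<bar>sin x - sin y\<bar> \<le> \<bar>x - y\<bar>" for x y :: real
    using field_differentiable_bound[of UNIV sin cos 1 x y]
    by (auto intro!: derivative_eq_intros)
  let ?S = "\<lambda>\<omega>. s * (\<Sum>w\<in>A. \<xi> w \<omega>)"
  have int: "complex_integrable M (\<lambda>\<omega>. of_real (\<xi> u \<omega>) * iexp (?S \<omega>))"
    by (rule integrable_iexp_mult[OF _ _ \<xi>_bounded]) measurable
  have "Re (\<integral>\<omega>. of_real (\<xi> u \<omega>) * iexp (?S \<omega>) \<partial>M) = expectation (\<lambda>\<omega>. \<xi> u \<omega> * cos (?S \<omega>))"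
    by (subst integral_Re[symmetric, OF int]) (simp add: Re_exp)
  moreover have "Im (\<integral>\<omega>. of_real (\<xi> u \<omega>) * iexp (?S \<omega>) \<partial>M) = expectation (\<lambda>\<omega>. \<xi> u \<omega> * sin (?S \<omega>))"
    by (subst integral_Im[symmetric, OF int]) (simp add: Im_exp)
  ultimately show ?thesis
    using bd[OF lipc] bd[OF lips] cmod_le[of "\<integral>\<omega>. of_real (\<xi> u \<omega>) * iexp (?S \<omega>) \<partial>M"] by simp
qed

text \<open>
  The exact identity \<open>E[W f(W)] = \<sigma>\<^sup>2 E[f'(W)]\<close> characterizes \<open>N(0, \<sigma>\<^sup>2)\<close>; here \<open>f(w) = exp (i t w)\<close>. The
  three error terms come from correlations at lags outside \<open>H\<close>, from the fluctuation of the local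
  quadratic form, and from the second-order remainder in the removal of the near sites.
\<close>

lemma stein_identity_error:
  assumes B: "finite B" "B \<noteq> {}" and H: "finite H"
    and \<epsilon>: "\<And>F. finite F \<Longrightarrow> F \<inter> H = {} \<Longrightarrow> sum c F \<le> \<epsilon>"
  defines "n \<equiv> real (card B)"
  shows "norm ((\<integral>\<omega>. of_real (nsum B \<omega>) * iexp (t * nsum B \<omega>) \<partial>M)
      - \<i> * of_real (t * expectation (\<lambda>\<omega>. (nsum B \<omega>)\<^sup>2)) * (\<integral>\<omega>. iexp (t * nsum B \<omega>) \<partial>M))
    \<le> 3 * \<bar>t\<bar> * \<epsilon> + \<bar>t\<bar> * (2 * K * card H * sqrt (v / n)) + t\<^sup>2 * K ^ 3 * (card H)\<^sup>2 / (2 * sqrt n)"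
proof -
  have n: "n > 0" using B by (simp add: n_def card_gt_0_iff)
  define a where "a = 1 / sqrt n"
  have a: "a > 0" "a * a * n = 1" using n by (simp_all add: a_def real_sqrt_mult_self)
  define D where "D u \<omega> = a * (\<Sum>w\<in>near H B u. \<xi> w \<omega>)" for u \<omega>
  define W where "W = nsum B"
  define A where "A = local_form H B"
  define m where "m = expectation A"
  define s2 where "s2 = expectation (\<lambda>\<omega>. (W \<omega>)\<^sup>2)"
  define r where "r u \<omega> = iexp (- (t * D u \<omega>)) - 1 + \<i> * (t * D u \<omega>)" for u \<omega>
  have [measurable]: "D u \<in> borel_measurable M" "W \<in> borel_measurable M" "A \<in> borel_measurable M" for u
    unfolding D_def W_def A_def by measurable
  have [measurable]: "r u \<in> borel_measurable M" for u unfolding r_def by measurable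
  have W: "W \<omega> = a * (\<Sum>u\<in>B. \<xi> u \<omega>)" for \<omega> by (simp add: W_def nsum_def a_def n_def)
  have WD: "W \<omega> - D u \<omega> = a * (\<Sum>w\<in>B - near H B u. \<xi> w \<omega>)" for u \<omega>
    unfolding W D_def using B by (subst sum.subset_diff[of "near H B u" B]) (auto simp: near_def algebra_simps)
  have Ab: "A \<omega> = (\<Sum>u\<in>B. a * \<xi> u \<omega> * D u \<omega>)" for \<omega>
  proof -
    have "A \<omega> = a * a * (\<Sum>u\<in>B. \<Sum>w\<in>near H B u. \<xi> u \<omega> * \<xi> w \<omega>)"
      using n by (simp add: A_def local_form_def a_def n_def[symmetric] real_sqrt_mult_self)
    then show ?thesis by (simp add: D_def sum_distrib_left mult_ac)
  qed
  have Dbound: "\<bar>D u \<omega>\<bar> \<le> a * (card H * K)" for u \<omega>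
  proof -
    have "\<bar>\<Sum>w\<in>near H B u. \<xi> w \<omega>\<bar> \<le> (\<Sum>w\<in>near H B u. K)"
      by (intro order_trans[OF sum_abs] sum_mono \<xi>_bounded)
    also have "\<dots> \<le> card H * K" using card_near[OF H] K_nonneg by (simp add: mult_right_mono)
    finally show ?thesis using a by (simp add: D_def abs_mult)
  qed
  have rbound: "norm (r u \<omega>) \<le> t\<^sup>2 * (a * (card H * K))\<^sup>2 / 2" for u \<omega>
  proof -
    have "norm (r u \<omega>) \<le> \<bar>- (t * D u \<omega>)\<bar>\<^sup>2 / 2"
      using iexp_approx1[of "- (t * D u \<omega>)" 1] by (simp add: r_def algebra_simps power2_eq_square)
    also have "\<dots> = t\<^sup>2 * (D u \<omega>)\<^sup>2 / 2" by (simp add: power_mult_distrib)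
    also have "\<dots> \<le> t\<^sup>2 * (a * (card H * K))\<^sup>2 / 2"
      using Dbound by (intro divide_right_mono mult_left_mono power2_le_iff_abs_le[THEN iffD2])
        (use a K_nonneg in auto)
    finally show ?thesis .
  qed
  \<comment> \<open>expand the factor belonging to the near sites to first order\<close>
  have split: "iexp (t * W \<omega>) = iexp (t * (W \<omega> - D u \<omega>)) + \<i> * (t * D u \<omega>) * iexp (t * W \<omega>) - r u \<omega> * iexp (t * W \<omega>)" for u \<omega>
  proof -
    have "iexp (t * (W \<omega> - D u \<omega>)) = iexp (- (t * D u \<omega>)) * iexp (t * W \<omega>)"
      by (simp add: exp_add[symmetric] algebra_simps)
    then show ?thesis by (simp add: r_def algebra_simps)
  qed
  let ?f = "\<lambda>u \<omega>. of_real (a * \<xi> u \<omega>) * iexp (t * (W \<omega> - D u \<omega>))"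
    and ?g = "\<lambda>u \<omega>. of_real (a * \<xi> u \<omega>) * (r u \<omega> * iexp (t * W \<omega>))"
  have a\<xi>: "\<bar>a * \<xi> u \<omega>\<bar> \<le> a * K" for u \<omega> using \<xi>_bounded[of u \<omega>] a by (simp add: abs_mult)
  have fi: "complex_integrable M (?f u)" for u
    by (rule integrable_iexp_mult[OF _ _ a\<xi>]) measurable
  have gb: "norm (?g u \<omega>) \<le> a * K * (t\<^sup>2 * (a * (card H * K))\<^sup>2 / 2)" for u \<omega>
  proof -
    have "norm (?g u \<omega>) = \<bar>a * \<xi> u \<omega>\<bar> * norm (r u \<omega>)" by (simp add: norm_mult abs_mult)
    also have "\<dots> \<le> (a * K) * (t\<^sup>2 * (a * (card H * K))\<^sup>2 / 2)"
      using a K_nonneg by (intro mult_mono a\<xi> rbound) auto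
    finally show ?thesis .
  qed
  have gi: "complex_integrable M (?g u)" for u
    using gb by (intro integrable_const_bound[of _ "a * K * (t\<^sup>2 * (a * (card H * K))\<^sup>2 / 2)"]) auto
  have Ai: "complex_integrable M (\<lambda>\<omega>. of_real (A \<omega>) * iexp (t * W \<omega>))"
    by (rule integrable_iexp_mult[where b = "K\<^sup>2 * card H"]) (auto simp: A_def local_form_bounded[OF B(1) H])
  have ei: "complex_integrable M (\<lambda>\<omega>. iexp (t * W \<omega>))" by (rule integrable_iexp) auto
  have dec: "of_real (W \<omega>) * iexp (t * W \<omega>) = (\<Sum>u\<in>B. ?f u \<omega>) + \<i> * t * (of_real (A \<omega>) * iexp (t * W \<omega>)) - (\<Sum>u\<in>B. ?g u \<omega>)" for \<omega>
  proof -
    have "of_real (W \<omega>) * iexp (t * W \<omega>) = (\<Sum>u\<in>B. of_real (a * \<xi> u \<omega>) * iexp (t * W \<omega>))"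
      by (simp add: W sum_distrib_left sum_distrib_right)
    also have "\<dots> = (\<Sum>u\<in>B. ?f u \<omega> + of_real (a * \<xi> u \<omega>) * (\<i> * (t * D u \<omega>) * iexp (t * W \<omega>)) - ?g u \<omega>)"
      by (intro sum.cong refl, subst (1) split) (simp only: distrib_left right_diff_distrib)
    also have "\<dots> = (\<Sum>u\<in>B. ?f u \<omega>) + (\<Sum>u\<in>B. of_real (a * \<xi> u \<omega>) * (\<i> * (t * D u \<omega>) * iexp (t * W \<omega>))) - (\<Sum>u\<in>B. ?g u \<omega>)"
      by (simp only: sum.distrib sum_subtractf)
    also have "(\<Sum>u\<in>B. of_real (a * \<xi> u \<omega>) * (\<i> * (t * D u \<omega>) * iexp (t * W \<omega>))) = \<i> * t * (of_real (A \<omega>) * iexp (t * W \<omega>))"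
      by (simp add: Ab sum_distrib_left sum_distrib_right mult_ac)
    finally show ?thesis .
  qed
  define \<phi> where "\<phi> = (\<integral>\<omega>. iexp (t * W \<omega>) \<partial>M)"
  have I: "(\<integral>\<omega>. of_real (W \<omega>) * iexp (t * W \<omega>) \<partial>M) =
     (\<Sum>u\<in>B. \<integral>\<omega>. ?f u \<omega> \<partial>M) + \<i> * t * (\<integral>\<omega>. of_real (A \<omega>) * iexp (t * W \<omega>) \<partial>M) - (\<Sum>u\<in>B. \<integral>\<omega>. ?g u \<omega> \<partial>M)"
    unfolding dec using fi gi Ai
    by (subst Bochner_Integration.integral_diff, simp, simp, subst Bochner_Integration.integral_add)
      (simp_all add: Bochner_Integration.integral_sum)
  have e1: "norm (\<Sum>u\<in>B. \<integral>\<omega>. ?f u \<omega> \<partial>M) \<le> 2 * \<bar>t\<bar> * \<epsilon>"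
  proof -
    have "norm (\<integral>\<omega>. ?f u \<omega> \<partial>M) \<le> a * (2 * \<bar>t * a\<bar> * \<epsilon>)" for u
    proof -
      have "(\<integral>\<omega>. ?f u \<omega> \<partial>M) = a * (\<integral>\<omega>. of_real (\<xi> u \<omega>) * iexp ((t * a) * (\<Sum>w\<in>B - near H B u. \<xi> w \<omega>)) \<partial>M)"
        unfolding WD by (simp add: mult.assoc)
      then have "norm (\<integral>\<omega>. ?f u \<omega> \<partial>M) \<le> a * (2 * \<bar>t * a\<bar> * (\<Sum>w\<in>B - near H B u. covariance M (\<xi> u) (\<xi> w)))"
        using far_term[of "B - near H B u" u "t * a"] B a(1) by (simp add: norm_mult)
      also have "\<dots> \<le> a * (2 * \<bar>t * a\<bar> * \<epsilon>)"
        using a B by (intro mult_left_mono cov_sum_le[OF _ _ \<epsilon>]) (auto simp: near_def)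
      finally show ?thesis .
    qed
    then have "norm (\<Sum>u\<in>B. \<integral>\<omega>. ?f u \<omega> \<partial>M) \<le> (\<Sum>u\<in>B. a * (2 * \<bar>t * a\<bar> * \<epsilon>))"
      by (intro order_trans[OF norm_sum] sum_mono)
    also have "\<dots> = (a * a * n) * (2 * \<bar>t\<bar> * \<epsilon>)" using a(1) by (simp add: n_def abs_mult mult_ac)
    finally show ?thesis using a by simp
  qed
  have e2: "norm (\<Sum>u\<in>B. \<integral>\<omega>. ?g u \<omega> \<partial>M) \<le> t\<^sup>2 * K ^ 3 * (card H)\<^sup>2 / (2 * sqrt n)"
  proof -
    have "norm (\<integral>\<omega>. ?g u \<omega> \<partial>M) \<le> a * K * (t\<^sup>2 * (a * (card H * K))\<^sup>2 / 2)" for u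
    proof -
      have "norm (\<integral>\<omega>. ?g u \<omega> \<partial>M) \<le> (\<integral>\<omega>. norm (?g u \<omega>) \<partial>M)" by (rule integral_norm_bound)
      also have "\<dots> \<le> (\<integral>\<omega>. a * K * (t\<^sup>2 * (a * (card H * K))\<^sup>2 / 2) \<partial>M)"
        by (rule integral_mono[OF integrable_norm[OF gi] _ gb]) simp
      also have "\<dots> = a * K * (t\<^sup>2 * (a * (card H * K))\<^sup>2 / 2)" using prob_space by simp
      finally show ?thesis .
    qed
    then have "norm (\<Sum>u\<in>B. \<integral>\<omega>. ?g u \<omega> \<partial>M) \<le> (\<Sum>u\<in>B. a * K * (t\<^sup>2 * (a * (card H * K))\<^sup>2 / 2))"
      by (intro order_trans[OF norm_sum] sum_mono)
    also have "\<dots> = (a * a * n) * (a * (t\<^sup>2 * K ^ 3 * (card H)\<^sup>2 / 2))"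
      by (simp add: n_def power2_eq_square power3_eq_cube mult_ac)
    finally show ?thesis using a(2) by (simp add: a_def mult_ac)
  qed
  have e3: "norm ((\<integral>\<omega>. of_real (A \<omega>) * iexp (t * W \<omega>) \<partial>M) - s2 * \<phi>) \<le> 2 * K * card H * sqrt (v / n) + \<epsilon>"
  proof -
    have "(\<integral>\<omega>. of_real (A \<omega>) * iexp (t * W \<omega>) \<partial>M) - m * \<phi> = (\<integral>\<omega>. of_real (A \<omega> - m) * iexp (t * W \<omega>) \<partial>M)"
      using Ai ei by (simp add: \<phi>_def left_diff_distrib)
    also have "norm \<dots> \<le> (\<integral>\<omega>. norm (of_real (A \<omega> - m) * iexp (t * W \<omega>)) \<partial>M)"
      by (rule integral_norm_bound)
    also have "\<dots> = (\<integral>\<omega>. \<bar>A \<omega> - m\<bar> \<partial>M)" by (simp only: norm_mult norm_exp_i_times norm_of_real mult_1_right)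
    also have "\<dots> \<le> 2 * K * card H * sqrt (v / n)"
      using local_form_variance[OF B H] by (simp add: A_def m_def n_def)
    finally have 1: "norm ((\<integral>\<omega>. of_real (A \<omega>) * iexp (t * W \<omega>) \<partial>M) - m * \<phi>) \<le> 2 * K * card H * sqrt (v / n)" .
    have \<phi>1: "norm \<phi> \<le> 1"
      unfolding \<phi>_def using integral_norm_bound[of M "\<lambda>\<omega>. iexp (t * W \<omega>)"] prob_space by simp
    have "norm (m * \<phi> - s2 * \<phi>) = \<bar>m - s2\<bar> * norm \<phi>"
      by (simp add: left_diff_distrib[symmetric] norm_mult flip: of_real_diff)
    also have "\<dots> \<le> \<epsilon> * 1"
    proof (rule mult_mono)
      show "\<bar>m - s2\<bar> \<le> \<epsilon>"
        unfolding m_def A_def s2_def W_def by (rule local_form_mean[OF B \<epsilon>])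
      then show "0 \<le> \<epsilon>" by (rule order_trans[OF abs_ge_zero])
    qed (use \<phi>1 in auto)
    finally have 2: "norm (m * \<phi> - s2 * \<phi>) \<le> \<epsilon>" by simp
    show ?thesis by (rule norm_diff_triangle_le[OF 1 2])
  qed
  define F G J where "F = (\<Sum>u\<in>B. \<integral>\<omega>. ?f u \<omega> \<partial>M)" and "G = (\<Sum>u\<in>B. \<integral>\<omega>. ?g u \<omega> \<partial>M)"
    and "J = (\<integral>\<omega>. of_real (A \<omega>) * iexp (t * W \<omega>) \<partial>M) - s2 * \<phi>"
  have eq: "(\<integral>\<omega>. of_real (W \<omega>) * iexp (t * W \<omega>) \<partial>M) - \<i> * of_real (t * s2) * \<phi> = F + \<i> * t * J - G"
    unfolding I F_def[symmetric] G_def[symmetric] by (simp add: J_def algebra_simps)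
  have "norm (F + \<i> * t * J - G) \<le> norm F + \<bar>t\<bar> * norm J + norm G"
    using norm_triangle_ineq4[of "F + \<i> * t * J" G] norm_triangle_ineq[of F "\<i> * t * J"] by (simp add: norm_mult)
  also have "\<dots> \<le> 2 * \<bar>t\<bar> * \<epsilon> + \<bar>t\<bar> * (2 * K * card H * sqrt (v / n) + \<epsilon>) + t\<^sup>2 * K ^ 3 * (card H)\<^sup>2 / (2 * sqrt n)"
    using e1 e2 mult_left_mono[OF e3, of "\<bar>t\<bar>"] unfolding F_def G_def J_def by (intro add_mono) simp_all
  also have "\<dots> = 3 * \<bar>t\<bar> * \<epsilon> + \<bar>t\<bar> * (2 * K * card H * sqrt (v / n)) + t\<^sup>2 * K ^ 3 * (card H)\<^sup>2 / (2 * sqrt n)"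
    by (simp add: algebra_simps)
  finally show ?thesis unfolding eq[symmetric] by (simp add: W_def s2_def \<phi>_def)
qed

lemma char_nsum_has_derivative:
  "((\<lambda>s. \<integral>\<omega>. iexp (s * nsum B \<omega>) \<partial>M) has_vector_derivative
     \<i> * (\<integral>\<omega>. of_real (nsum B \<omega>) * iexp (s * nsum B \<omega>) \<partial>M)) (at s)"
proof (rule has_vector_derivative_quadratic_error)
  fix h :: real
  let ?W = "nsum B"
  have i0: "complex_integrable M (\<lambda>\<omega>. iexp (s * ?W \<omega>))" for s by (rule integrable_iexp) auto
  have i1: "complex_integrable M (\<lambda>\<omega>. of_real (?W \<omega>) * iexp (s * ?W \<omega>))"
    by (rule integrable_iexp_mult[OF _ _ nsum_bounded]) measurable
  have i2: "complex_integrable M (\<lambda>\<omega>. (h * \<i>) * (of_real (?W \<omega>) * iexp (s * ?W \<omega>)))"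
    by (rule integrable_mult_right[OF i1])
  have eq: "(\<integral>\<omega>. iexp ((s + h) * ?W \<omega>) \<partial>M) - (\<integral>\<omega>. iexp (s * ?W \<omega>) \<partial>M)
       - h *\<^sub>R (\<i> * (\<integral>\<omega>. of_real (?W \<omega>) * iexp (s * ?W \<omega>) \<partial>M))
    = (\<integral>\<omega>. iexp ((s + h) * ?W \<omega>) - iexp (s * ?W \<omega>) - (h * \<i>) * (of_real (?W \<omega>) * iexp (s * ?W \<omega>)) \<partial>M)"
    (is "_ = (\<integral>\<omega>. ?d \<omega> \<partial>M)")
  proof -
    have "(\<integral>\<omega>. ?d \<omega> \<partial>M) = (\<integral>\<omega>. iexp ((s + h) * ?W \<omega>) \<partial>M) - (\<integral>\<omega>. iexp (s * ?W \<omega>) \<partial>M)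
        - (\<integral>\<omega>. (h * \<i>) * (of_real (?W \<omega>) * iexp (s * ?W \<omega>)) \<partial>M)"
      using i0[of "s + h"] i0[of s] i2
      by (simp only: Bochner_Integration.integral_diff Bochner_Integration.integrable_diff)
    also have "(\<integral>\<omega>. (h * \<i>) * (of_real (?W \<omega>) * iexp (s * ?W \<omega>)) \<partial>M) =
        h *\<^sub>R (\<i> * (\<integral>\<omega>. of_real (?W \<omega>) * iexp (s * ?W \<omega>) \<partial>M))"
      by (simp only: integral_mult_right_zero scaleR_conv_of_real mult.assoc)
    finally show ?thesis by (rule sym)
  qed
  have bound: "norm (?d \<omega>) \<le> h\<^sup>2 / 2 * (?W \<omega>)\<^sup>2" for \<omega>
  proof -
    have "?d \<omega> = (iexp (h * ?W \<omega>) - (1 + \<i> * (h * ?W \<omega>))) * iexp (s * ?W \<omega>)"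
      by (simp add: distrib_right exp_add algebra_simps)
    then have "norm (?d \<omega>) = norm (iexp (h * ?W \<omega>) - (1 + \<i> * (h * ?W \<omega>)))"
      by (simp add: norm_mult)
    also have "\<dots> \<le> \<bar>h * ?W \<omega>\<bar>\<^sup>2 / 2"
      using iexp_approx1[of "h * ?W \<omega>" 1] by (simp add: power2_eq_square)
    finally show ?thesis by (simp add: power_mult_distrib)
  qed
  have "norm (\<integral>\<omega>. ?d \<omega> \<partial>M) \<le> (\<integral>\<omega>. norm (?d \<omega>) \<partial>M)" by (rule integral_norm_bound)
  also have "\<dots> \<le> (\<integral>\<omega>. h\<^sup>2 / 2 * (?W \<omega>)\<^sup>2 \<partial>M)"
    by (rule integral_mono[OF integrable_norm _ bound])
      (intro Bochner_Integration.integrable_diff i0 i2 integrable_mult_right integrable_nsum_square)+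
  also have "\<dots> = (\<integral>\<omega>. (?W \<omega>)\<^sup>2 \<partial>M) / 2 * h\<^sup>2" by simp
  finally show "norm ((\<integral>\<omega>. iexp ((s + h) * ?W \<omega>) \<partial>M) - (\<integral>\<omega>. iexp (s * ?W \<omega>) \<partial>M)
       - h *\<^sub>R (\<i> * (\<integral>\<omega>. of_real (?W \<omega>) * iexp (s * ?W \<omega>) \<partial>M))) \<le> (\<integral>\<omega>. (?W \<omega>)\<^sup>2 \<partial>M) / 2 * h\<^sup>2"
    unfolding eq .
qed

text \<open>
  The set of lags is chosen first, to make the part of the error that does not decay with \<open>card B\<close>
  small; the remaining part is of order \<open>1 / sqrt (card B)\<close>.
\<close>

lemma char_nsum_near_gaussian:
  assumes e: "e > 0"
  shows "\<exists>N. \<forall>B. finite B \<longrightarrow> card B \<ge> N \<longrightarrow>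
    norm ((\<integral>\<omega>. iexp (t * nsum B \<omega>) \<partial>M) - of_real (exp (- (expectation (\<lambda>\<omega>. (nsum B \<omega>)\<^sup>2) * t\<^sup>2 / 2)))) \<le> e"
proof -
  \<comment> \<open>the lag error enters as \<open>3 * t\<^sup>2 * \<epsilon>\<close> after integration; the summand 1 covers \<open>t = 0\<close>\<close>
  define \<epsilon> where "\<epsilon> = e / (2 * (3 * t\<^sup>2 + 1))"
  have pos: "3 * t\<^sup>2 + 1 > 0" by (simp add: add_nonneg_pos)
  have \<epsilon>: "\<epsilon> > 0" using e pos by (simp add: \<epsilon>_def)
  obtain H where H: "finite H" and tail: "\<And>F. finite F \<Longrightarrow> F \<inter> H = {} \<Longrightarrow> sum c F \<le> \<epsilon>"
    using c_tail[OF \<epsilon>] by blast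
  define C where "C = \<bar>t\<bar> * (\<bar>t\<bar> * (2 * K * card H * sqrt v) + t\<^sup>2 * K ^ 3 * (card H)\<^sup>2 / 2)"
  have C: "C \<ge> 0" using K_nonneg v_nonneg by (simp add: C_def)
  define N where "N = Suc (nat \<lceil>(2 * C / e)\<^sup>2\<rceil>)"
  have "norm ((\<integral>\<omega>. iexp (t * nsum B \<omega>) \<partial>M) - of_real (exp (- (expectation (\<lambda>\<omega>. (nsum B \<omega>)\<^sup>2) * t\<^sup>2 / 2)))) \<le> e"
    if B: "finite B" and N: "card B \<ge> N" for B
  proof -
    have B0: "B \<noteq> {}" using N by (auto simp: N_def)
    define n where "n = real (card B)"
    have n: "n > 0" using B B0 by (simp add: n_def card_gt_0_iff)
    define E where "E s = 3 * \<bar>s\<bar> * \<epsilon> + \<bar>s\<bar> * (2 * K * card H * sqrt (v / n)) + s\<^sup>2 * K ^ 3 * (card H)\<^sup>2 / (2 * sqrt n)" for s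
    define r where "r = expectation (\<lambda>\<omega>. (nsum B \<omega>)\<^sup>2)"
    let ?\<phi> = "\<lambda>s. \<integral>\<omega>. iexp (s * nsum B \<omega>) \<partial>M" and ?I = "\<lambda>s. \<integral>\<omega>. of_real (nsum B \<omega>) * iexp (s * nsum B \<omega>) \<partial>M"
    have err: "norm (\<i> * ?I s + (s * r) *\<^sub>R ?\<phi> s) \<le> E t" if s: "\<bar>s\<bar> \<le> \<bar>t\<bar>" for s
    proof -
      have "\<i> * ?I s + (s * r) *\<^sub>R ?\<phi> s = \<i> * (?I s - \<i> * of_real (s * r) * ?\<phi> s)"
        by (simp add: scaleR_conv_of_real algebra_simps)
      then have "norm (\<i> * ?I s + (s * r) *\<^sub>R ?\<phi> s) = norm (?I s - \<i> * of_real (s * r) * ?\<phi> s)"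
        by (simp only: norm_mult norm_ii mult_1)
      also have "\<dots> \<le> E s" unfolding E_def r_def n_def by (rule stein_identity_error[OF B B0 H tail])
      also have "\<dots> \<le> E t"
        unfolding E_def using s K_nonneg v_nonneg n \<epsilon> abs_le_square_iff[of s t]
        by (intro add_mono mult_right_mono divide_right_mono mult_left_mono) auto
      finally show ?thesis .
    qed
    have r: "r \<ge> 0" unfolding r_def by (intro integral_nonneg_AE) simp
    have \<phi>0: "?\<phi> 0 = 1" using prob_space by simp
    have "norm (?\<phi> t - of_real (exp (- (r * t\<^sup>2 / 2)))) \<le> \<bar>t\<bar> * E t"
      by (rule gaussian_ode_stability[OF char_nsum_has_derivative \<phi>0 r err])
    also have "\<dots> = 3 * t\<^sup>2 * \<epsilon> + C / sqrt n"
    proof -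
      define q where "q = \<bar>t\<bar>"
      have q: "t\<^sup>2 = q\<^sup>2" by (simp add: q_def)
      show ?thesis
        unfolding E_def C_def q q_def[symmetric] real_sqrt_divide using n
        by (simp add: field_simps power2_eq_square)
    qed
    also have "\<dots> \<le> e / 2 + e / 2"
    proof (rule add_mono)
      show "3 * t\<^sup>2 * \<epsilon> \<le> e / 2" using e pos by (simp add: \<epsilon>_def divide_le_eq mult_left_mono)
      have "(2 * C / e)\<^sup>2 \<le> n" using N unfolding N_def n_def by linarith
      then have "2 * C / e \<le> sqrt n" by (rule real_le_rsqrt)
      then show "C / sqrt n \<le> e / 2" using e n by (simp add: divide_le_eq field_simps)
    qed
    finally show ?thesis by (simp add: r_def)
  qed
  then show ?thesis by blast
qed

end

section \<open>Truncation of a stationary field\<close>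

lemma (in prob_space) FKG_covariance_mono_nonneg:
  fixes X :: "'i \<Rightarrow> 'a \<Rightarrow> real"
  assumes FKG: "FKG M X" and X[measurable]: "\<And>u. X u \<in> borel_measurable M"
    and g: "mono g" and [measurable]: "g \<in> borel_measurable borel" and g2: "integrable M (\<lambda>\<omega>. (g (X u \<omega>))\<^sup>2)"
    and h: "mono h" and [measurable]: "h \<in> borel_measurable borel" and h2: "integrable M (\<lambda>\<omega>. (h (X w \<omega>))\<^sup>2)"
  shows "0 \<le> covariance M (\<lambda>\<omega>. g (X u \<omega>)) (\<lambda>\<omega>. h (X w \<omega>))"
proof -
  let ?S = "{u, w}"
  have "FKG_on M ?S X" using FKG by (simp add: FKG_def)
  note fkg = this[unfolded FKG_on_def, rule_format, of "\<lambda>x. g (x u)" "\<lambda>x. h (x w)"]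
  have "0 \<le> covariance M (\<lambda>\<omega>. g ((\<lambda>i\<in>?S. X i \<omega>) u)) (\<lambda>\<omega>. h ((\<lambda>i\<in>?S. X i \<omega>) w))"
  proof (rule fkg)
    show "(\<lambda>x. g (x u)) \<in> borel_measurable (\<Pi>\<^sub>M i\<in>?S. borel)"
      by (intro measurable_compose[OF measurable_component_singleton]) auto
    show "(\<lambda>x. h (x w)) \<in> borel_measurable (\<Pi>\<^sub>M i\<in>?S. borel)"
      by (intro measurable_compose[OF measurable_component_singleton]) auto
    show "mono_on (?S \<rightarrow>\<^sub>E UNIV) (\<lambda>x. g (x u))" "mono_on (?S \<rightarrow>\<^sub>E UNIV) (\<lambda>x. h (x w))"
      using g h by (auto intro!: mono_onI simp: le_fun_def monoD)
    show "integrable M (\<lambda>\<omega>. g ((\<lambda>i\<in>?S. X i \<omega>) u))"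
      using square_integrable_imp_integrable[OF _ g2] by simp
    show "integrable M (\<lambda>\<omega>. h ((\<lambda>i\<in>?S. X i \<omega>) w))"
      using square_integrable_imp_integrable[OF _ h2] by simp
    show "integrable M (\<lambda>\<omega>. g ((\<lambda>i\<in>?S. X i \<omega>) u) * h ((\<lambda>i\<in>?S. X i \<omega>) w))"
      using square_integrable_mult[OF _ _ g2 h2] by simp
  qed
  then show ?thesis by simp
qed

lemma (in prob_space) stationary_pair_expectation:
  fixes X :: "'i::ab_group_add \<Rightarrow> 'a \<Rightarrow> real" and p :: "real \<Rightarrow> real \<Rightarrow> real"
  assumes st: "stationary M X" and X[measurable]: "\<And>u. X u \<in> borel_measurable M"
    and p[measurable]: "case_prod p \<in> borel_measurable (borel \<Otimes>\<^sub>M borel)"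
  shows "expectation (\<lambda>\<omega>. p (X u \<omega>) (X w \<omega>)) = expectation (\<lambda>\<omega>. p (X 0 \<omega>) (X (w - u) \<omega>))"
proof -
  let ?P = "\<Pi>\<^sub>M u\<in>(UNIV::'i set). (borel :: real measure)"
  let ?q = "\<lambda>x :: 'i \<Rightarrow> real. p (x 0) (x (w - u))"
  have q: "?q \<in> borel_measurable ?P" by measurable
  have m: "(\<lambda>\<omega> k. X (k + h) \<omega>) \<in> measurable M ?P" for h
    by (rule measurable_PiM_single') auto
  have "expectation (\<lambda>\<omega>. p (X u \<omega>) (X w \<omega>)) = (\<integral>x. ?q x \<partial>distr M ?P (\<lambda>\<omega> k. X (k + u) \<omega>))"
    using integral_distr[OF m q, of u] by simp
  also have "distr M ?P (\<lambda>\<omega> k. X (k + u) \<omega>) = distr M ?P (\<lambda>\<omega> k. X (k + 0) \<omega>)"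
    using st by (simp add: stationary_def)
  also have "(\<integral>x. ?q x \<partial>distr M ?P (\<lambda>\<omega> k. X (k + 0) \<omega>)) = expectation (\<lambda>\<omega>. p (X 0 \<omega>) (X (w - u) \<omega>))"
    using integral_distr[OF m q, of 0] by simp
  finally show ?thesis .
qed

lemma (in prob_space) stationary_covariance:
  fixes X :: "'i::ab_group_add \<Rightarrow> 'a \<Rightarrow> real"
  assumes st: "stationary M X" and X[measurable]: "\<And>u. X u \<in> borel_measurable M"
    and g[measurable]: "g \<in> borel_measurable borel"
  shows "covariance M (\<lambda>\<omega>. g (X u \<omega>)) (\<lambda>\<omega>. g (X w \<omega>)) = covariance M (\<lambda>\<omega>. g (X 0 \<omega>)) (\<lambda>\<omega>. g (X (w - u) \<omega>))"
proof -
  define m where "m = expectation (\<lambda>\<omega>. g (X 0 \<omega>))"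
  have e: "expectation (\<lambda>\<omega>. g (X w \<omega>)) = m" for w
    unfolding m_def using stationary_pair_expectation[OF st X, of "\<lambda>x y. g x" w w] by simp
  show ?thesis unfolding covariance_def e
    by (rule stationary_pair_expectation[OF st X, of "\<lambda>x y. (g x - m) * (g y - m)"]) measurable
qed

definition clip :: "real \<Rightarrow> real \<Rightarrow> real" where
  "clip K x = max (- K) (min K x)"

lemma clip_measurable [measurable]: "clip K \<in> borel_measurable borel"
  unfolding clip_def by measurable

lemma mono_clip: "mono (clip K)" "mono (\<lambda>x. x - clip K x)"
proof -
  show "mono (clip K)" unfolding clip_def by (intro monoI max.mono min.mono order_refl)
  show "mono (\<lambda>x. x - clip K x)"
  proof (rule monoI)
    fix x y :: real assume "x \<le> y"
    then have "clip K y \<le> clip K x + (y - x)" unfolding clip_def by linarith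
    then show "x - clip K x \<le> y - clip K y" by simp
  qed
qed

locale FKG_field = prob_space M for M :: "'a measure" +
  fixes X :: "'i::ab_group_add \<Rightarrow> 'a \<Rightarrow> real"
  assumes X_measurable [measurable]: "\<And>u. X u \<in> borel_measurable M"
    and X_stationary: "stationary M X"
    and X_square_integrable: "\<And>u. integrable M (\<lambda>\<omega>. (X u \<omega>)\<^sup>2)"
    and X_centred: "\<And>u. expectation (X u) = 0"
    and X_FKG: "FKG M X"
    and X_susceptible: "(\<lambda>u. covariance M (X 0) (X u)) summable_on UNIV"
begin

definition corr :: "'i \<Rightarrow> real" where "corr h = covariance M (X 0) (X h)"

definition susceptibility :: real where "susceptibility = (\<Sum>\<^sub>\<infinity>h. corr h)"

lemma corr_nonneg: "0 \<le> corr h"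
  unfolding corr_def by (rule FKG_covariance_nonneg[OF X_FKG X_measurable X_square_integrable])

lemma corr_sum: "finite F \<Longrightarrow> sum corr F \<le> susceptibility"
  unfolding susceptibility_def using X_susceptible corr_nonneg
  by (intro finite_sum_le_infsum) (auto simp: corr_def[abs_def])

lemma susceptibility_nonneg: "susceptibility \<ge> 0" using corr_sum[of "{}"] by simp

lemma corr_tail:
  assumes "\<epsilon> > 0"
  shows "\<exists>H. finite H \<and> (\<forall>F. finite F \<longrightarrow> F \<inter> H = {} \<longrightarrow> sum corr F \<le> \<epsilon>)"
proof -
  have "(corr has_sum susceptibility) UNIV"
    unfolding susceptibility_def using X_susceptible by (intro has_sum_infsum) (simp add: corr_def[abs_def])
  then have "\<forall>\<^sub>F F in finite_subsets_at_top UNIV. dist (sum corr F) susceptibility < \<epsilon>"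
    unfolding has_sum_def using assms by (rule tendstoD)
  then obtain H where H: "finite H" "\<And>F. finite F \<Longrightarrow> H \<subseteq> F \<Longrightarrow> dist (sum corr F) susceptibility < \<epsilon>"
    unfolding eventually_finite_subsets_at_top by auto
  have "\<forall>F. finite F \<longrightarrow> F \<inter> H = {} \<longrightarrow> sum corr F \<le> \<epsilon>"
  proof (intro allI impI)
    fix F :: "'i set" assume F: "finite F" "F \<inter> H = {}"
    have "sum corr F + sum corr H \<le> susceptibility"
      using corr_sum[of "F \<union> H"] F H(1) by (simp add: sum.union_disjoint)
    moreover have "\<bar>sum corr H - susceptibility\<bar> < \<epsilon>"
      using H(2)[OF H(1) order_refl] by (simp only: dist_real_def)
    ultimately show "sum corr F \<le> \<epsilon>" by linarith
  qed
  with H(1) show ?thesis by (intro exI[of _ H] conjI)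
qed

lemma cov_eq_corr: "covariance M (X u) (X w) = corr (w - u)"
  unfolding corr_def using stationary_covariance[OF X_stationary X_measurable, of "\<lambda>x. x" u w] by simp

lemma X_integrable: "integrable M (X u)"
  by (rule square_integrable_imp_integrable[OF _ X_square_integrable]) simp

text \<open>
  The field splits into its recentred clipped part and a remainder. Both are increasing functions
  of \<open>X u\<close>, so within and between the two parts all covariances are nonnegative.
\<close>

definition core :: "real \<Rightarrow> 'i \<Rightarrow> 'a \<Rightarrow> real" where
  "core K u \<omega> = clip K (X u \<omega>) - expectation (\<lambda>\<omega>. clip K (X 0 \<omega>))"

definition rest :: "real \<Rightarrow> 'i \<Rightarrow> 'a \<Rightarrow> real" where
  "rest K u \<omega> = X u \<omega> - core K u \<omega>"

context
  fixes K :: real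
  assumes K: "K \<ge> 0"
begin

lemma clip_bounded: "\<bar>clip K x\<bar> \<le> K"
  using K by (auto simp: clip_def abs_le_iff)

lemma clip_integrable: "integrable M (\<lambda>\<omega>. clip K (X u \<omega>))"
  using clip_bounded by (intro integrable_const_bound[of _ K]) auto

lemma mean_clip_bounded: "\<bar>expectation (\<lambda>\<omega>. clip K (X 0 \<omega>))\<bar> \<le> K"
proof -
  have "\<bar>expectation (\<lambda>\<omega>. clip K (X 0 \<omega>))\<bar> \<le> expectation (\<lambda>\<omega>. \<bar>clip K (X 0 \<omega>)\<bar>)"
    by (rule integral_abs_bound)
  also have "\<dots> \<le> expectation (\<lambda>_. K)"
    by (intro integral_mono integrable_abs clip_integrable clip_bounded) simp
  finally show ?thesis using prob_space by simp
qed

lemma core_measurable [measurable]: "core K u \<in> borel_measurable M"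
  unfolding core_def by measurable

lemma rest_measurable [measurable]: "rest K u \<in> borel_measurable M"
  unfolding rest_def by measurable

lemma core_bounded: "\<bar>core K u \<omega>\<bar> \<le> 2 * K"
  using clip_bounded[of "X u \<omega>"] mean_clip_bounded unfolding core_def by linarith

lemma core_square_integrable: "integrable M (\<lambda>\<omega>. (core K u \<omega>)\<^sup>2)"
proof (rule integrable_const_bound)
  show "AE \<omega> in M. norm ((core K u \<omega>)\<^sup>2) \<le> (2 * K)\<^sup>2"
  proof (intro always_eventually allI)
    show "norm ((core K u \<omega>)\<^sup>2) \<le> (2 * K)\<^sup>2" for \<omega>
      using core_bounded[of u \<omega>] K power2_le_iff_abs_le[of "2 * K" "core K u \<omega>"] by simp
  qed
qed simp

lemma rest_square_integrable: "integrable M (\<lambda>\<omega>. (rest K u \<omega>)\<^sup>2)"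
  using square_integrable_add[of "X u" M "\<lambda>\<omega>. - core K u \<omega>"] X_square_integrable core_square_integrable
  by (simp add: rest_def)

lemma core_centred: "expectation (core K u) = 0"
proof -
  have "expectation (\<lambda>\<omega>. clip K (X u \<omega>)) = expectation (\<lambda>\<omega>. clip K (X 0 \<omega>))"
    using stationary_pair_expectation[OF X_stationary X_measurable, of "\<lambda>x y. clip K x" u u] by simp
  then show ?thesis unfolding core_def using clip_integrable prob_space by simp
qed

lemma rest_centred: "expectation (rest K u) = 0"
  unfolding rest_def
  using X_integrable X_centred core_centred square_integrable_imp_integrable[OF core_measurable core_square_integrable] by simp

lemma core_FKG: "FKG M (core K)"
  unfolding core_def[abs_def]
  by (rule FKG_increasing_transform[OF X_FKG]) (use mono_clip(1)[of K] in \<open>auto simp: mono_def\<close>)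

text \<open>
  Expanding \<open>Cov(X u, X w)\<close> along the splitting gives four nonnegative terms.
\<close>

lemma covariance_split:
  "0 \<le> covariance M (core K u) (core K w)" "0 \<le> covariance M (rest K u) (rest K w)"
  "covariance M (core K u) (core K w) \<le> corr (w - u)" "covariance M (rest K u) (rest K w) \<le> corr (w - u)"
proof -
  define k where "k = expectation (\<lambda>\<omega>. clip K (X 0 \<omega>))"
  define g h where "g x = clip K x - k" and "h x = x - g x" for x
  have gh: "mono g" "mono h" using mono_clip[of K] by (auto simp: mono_def g_def h_def)
  have [measurable]: "g \<in> borel_measurable borel" "h \<in> borel_measurable borel" unfolding h_def g_def by measurable
  have core: "core K u = (\<lambda>\<omega>. g (X u \<omega>))" for u by (auto simp: core_def g_def k_def)
  have rest: "rest K u = (\<lambda>\<omega>. h (X u \<omega>))" for u by (auto simp: rest_def core h_def)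
  note si = core_square_integrable[unfolded core] rest_square_integrable[unfolded rest]
  show 1: "0 \<le> covariance M (core K u) (core K w)" and 2: "0 \<le> covariance M (rest K u) (rest K w)"
    unfolding core rest using gh si by (auto intro!: FKG_covariance_mono_nonneg[OF X_FKG X_measurable])
  have 3: "0 \<le> covariance M (core K u) (rest K w)" and 4: "0 \<le> covariance M (rest K u) (core K w)"
    unfolding core rest using gh si by (auto intro!: FKG_covariance_mono_nonneg[OF X_FKG X_measurable])
  have X: "X u = (\<lambda>\<omega>. core K u \<omega> + rest K u \<omega>)" for u by (auto simp: rest_def)
  have "corr (w - u) = covariance M (\<lambda>\<omega>. core K u \<omega> + rest K u \<omega>) (\<lambda>\<omega>. core K w \<omega> + rest K w \<omega>)"
    unfolding cov_eq_corr[symmetric] by (simp flip: X)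
  also have "\<dots> = covariance M (core K u) (core K w) + covariance M (core K u) (rest K w)
      + covariance M (rest K u) (core K w) + covariance M (rest K u) (rest K w)"
    by (simp add: covariance_add_left covariance_add_right core_square_integrable rest_square_integrable square_integrable_add)
  finally show "covariance M (core K u) (core K w) \<le> corr (w - u)" "covariance M (rest K u) (rest K w) \<le> corr (w - u)"
    using 1 2 3 4 by linarith+
qed

lemma rest_covariance_le: "covariance M (rest K u) (rest K w) \<le> expectation (\<lambda>\<omega>. (rest K 0 \<omega>)\<^sup>2)"
proof -
  have e: "expectation (\<lambda>\<omega>. (rest K u \<omega>)\<^sup>2) = expectation (\<lambda>\<omega>. (rest K 0 \<omega>)\<^sup>2)" for u
    unfolding rest_def core_def
    using stationary_pair_expectation[OF X_stationary X_measurable,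
        of "\<lambda>x y. (x - (clip K x - expectation (\<lambda>\<omega>. clip K (X 0 \<omega>))))\<^sup>2" u u] by simp
  have "covariance M (rest K u) (rest K w) = expectation (\<lambda>\<omega>. rest K u \<omega> * rest K w \<omega>)"
    by (subst covariance_eq) (auto simp: rest_square_integrable rest_centred)
  also have "\<dots> \<le> expectation (\<lambda>\<omega>. ((rest K u \<omega>)\<^sup>2 + (rest K w \<omega>)\<^sup>2) / 2)"
  proof (rule integral_mono)
    show "rest K u \<omega> * rest K w \<omega> \<le> ((rest K u \<omega>)\<^sup>2 + (rest K w \<omega>)\<^sup>2) / 2" for \<omega>
      using sum_squares_bound[of "rest K u \<omega>" "rest K w \<omega>"] by simp
  qed (auto intro!: square_integrable_mult rest_square_integrable integrable_divide Bochner_Integration.integrable_add)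
  also have "\<dots> = expectation (\<lambda>\<omega>. (rest K 0 \<omega>)\<^sup>2)"
    using e[of u] e[of w] rest_square_integrable by simp
  finally show ?thesis .
qed

lemma bounded_FKG_field_core: "bounded_FKG_field M (core K) (2 * K) corr susceptibility"
  by unfold_locales (auto intro: core_bounded core_centred core_FKG covariance_split corr_sum corr_tail)

text \<open>
  Near lags are controlled by the variance of the remainder at one site, far lags by the
  covariances of \<open>X\<close> itself.
\<close>

lemma rest_sum_variance:
  assumes B: "finite B" "B \<noteq> {}" and H: "finite H"
    and \<epsilon>: "\<And>F. finite F \<Longrightarrow> F \<inter> H = {} \<Longrightarrow> sum corr F \<le> \<epsilon>"
  shows "expectation (\<lambda>\<omega>. ((\<Sum>u\<in>B. rest K u \<omega>) / sqrt (card B))\<^sup>2) \<le> card H * expectation (\<lambda>\<omega>. (rest K 0 \<omega>)\<^sup>2) + \<epsilon>"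
proof -
  define n where "n = real (card B)"
  have n: "n > 0" using B by (simp add: n_def card_gt_0_iff)
  define b where "b = expectation (\<lambda>\<omega>. (rest K 0 \<omega>)\<^sup>2)"
  have b: "b \<ge> 0" unfolding b_def by (intro integral_nonneg_AE) simp
  have cov: "expectation (\<lambda>\<omega>. rest K u \<omega> * rest K w \<omega>) = covariance M (rest K u) (rest K w)" for u w
    by (subst covariance_eq) (auto simp: rest_square_integrable rest_centred)
  have row: "(\<Sum>w\<in>B. covariance M (rest K u) (rest K w)) \<le> card H * b + \<epsilon>" for u
  proof -
    let ?N = "{w\<in>B. w - u \<in> H}"
    have "(\<Sum>w\<in>B. covariance M (rest K u) (rest K w)) = (\<Sum>w\<in>?N. covariance M (rest K u) (rest K w)) + (\<Sum>w\<in>B - ?N. covariance M (rest K u) (rest K w))"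
      by (subst sum.subset_diff[of ?N B]) (use B in auto)
    also have "\<dots> \<le> (\<Sum>w\<in>?N. b) + (\<Sum>w\<in>B - ?N. corr (w - u))"
      unfolding b_def by (intro add_mono sum_mono rest_covariance_le covariance_split)
    also have "\<dots> \<le> card H * b + \<epsilon>"
    proof (rule add_mono)
      have "card ?N \<le> card H" using H by (intro card_inj_on_le[of "\<lambda>w. w - u"]) (auto simp: inj_on_def)
      then show "(\<Sum>w\<in>?N. b) \<le> card H * b" using b by (simp add: mult_right_mono)
      have "(\<Sum>w\<in>B - ?N. corr (w - u)) = sum corr ((\<lambda>w. w - u) ` (B - ?N))"
        by (subst sum.reindex) (auto simp: inj_on_def)
      also have "\<dots> \<le> \<epsilon>" using B by (intro \<epsilon>) auto
      finally show "(\<Sum>w\<in>B - ?N. corr (w - u)) \<le> \<epsilon>" .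
    qed
    finally show ?thesis .
  qed
  have "expectation (\<lambda>\<omega>. ((\<Sum>u\<in>B. rest K u \<omega>) / sqrt (card B))\<^sup>2) = expectation (\<lambda>\<omega>. \<Sum>u\<in>B. \<Sum>w\<in>B. rest K u \<omega> * rest K w \<omega>) / n"
    by (simp add: power_divide power2_eq_square sum_product n_def)
  also have "\<dots> = (\<Sum>u\<in>B. \<Sum>w\<in>B. covariance M (rest K u) (rest K w)) / n"
    by (simp add: cov Bochner_Integration.integral_sum square_integrable_mult rest_square_integrable)
  also have "\<dots> \<le> (\<Sum>u\<in>B. card H * b + \<epsilon>) / n"
    using n by (intro divide_right_mono sum_mono row) simp
  also have "\<dots> = card H * b + \<epsilon>" using n by (simp add: n_def)
  finally show ?thesis by (simp add: b_def)
qed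

lemma rest_variance_le: "expectation (\<lambda>\<omega>. (rest K 0 \<omega>)\<^sup>2) \<le> expectation (\<lambda>\<omega>. (X 0 \<omega> - clip K (X 0 \<omega>))\<^sup>2)"
proof -
  let ?D = "\<lambda>\<omega>. X 0 \<omega> - clip K (X 0 \<omega>)"
  have D1: "integrable M ?D" using X_integrable clip_integrable by simp
  have ED: "expectation ?D = - expectation (\<lambda>\<omega>. clip K (X 0 \<omega>))"
    using X_integrable clip_integrable X_centred by simp
  have "integrable M (\<lambda>\<omega>. (clip K (X 0 \<omega>))\<^sup>2)"
    using square_integrable_add[of "core K 0" M "\<lambda>_. expectation (\<lambda>\<omega>. clip K (X 0 \<omega>))"] core_square_integrable[of 0]
    by (simp add: core_def)
  then have D2: "integrable M (\<lambda>\<omega>. (?D \<omega>)\<^sup>2)"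
    using square_integrable_add[of "X 0" M "\<lambda>\<omega>. - clip K (X 0 \<omega>)"] X_square_integrable by simp
  have "expectation (\<lambda>\<omega>. (rest K 0 \<omega>)\<^sup>2) = variance ?D"
    unfolding ED rest_def core_def by (simp add: algebra_simps)
  also have "\<dots> \<le> expectation (\<lambda>\<omega>. (?D \<omega>)\<^sup>2)"
    by (subst variance_eq[OF D1 D2]) simp
  finally show ?thesis .
qed

end

text \<open>
  The set of near lags is fixed before the truncation level. For near lags only the variance of the
  remainder at one site matters, and it tends to 0 with growing level by dominated convergence.
\<close>

lemma rest_uniformly_small:
  assumes \<delta>: "\<delta> > 0"
  shows "\<exists>K\<ge>0. \<forall>B. finite B \<longrightarrow> B \<noteq> {} \<longrightarrow> expectation (\<lambda>\<omega>. ((\<Sum>u\<in>B. rest K u \<omega>) / sqrt (card B))\<^sup>2) \<le> \<delta>"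
proof -
  have "\<delta> / 2 > 0" using \<delta> by simp
  then obtain H where H: "finite H" "\<And>F. finite F \<Longrightarrow> F \<inter> H = {} \<Longrightarrow> sum corr F \<le> \<delta> / 2"
    using corr_tail by meson
  have "(\<lambda>k. expectation (\<lambda>\<omega>. (X 0 \<omega> - clip (real k) (X 0 \<omega>))\<^sup>2)) \<longlonglongrightarrow> expectation (\<lambda>\<omega>. 0)"
  proof (rule integral_dominated_convergence[where w = "\<lambda>\<omega>. (X 0 \<omega>)\<^sup>2"])
    show "AE \<omega> in M. (\<lambda>k. (X 0 \<omega> - clip (real k) (X 0 \<omega>))\<^sup>2) \<longlonglongrightarrow> 0"
    proof (intro always_eventually allI)
      fix \<omega>
      have "\<forall>\<^sub>F k in sequentially. (X 0 \<omega> - clip (real k) (X 0 \<omega>))\<^sup>2 = 0"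
        using eventually_ge_at_top[of "nat \<lceil>\<bar>X 0 \<omega>\<bar>\<rceil>"]
      proof eventually_elim
        case (elim k)
        then have "\<bar>X 0 \<omega>\<bar> \<le> real k" by linarith
        then show ?case unfolding clip_def by simp
      qed
      then show "(\<lambda>k. (X 0 \<omega> - clip (real k) (X 0 \<omega>))\<^sup>2) \<longlonglongrightarrow> 0"
        by (rule tendsto_eventually)
    qed
    show "AE \<omega> in M. norm ((X 0 \<omega> - clip (real k) (X 0 \<omega>))\<^sup>2) \<le> (X 0 \<omega>)\<^sup>2" for k
    proof (intro always_eventually allI)
      fix \<omega>
      have "\<bar>X 0 \<omega> - clip (real k) (X 0 \<omega>)\<bar> \<le> \<bar>X 0 \<omega>\<bar>"
        unfolding clip_def by (cases "X 0 \<omega> \<ge> 0") (auto simp: min_def max_def)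
      then show "norm ((X 0 \<omega> - clip (real k) (X 0 \<omega>))\<^sup>2) \<le> (X 0 \<omega>)\<^sup>2"
        by (simp add: abs_le_square_iff)
    qed
  qed (auto simp: X_square_integrable)
  then have "(\<lambda>k. card H * expectation (\<lambda>\<omega>. (X 0 \<omega> - clip (real k) (X 0 \<omega>))\<^sup>2)) \<longlonglongrightarrow> card H * expectation (\<lambda>\<omega>. 0)"
    by (rule tendsto_mult_left)
  then have "(\<lambda>k. card H * expectation (\<lambda>\<omega>. (X 0 \<omega> - clip (real k) (X 0 \<omega>))\<^sup>2)) \<longlonglongrightarrow> 0" by simp
  then have "\<forall>\<^sub>F k in sequentially. card H * expectation (\<lambda>\<omega>. (X 0 \<omega> - clip (real k) (X 0 \<omega>))\<^sup>2) < \<delta> / 2"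
    by (rule order_tendstoD(2)) (use \<delta> in simp)
  then obtain k :: nat where k: "card H * expectation (\<lambda>\<omega>. (X 0 \<omega> - clip (real k) (X 0 \<omega>))\<^sup>2) < \<delta> / 2"
    using eventually_happens'[OF sequentially_bot] by blast
  have "expectation (\<lambda>\<omega>. ((\<Sum>u\<in>B. rest k u \<omega>) / sqrt (card B))\<^sup>2) \<le> \<delta>" if B: "finite B" "B \<noteq> {}" for B
  proof -
    have "card H * expectation (\<lambda>\<omega>. (rest k 0 \<omega>)\<^sup>2) \<le> card H * expectation (\<lambda>\<omega>. (X 0 \<omega> - clip (real k) (X 0 \<omega>))\<^sup>2)"
      by (intro mult_left_mono rest_variance_le) auto
    moreover have "expectation (\<lambda>\<omega>. ((\<Sum>u\<in>B. rest k u \<omega>) / sqrt (card B))\<^sup>2) \<le> card H * expectation (\<lambda>\<omega>. (rest k 0 \<omega>)\<^sup>2) + \<delta> / 2"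
      by (rule rest_sum_variance[OF _ B H]) simp
    ultimately show ?thesis using k by linarith
  qed
  then show ?thesis by (intro exI[of _ "real k"]) auto
qed

definition block_sum :: "'i set \<Rightarrow> 'a \<Rightarrow> real" where
  "block_sum B \<omega> = (\<Sum>u\<in>B. X u \<omega>) / sqrt (card B)"

lemma block_sum_measurable [measurable]: "block_sum B \<in> borel_measurable M"
  unfolding block_sum_def by measurable

lemma block_sum_square_integrable: "integrable M (\<lambda>\<omega>. (block_sum B \<omega>)\<^sup>2)"
  unfolding block_sum_def power_divide
  by (intro integrable_divide square_integrable_sum X_square_integrable X_measurable)

lemma block_sum_centred: "expectation (block_sum B) = 0"
  unfolding block_sum_def using X_integrable X_centred by (simp add: Bochner_Integration.integral_sum)

lemma block_sum_variance_le:
  assumes B: "finite B"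
  shows "expectation (\<lambda>\<omega>. (block_sum B \<omega>)\<^sup>2) \<le> susceptibility"
proof (cases "B = {}")
  case True
  then show ?thesis using susceptibility_nonneg by (simp add: block_sum_def)
next
  case False
  define n where "n = real (card B)"
  have n: "n > 0" using B False by (simp add: n_def card_gt_0_iff)
  have cov: "expectation (\<lambda>\<omega>. X u \<omega> * X w \<omega>) = corr (w - u)" for u w
    unfolding cov_eq_corr[symmetric] by (subst covariance_eq) (auto simp: X_square_integrable X_centred)
  have row: "(\<Sum>w\<in>B. corr (w - u)) \<le> susceptibility" for u
  proof -
    have "(\<Sum>w\<in>B. corr (w - u)) = sum corr ((\<lambda>w. w - u) ` B)"
      by (subst sum.reindex) (auto simp: inj_on_def)
    then show ?thesis using B by (simp add: corr_sum)
  qed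
  have "expectation (\<lambda>\<omega>. (block_sum B \<omega>)\<^sup>2) = expectation (\<lambda>\<omega>. \<Sum>u\<in>B. \<Sum>w\<in>B. X u \<omega> * X w \<omega>) / n"
    by (simp add: block_sum_def power_divide power2_eq_square sum_product n_def)
  also have "\<dots> = (\<Sum>u\<in>B. \<Sum>w\<in>B. corr (w - u)) / n"
    by (simp add: cov Bochner_Integration.integral_sum square_integrable_mult X_square_integrable)
  also have "\<dots> \<le> (\<Sum>u\<in>B. susceptibility) / n"
    using n by (intro divide_right_mono sum_mono row) simp
  also have "\<dots> = susceptibility" using n by (simp add: n_def)
  finally show ?thesis .
qed

text \<open>
  Passing from \<open>X\<close> to its clipped part changes the characteristic function by at most \<open>\<bar>t\<bar>\<close> times an
  \<open>L\<^sup>1\<close> distance, and the Gaussian it is compared with by the change of the variance.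
\<close>

lemma char_block_sum_near_gaussian:
  assumes e: "e > 0"
  shows "\<exists>N. \<forall>B. finite B \<longrightarrow> card B \<ge> N \<longrightarrow>
    norm ((\<integral>\<omega>. iexp (t * block_sum B \<omega>) \<partial>M) - of_real (exp (- (expectation (\<lambda>\<omega>. (block_sum B \<omega>)\<^sup>2) * t\<^sup>2 / 2)))) \<le> e"
proof -
  define q where "q = \<bar>t\<bar> + t\<^sup>2 / 2 * (susceptibility + 2)"
  have q: "q \<ge> 0" using susceptibility_nonneg by (simp add: q_def)
  \<comment> \<open>\<open>\<eta>\<close> is the \<open>L\<^sup>2\<close> size allowed to the remainder; it enters the final estimate as \<open>\<eta> * q\<close>\<close>
  define \<eta> where "\<eta> = min 1 (e / 2 / (q + 1))"
  have \<eta>: "\<eta> > 0" "\<eta> \<le> 1" using e q by (auto simp: \<eta>_def)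
  have "\<eta> * q \<le> e / 2 / (q + 1) * (q + 1)" unfolding \<eta>_def using q e by (intro mult_mono) auto
  also have "\<dots> = e / 2" using q by (intro nonzero_eq_divide_eq[THEN iffD1]) auto
  finally have \<eta>q: "\<eta> * q \<le> e / 2" .
  obtain K where K: "K \<ge> 0" and small: "\<And>B. finite B \<Longrightarrow> B \<noteq> {} \<Longrightarrow>
      expectation (\<lambda>\<omega>. ((\<Sum>u\<in>B. rest K u \<omega>) / sqrt (card B))\<^sup>2) \<le> \<eta>\<^sup>2"
    using rest_uniformly_small[of "\<eta>\<^sup>2"] \<eta> by auto
  interpret bd: bounded_FKG_field M "core K" "2 * K" corr susceptibility by (rule bounded_FKG_field_core[OF K])
  obtain N where N: "\<And>B. finite B \<Longrightarrow> card B \<ge> N \<Longrightarrow>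
     norm ((\<integral>\<omega>. iexp (t * bd.nsum B \<omega>) \<partial>M) - of_real (exp (- (expectation (\<lambda>\<omega>. (bd.nsum B \<omega>)\<^sup>2) * t\<^sup>2 / 2)))) \<le> e / 2"
    using bd.char_nsum_near_gaussian[of "e / 2" t] e by auto
  have "norm ((\<integral>\<omega>. iexp (t * block_sum B \<omega>) \<partial>M) - of_real (exp (- (expectation (\<lambda>\<omega>. (block_sum B \<omega>)\<^sup>2) * t\<^sup>2 / 2)))) \<le> e"
    if B: "finite B" "card B \<ge> Suc N" for B
  proof -
    have B0: "B \<noteq> {}" using B by auto
    define U where "U = bd.nsum B"
    define R where "R \<omega> = (\<Sum>u\<in>B. rest K u \<omega>) / sqrt (card B)" for \<omega>
    have WUR: "block_sum B \<omega> = U \<omega> + R \<omega>" for \<omega>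
      by (simp add: block_sum_def U_def R_def bd.nsum_def rest_def sum_subtractf add_divide_distrib[symmetric])
    have [measurable]: "R \<in> borel_measurable M" unfolding R_def using rest_measurable[OF K] by measurable
    have [measurable]: "U \<in> borel_measurable M" unfolding U_def by measurable
    have R2i: "integrable M (\<lambda>\<omega>. (R \<omega>)\<^sup>2)"
      unfolding R_def power_divide
      by (intro integrable_divide square_integrable_sum rest_square_integrable[OF K] rest_measurable[OF K])
    have U2i: "integrable M (\<lambda>\<omega>. (U \<omega>)\<^sup>2)" unfolding U_def by (rule bd.integrable_nsum_square)
    have R2: "expectation (\<lambda>\<omega>. (R \<omega>)\<^sup>2) \<le> \<eta>\<^sup>2" unfolding R_def by (rule small[OF B(1) B0])
    have R1i: "integrable M R" by (rule square_integrable_imp_integrable[OF _ R2i]) simp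
    have "expectation (\<lambda>\<omega>. \<bar>R \<omega>\<bar>) \<le> sqrt (expectation (\<lambda>\<omega>. (R \<omega>)\<^sup>2))"
      by (rule expectation_abs_le_sqrt[OF _ R2i]) simp
    also have "\<dots> \<le> \<eta>" using real_sqrt_le_mono[OF R2] \<eta> by simp
    finally have R1: "expectation (\<lambda>\<omega>. \<bar>R \<omega>\<bar>) \<le> \<eta>" .
    let ?a = "expectation (\<lambda>\<omega>. (block_sum B \<omega>)\<^sup>2)" and ?b = "expectation (\<lambda>\<omega>. (U \<omega>)\<^sup>2)"
    have ab0: "0 \<le> ?a" "0 \<le> ?b" by (intro integral_nonneg_AE, simp)+
    have phi: "norm ((\<integral>\<omega>. iexp (t * block_sum B \<omega>) \<partial>M) - (\<integral>\<omega>. iexp (t * U \<omega>) \<partial>M)) \<le> \<bar>t\<bar> * \<eta>"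
    proof -
      have i: "complex_integrable M (\<lambda>\<omega>. iexp (t * block_sum B \<omega>))" "complex_integrable M (\<lambda>\<omega>. iexp (t * U \<omega>))"
        by (rule integrable_iexp; simp)+
      have bound: "norm (iexp (t * block_sum B \<omega>) - iexp (t * U \<omega>)) \<le> \<bar>t\<bar> * \<bar>R \<omega>\<bar>" for \<omega>
      proof -
        have "iexp (t * block_sum B \<omega>) - iexp (t * U \<omega>) = (iexp (t * R \<omega>) - 1) * iexp (t * U \<omega>)"
          by (simp add: WUR exp_add algebra_simps)
        then have "norm (iexp (t * block_sum B \<omega>) - iexp (t * U \<omega>)) = norm (iexp (t * R \<omega>) - 1)" by (simp add: norm_mult)
        also have "\<dots> \<le> \<bar>t * R \<omega>\<bar>" using iexp_approx1[of "t * R \<omega>" 0] by simp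
        finally show ?thesis by (simp add: abs_mult)
      qed
      have "norm (\<integral>\<omega>. iexp (t * block_sum B \<omega>) - iexp (t * U \<omega>) \<partial>M) \<le> (\<integral>\<omega>. norm (iexp (t * block_sum B \<omega>) - iexp (t * U \<omega>)) \<partial>M)"
        by (rule integral_norm_bound)
      also have "\<dots> \<le> (\<integral>\<omega>. \<bar>t\<bar> * \<bar>R \<omega>\<bar> \<partial>M)"
        by (rule integral_mono[OF integrable_norm[OF Bochner_Integration.integrable_diff[OF i]] _ bound]) (use R1i in simp)
      also have "\<dots> \<le> \<bar>t\<bar> * \<eta>" using R1 by (simp add: mult_left_mono)
      finally show ?thesis using i by simp
    qed
    have diff: "\<bar>?b - ?a\<bar> \<le> \<eta> * (susceptibility + 2)"
    proof -
      \<comment> \<open>Young's inequality with parameter \<open>\<eta>\<close> replaces a Cauchy-Schwarz estimate of \<open>E \<bar>W R\<bar>\<close>\<close>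
      have pt: "\<bar>(U \<omega>)\<^sup>2 - (block_sum B \<omega>)\<^sup>2\<bar> \<le> \<eta> * (block_sum B \<omega>)\<^sup>2 + (1 / \<eta> + 1) * (R \<omega>)\<^sup>2" for \<omega>
      proof -
        have U: "U \<omega> = block_sum B \<omega> - R \<omega>" by (simp add: WUR)
        have "0 \<le> (\<eta> * \<bar>block_sum B \<omega>\<bar> - \<bar>R \<omega>\<bar>)\<^sup>2 / \<eta>" using \<eta> by simp
        also have "\<dots> = \<eta> * (block_sum B \<omega>)\<^sup>2 + (R \<omega>)\<^sup>2 / \<eta> - 2 * (\<bar>block_sum B \<omega>\<bar> * \<bar>R \<omega>\<bar>)"
          using \<eta> by (simp add: power2_diff power_mult_distrib field_simps power2_eq_square)
        finally have 1: "2 * \<bar>block_sum B \<omega> * R \<omega>\<bar> \<le> \<eta> * (block_sum B \<omega>)\<^sup>2 + (R \<omega>)\<^sup>2 / \<eta>" by (simp add: abs_mult)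
        have "(U \<omega>)\<^sup>2 - (block_sum B \<omega>)\<^sup>2 = (R \<omega>)\<^sup>2 - 2 * (block_sum B \<omega> * R \<omega>)" unfolding U by (simp add: power2_diff)
        then have "\<bar>(U \<omega>)\<^sup>2 - (block_sum B \<omega>)\<^sup>2\<bar> \<le> (R \<omega>)\<^sup>2 + 2 * \<bar>block_sum B \<omega> * R \<omega>\<bar>"
          using zero_le_power2[of "R \<omega>"] by linarith
        with 1 show ?thesis by (simp add: distrib_right)
      qed
      have "\<bar>?b - ?a\<bar> = \<bar>expectation (\<lambda>\<omega>. (U \<omega>)\<^sup>2 - (block_sum B \<omega>)\<^sup>2)\<bar>"
        using U2i block_sum_square_integrable by simp
      also have "\<dots> \<le> expectation (\<lambda>\<omega>. \<bar>(U \<omega>)\<^sup>2 - (block_sum B \<omega>)\<^sup>2\<bar>)" by (rule integral_abs_bound)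
      also have "\<dots> \<le> expectation (\<lambda>\<omega>. \<eta> * (block_sum B \<omega>)\<^sup>2 + (1 / \<eta> + 1) * (R \<omega>)\<^sup>2)"
        using U2i block_sum_square_integrable R2i by (intro integral_mono pt) auto
      also have "\<dots> = \<eta> * ?a + (1 / \<eta> + 1) * expectation (\<lambda>\<omega>. (R \<omega>)\<^sup>2)"
        using block_sum_square_integrable R2i by simp
      also have "\<dots> \<le> \<eta> * susceptibility + (1 / \<eta> + 1) * \<eta>\<^sup>2"
        using \<eta> R2 block_sum_variance_le[OF B(1)] by (intro add_mono mult_left_mono) auto
      also have "(1 / \<eta> + 1) * \<eta>\<^sup>2 = \<eta> + \<eta> * \<eta>" using \<eta> by (simp add: power2_eq_square field_simps)
      also have "\<eta> * susceptibility + (\<eta> + \<eta> * \<eta>) \<le> \<eta> * susceptibility + (\<eta> + \<eta> * 1)" using \<eta> by (intro add_left_mono mult_left_mono) auto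
      finally show ?thesis by (simp add: algebra_simps)
    qed
    have exp_lip: "\<bar>exp (- x) - exp (- y)\<bar> \<le> \<bar>x - y\<bar>" if "x \<ge> 0" "y \<ge> 0" for x y :: real
    proof -
      have "\<bar>exp (- x) - exp (- y)\<bar> \<le> y - x" if "0 \<le> x" "x \<le> y" for x y :: real
      proof -
        have "exp (- x) - exp (- y) = exp (- x) * (1 - exp (- (y - x)))" by (simp add: right_diff_distrib flip: exp_add)
        also have "\<dots> \<le> 1 * (y - x)"
        proof (rule mult_mono)
          show "1 - exp (- (y - x)) \<le> y - x" using exp_ge_add_one_self[of "- (y - x)"] by linarith
        qed (use that in auto)
        finally show ?thesis using that by simp
      qed
      from this[of x y] this[of y x] that show ?thesis by linarith
    qed
    have "\<bar>exp (- (?b * t\<^sup>2 / 2)) - exp (- (?a * t\<^sup>2 / 2))\<bar> \<le> \<bar>?b * t\<^sup>2 / 2 - ?a * t\<^sup>2 / 2\<bar>"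
      using ab0 by (intro exp_lip) auto
    also have "\<dots> = \<bar>?b - ?a\<bar> * (t\<^sup>2 / 2)"
      by (simp add: left_diff_distrib[symmetric] diff_divide_distrib[symmetric] abs_mult)
    also have "\<dots> \<le> \<eta> * (susceptibility + 2) * (t\<^sup>2 / 2)" using diff by (intro mult_right_mono) auto
    finally have gauss: "norm (complex_of_real (exp (- (?b * t\<^sup>2 / 2))) - of_real (exp (- (?a * t\<^sup>2 / 2)))) \<le> \<eta> * (susceptibility + 2) * (t\<^sup>2 / 2)"
      by (simp only: of_real_diff[symmetric] norm_of_real)
    have mid: "norm ((\<integral>\<omega>. iexp (t * U \<omega>) \<partial>M) - of_real (exp (- (?b * t\<^sup>2 / 2)))) \<le> e / 2"
      unfolding U_def using B by (intro N) auto
    have "norm ((\<integral>\<omega>. iexp (t * block_sum B \<omega>) \<partial>M) - of_real (exp (- (?a * t\<^sup>2 / 2)))) \<le> (\<bar>t\<bar> * \<eta> + e / 2) + \<eta> * (susceptibility + 2) * (t\<^sup>2 / 2)"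
      by (rule norm_diff_triangle_le[OF norm_diff_triangle_le[OF phi mid] gauss])
    also have "\<dots> = \<eta> * q + e / 2" by (simp add: q_def algebra_simps)
    also have "\<dots> \<le> e" using \<eta>q by simp
    finally show ?thesis .
  qed
  then show ?thesis by blast
qed

end

section \<open>Block sums perturbed by independent Gaussian noise\<close>

lemma (in prob_space) tail_second_moment_small:
  fixes U :: "'a \<Rightarrow> real"
  assumes [measurable]: "U \<in> borel_measurable M" and U2: "integrable M (\<lambda>\<omega>. (U \<omega>)\<^sup>2)" and e: "e > 0"
  shows "\<exists>a. expectation (\<lambda>\<omega>. (U \<omega>)\<^sup>2 * indicator {\<omega>. \<bar>U \<omega>\<bar> \<ge> a} \<omega>) \<le> e"
proof -
  have "(\<lambda>k. expectation (\<lambda>\<omega>. (U \<omega>)\<^sup>2 * indicator {\<omega>. \<bar>U \<omega>\<bar> \<ge> real k} \<omega>)) \<longlonglongrightarrow> expectation (\<lambda>\<omega>. 0)"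
  proof (rule integral_dominated_convergence[where w = "\<lambda>\<omega>. (U \<omega>)\<^sup>2"])
    show "AE \<omega> in M. (\<lambda>k. (U \<omega>)\<^sup>2 * indicator {\<omega>. \<bar>U \<omega>\<bar> \<ge> real k} \<omega>) \<longlonglongrightarrow> 0"
    proof (intro always_eventually allI)
      fix \<omega>
      have "\<forall>\<^sub>F k in sequentially. (U \<omega>)\<^sup>2 * indicator {\<omega>. \<bar>U \<omega>\<bar> \<ge> real k} \<omega> = (0 :: real)"
        using eventually_gt_at_top[of "nat \<lceil>\<bar>U \<omega>\<bar>\<rceil>"]
      proof eventually_elim
        case (elim k)
        then have "\<bar>U \<omega>\<bar> < real k" by linarith
        then show ?case by simp
      qed
      then show "(\<lambda>k. (U \<omega>)\<^sup>2 * indicator {\<omega>. \<bar>U \<omega>\<bar> \<ge> real k} \<omega>) \<longlonglongrightarrow> (0 :: real)"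
        by (rule tendsto_eventually)
    qed
    show "AE \<omega> in M. norm ((U \<omega>)\<^sup>2 * indicator {\<omega>. \<bar>U \<omega>\<bar> \<ge> real k} \<omega>) \<le> (U \<omega>)\<^sup>2" for k
      by (intro always_eventually allI) (simp add: indicator_def)
  qed (use U2 in \<open>auto simp: indicator_def\<close>)
  then have "(\<lambda>k. expectation (\<lambda>\<omega>. (U \<omega>)\<^sup>2 * indicator {\<omega>. \<bar>U \<omega>\<bar> \<ge> real k} \<omega>)) \<longlonglongrightarrow> 0" by simp
  then have "\<forall>\<^sub>F k in sequentially. expectation (\<lambda>\<omega>. (U \<omega>)\<^sup>2 * indicator {\<omega>. \<bar>U \<omega>\<bar> \<ge> real k} \<omega>) < e"
    using e by (rule order_tendstoD(2))
  then obtain k :: nat where "expectation (\<lambda>\<omega>. (U \<omega>)\<^sup>2 * indicator {\<omega>. \<bar>U \<omega>\<bar> \<ge> real k} \<omega>) < e"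
    using eventually_happens'[OF sequentially_bot] by blast
  then show ?thesis by (intro exI[of _ "real k"]) simp
qed

lemma (in prob_space) tail_second_moment_mono:
  fixes U :: "'a \<Rightarrow> real"
  assumes [measurable]: "U \<in> borel_measurable M" and U2: "integrable M (\<lambda>\<omega>. (U \<omega>)\<^sup>2)" and "a \<le> b"
  shows "expectation (\<lambda>\<omega>. (U \<omega>)\<^sup>2 * indicator {\<omega>. \<bar>U \<omega>\<bar> \<ge> b} \<omega>)
    \<le> expectation (\<lambda>\<omega>. (U \<omega>)\<^sup>2 * indicator {\<omega>. \<bar>U \<omega>\<bar> \<ge> a} \<omega>)"
proof -
  have int: "integrable M (\<lambda>\<omega>. (U \<omega>)\<^sup>2 * indicator {\<omega>. \<bar>U \<omega>\<bar> \<ge> c} \<omega>)" for c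
    by (rule Bochner_Integration.integrable_bound[OF U2]) (auto simp: indicator_def)
  show ?thesis
    by (rule integral_mono[OF int int]) (use \<open>a \<le> b\<close> in \<open>auto simp: indicator_def\<close>)
qed

locale perturbed_FKG_field = FKG_field M X
  for M :: "'a measure" and X :: "'i::ab_group_add \<Rightarrow> 'a \<Rightarrow> real" +
  fixes Z :: "'i \<Rightarrow> 'a \<Rightarrow> real" and \<tau> :: real
  assumes \<tau>: "\<tau> > 0"
    and Z_normal: "\<And>u. distributed M lborel (Z u) (\<lambda>z. ennreal (normal_density 0 (sqrt \<tau>) z))"
    and Z_indep: "indep_vars (\<lambda>_. borel) Z UNIV"
    and XZ_indep: "indep_var (\<Pi>\<^sub>M u\<in>UNIV. borel) (\<lambda>\<omega> u. X u \<omega>) (\<Pi>\<^sub>M u\<in>UNIV. borel) (\<lambda>\<omega> u. Z u \<omega>)"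
begin

definition block_noise :: "'i set \<Rightarrow> 'a \<Rightarrow> real" where
  "block_noise B \<omega> = (\<Sum>u\<in>B. Z u \<omega>) / sqrt (card B)"

definition perturbed_sum :: "'i set \<Rightarrow> 'a \<Rightarrow> real" where
  "perturbed_sum B \<omega> = block_sum B \<omega> + block_noise B \<omega>"

definition block_var :: "'i set \<Rightarrow> real" where
  "block_var B = expectation (\<lambda>\<omega>. (block_sum B \<omega>)\<^sup>2)"

definition block_fisher :: "'i set \<Rightarrow> real" where
  "block_fisher B = fisher_integral \<tau> (distr M borel (block_sum B))"

lemma block_var_nonneg: "block_var B \<ge> 0"
  unfolding block_var_def by (intro integral_nonneg_AE) simp

lemma block_var_le: "finite B \<Longrightarrow> block_var B \<le> susceptibility"
  unfolding block_var_def by (rule block_sum_variance_le)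

lemma block_noise_normal:
  assumes B: "finite B" "B \<noteq> {}"
  shows "distributed M lborel (block_noise B) (\<lambda>z. ennreal (normal_density 0 (sqrt \<tau>) z))"
proof -
  define n where "n = real (card B)"
  have n: "n > 0" using B by (simp add: n_def card_gt_0_iff)
  have "distributed M lborel (\<lambda>\<omega>. \<Sum>u\<in>B. Z u \<omega>) (normal_density (\<Sum>u\<in>B. 0) (sqrt (\<Sum>u\<in>B. (sqrt \<tau>)\<^sup>2)))"
    using \<tau> Z_normal B by (intro sum_indep_normal indep_vars_subset[OF Z_indep]) auto
  also have "(\<Sum>u\<in>B. (sqrt \<tau>)\<^sup>2) = n * \<tau>" using \<tau> by (simp add: n_def)
  finally have "distributed M lborel (\<lambda>\<omega>. \<Sum>u\<in>B. Z u \<omega>) (normal_density 0 (sqrt (n * \<tau>)))" by simp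
  from normal_density_affine[OF this, of "1 / sqrt n" 0]
  have "distributed M lborel (\<lambda>\<omega>. (\<Sum>u\<in>B. Z u \<omega>) / sqrt n) (normal_density 0 (\<bar>1 / sqrt n\<bar> * sqrt (n * \<tau>)))"
    using n \<tau> by simp
  moreover have "\<bar>1 / sqrt n\<bar> * sqrt (n * \<tau>) = sqrt \<tau>" using n by (simp add: real_sqrt_mult)
  ultimately show ?thesis by (simp add: block_noise_def[abs_def] n_def)
qed

lemma block_sum_noise_indep: "indep_var borel (block_sum B) borel (block_noise B)"
proof -
  let ?P = "\<Pi>\<^sub>M u\<in>(UNIV::'i set). (borel :: real measure)"
  let ?f = "\<lambda>x :: 'i \<Rightarrow> real. (\<Sum>u\<in>B. x u) / sqrt (card B)"
  have f: "?f \<in> measurable ?P borel" by measurable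
  have "block_sum B = ?f \<circ> (\<lambda>\<omega> u. X u \<omega>)" "block_noise B = ?f \<circ> (\<lambda>\<omega> u. Z u \<omega>)"
    by (auto simp: block_sum_def block_noise_def)
  then show ?thesis using indep_var_compose[OF XZ_indep f f] by simp
qed

lemma block_noise_measurable [measurable]: "block_noise B \<in> borel_measurable M"
  using indep_var_rv2[OF block_sum_noise_indep] .

lemma perturbed_sum_measurable [measurable]: "perturbed_sum B \<in> borel_measurable M"
  unfolding perturbed_sum_def by measurable

context
  fixes B :: "'i set"
  assumes B: "finite B" "B \<noteq> {}"
begin

lemma block_noise_moments:
  shows "expectation (block_noise B) = 0" and "integrable M (\<lambda>\<omega>. (block_noise B \<omega>)\<^sup>2)" and "expectation (\<lambda>\<omega>. (block_noise B \<omega>)\<^sup>2) = \<tau>"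
proof -
  have \<sigma>: "sqrt \<tau> > 0" using \<tau> by simp
  note D = block_noise_normal[OF B]
  show E: "expectation (block_noise B) = 0" by (rule normal_distributed_expectation[OF \<sigma> D])
  show "integrable M (\<lambda>\<omega>. (block_noise B \<omega>)\<^sup>2)"
    using distributed_integrable[OF D, of "\<lambda>z. z\<^sup>2"] integrable_normal_moment[OF \<sigma>, of 0 2] by simp
  show "expectation (\<lambda>\<omega>. (block_noise B \<omega>)\<^sup>2) = \<tau>"
    using normal_distributed_variance[OF \<sigma> D] \<tau> by (simp add: E)
qed

lemma perturbed_sum_square_integrable: "integrable M (\<lambda>\<omega>. (perturbed_sum B \<omega>)\<^sup>2)"
  unfolding perturbed_sum_def using block_noise_moments block_sum_square_integrable by (intro square_integrable_add) auto

lemma perturbed_sum_second_moment: "expectation (\<lambda>\<omega>. (perturbed_sum B \<omega>)\<^sup>2) = block_var B + \<tau>"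
proof -
  have W1: "integrable M (block_sum B)" by (rule square_integrable_imp_integrable[OF _ block_sum_square_integrable]) simp
  have G1: "integrable M (block_noise B)" by (rule square_integrable_imp_integrable[OF _ block_noise_moments(2)]) simp
  have "integrable M (\<lambda>\<omega>. block_sum B \<omega> * block_noise B \<omega>)"
    by (rule square_integrable_mult) (auto simp: block_sum_square_integrable block_noise_moments)
  moreover have "expectation (\<lambda>\<omega>. block_sum B \<omega> * block_noise B \<omega>) = 0"
    using indep_var_lebesgue_integral[OF block_sum_noise_indep W1 G1] block_sum_centred by simp
  ultimately show ?thesis
    using block_sum_square_integrable block_noise_moments by (simp add: perturbed_sum_def power2_sum block_var_def mult.assoc)
qed

lemma perturbed_sum_variance: "variance (perturbed_sum B) = block_var B + \<tau>"
proof -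
  have "integrable M (block_sum B)" by (rule square_integrable_imp_integrable[OF _ block_sum_square_integrable]) simp
  moreover have "integrable M (block_noise B)" by (rule square_integrable_imp_integrable[OF _ block_noise_moments(2)]) simp
  ultimately have "expectation (perturbed_sum B) = 0"
    unfolding perturbed_sum_def using block_sum_centred block_noise_moments by simp
  then show ?thesis using perturbed_sum_second_moment by simp
qed

lemma std_fisher_perturbed_sum: "std_fisher_information M (perturbed_sum B) = ereal ((block_var B + \<tau>) * block_fisher B - 1)"
proof -
  have "fisher_information M (perturbed_sum B) = ennreal (block_fisher B)" "block_fisher B \<ge> 0"
    unfolding block_fisher_def perturbed_sum_def
    using fisher_information_add_gaussian[OF \<tau> block_sum_noise_indep block_noise_normal[OF B] block_sum_square_integrable] by auto
  then show ?thesis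
    by (simp add: std_fisher_information_def perturbed_sum_variance enn2ereal_ennreal one_ereal_def)
qed

lemma expectation_perturbed_sum:
  assumes [measurable]: "q \<in> borel_measurable borel"
  shows "expectation (\<lambda>\<omega>. q (perturbed_sum B \<omega>)) = (\<integral>y. smoothed \<tau> 1 (distr M borel (block_sum B)) y * q y \<partial>lborel)"
proof -
  have "has_smooth_density M (perturbed_sum B) (smoothed \<tau> 1 (distr M borel (block_sum B)))"
    unfolding perturbed_sum_def[abs_def] by (rule has_smooth_density_add_gaussian[OF \<tau> block_sum_noise_indep block_noise_normal[OF B]])
  then have "distributed M lborel (perturbed_sum B) (\<lambda>y. ennreal (smoothed \<tau> 1 (distr M borel (block_sum B)) y))"
    "\<And>y. 0 \<le> smoothed \<tau> 1 (distr M borel (block_sum B)) y" by (auto simp: has_smooth_density_def)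
  from distributed_integral[OF this(1) _ this(2), of q] show ?thesis by simp
qed

end

lemma real_distribution_block_sum: "real_distribution (distr M borel (block_sum B))"
  by (rule real_distribution_distr) simp

lemma block_sum_second_moment_distr:
  "integrable (distr M borel (block_sum B)) (\<lambda>w. w\<^sup>2)" "(\<integral>w. w\<^sup>2 \<partial>distr M borel (block_sum B)) = block_var B"
  using block_sum_square_integrable by (simp_all add: integrable_distr_eq integral_distr block_var_def)

text \<open>
  The variances range in a compact interval, so they converge along a subsequence; Levy's continuity
  theorem then turns the approximation of characteristic functions into weak convergence.
\<close>

lemma gaussian_subsequence:
  assumes B: "\<And>k. finite (B k)" "\<And>k. card (B k) \<ge> k"
  obtains r :: "nat \<Rightarrow> nat" and s :: real where "strict_mono r" "s \<ge> 0" "s\<^sup>2 \<le> susceptibility"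
    "(\<lambda>k. block_var (B (r k))) \<longlonglongrightarrow> s\<^sup>2"
    "weak_conv_m (\<lambda>k. distr M borel (block_sum (B (r k)))) (centred_gaussian s)"
proof -
  have "seq_compact {0..susceptibility}" by (intro compact_imp_seq_compact compact_Icc)
  moreover have "\<forall>k. block_var (B k) \<in> {0..susceptibility}" using block_var_nonneg block_var_le B by simp
  ultimately obtain l r where l: "l \<in> {0..susceptibility}" and r: "strict_mono r" and lim: "((\<lambda>k. block_var (B k)) \<circ> r) \<longlonglongrightarrow> l"
    by (rule seq_compactE)
  define s where "s = sqrt l"
  have s: "s \<ge> 0" "s\<^sup>2 = l" using l by (auto simp: s_def)
  have lim: "(\<lambda>k. block_var (B (r k))) \<longlonglongrightarrow> s\<^sup>2" using lim by (simp add: s comp_def)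
  have "weak_conv_m (\<lambda>k. distr M borel (block_sum (B (r k)))) (centred_gaussian s)"
  proof (rule levy_continuity[OF real_distribution_block_sum real_distribution_centred_gaussian])
    fix t
    have char: "char (distr M borel (block_sum B)) t = (\<integral>\<omega>. iexp (t * block_sum B \<omega>) \<partial>M)" for B
      unfolding char_def by (subst integral_distr) auto
    have "(\<lambda>k. char (distr M borel (block_sum (B (r k)))) t - of_real (exp (- (block_var (B (r k)) * t\<^sup>2 / 2)))) \<longlonglongrightarrow> 0"
    proof (rule LIMSEQ_I)
      fix e :: real assume "e > 0"
      then obtain N where N: "\<And>B. finite B \<Longrightarrow> card B \<ge> N \<Longrightarrow>
          norm ((\<integral>\<omega>. iexp (t * block_sum B \<omega>) \<partial>M) - of_real (exp (- (block_var B * t\<^sup>2 / 2)))) \<le> e / 2"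
        using char_block_sum_near_gaussian[of "e / 2" t] unfolding block_var_def by auto
      have "norm (char (distr M borel (block_sum (B (r k)))) t - of_real (exp (- (block_var (B (r k)) * t\<^sup>2 / 2))) - 0) < e" if "k \<ge> N" for k
      proof -
        have "N \<le> card (B (r k))" using that B(2)[of "r k"] strict_mono_imp_increasing[OF r, of k] by linarith
        then show ?thesis using N[of "B (r k)"] B(1) \<open>e > 0\<close> unfolding char by fastforce
      qed
      then show "\<exists>N. \<forall>k\<ge>N. norm (char (distr M borel (block_sum (B (r k)))) t - of_real (exp (- (block_var (B (r k)) * t\<^sup>2 / 2))) - 0) < e"
        by blast
    qed
    moreover have "(\<lambda>k. complex_of_real (exp (- (block_var (B (r k)) * t\<^sup>2 / 2)))) \<longlonglongrightarrow> of_real (exp (- (s\<^sup>2 * t\<^sup>2 / 2)))"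
      by (intro tendsto_intros lim) simp
    ultimately have "(\<lambda>k. (char (distr M borel (block_sum (B (r k)))) t - of_real (exp (- (block_var (B (r k)) * t\<^sup>2 / 2)))) + of_real (exp (- (block_var (B (r k)) * t\<^sup>2 / 2))))
        \<longlonglongrightarrow> 0 + of_real (exp (- (s\<^sup>2 * t\<^sup>2 / 2)))"
      by (rule tendsto_add)
    then show "(\<lambda>k. char (distr M borel (block_sum (B (r k)))) t) \<longlonglongrightarrow> char (centred_gaussian s) t"
      by (simp add: char_centred_gaussian)
  qed
  with that[OF r s(1) _ lim] l s(2) show ?thesis by simp
qed

text \<open>
  Blocks violating the bound would form a sequence along which, after passing to a subsequence,
  the variance of the perturbed sum and its Fisher information have reciprocal limits.
\<close>

lemma standardised_fisher_small:
  assumes e: "e > 0"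
  shows "\<exists>N. \<forall>B. finite B \<longrightarrow> card B \<ge> N \<longrightarrow> \<bar>(block_var B + \<tau>) * block_fisher B - 1\<bar> \<le> e"
proof (rule ccontr)
  assume "\<not> ?thesis"
  then have "\<forall>k. \<exists>B. finite B \<and> card B \<ge> k \<and> \<not> \<bar>(block_var B + \<tau>) * block_fisher B - 1\<bar> \<le> e" by blast
  then obtain B where B: "\<And>k. finite (B k)" "\<And>k. card (B k) \<ge> k" and bad: "\<And>k. \<not> \<bar>(block_var (B k) + \<tau>) * block_fisher (B k) - 1\<bar> \<le> e"
    by metis
  obtain r s where s: "s \<ge> 0" and lim: "(\<lambda>k. block_var (B (r k))) \<longlonglongrightarrow> s\<^sup>2"
    and weak: "weak_conv_m (\<lambda>k. distr M borel (block_sum (B (r k)))) (centred_gaussian s)"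
    using gaussian_subsequence[OF B] by metis
  have "(\<lambda>k. block_fisher (B (r k))) \<longlonglongrightarrow> fisher_integral \<tau> (centred_gaussian s)"
    unfolding block_fisher_def
    by (rule fisher_integral_tendsto[OF \<tau> real_distribution_block_sum real_distribution_centred_gaussian weak, of susceptibility])
      (use block_sum_second_moment_distr block_var_le B in auto)
  then have Jlim: "(\<lambda>k. block_fisher (B (r k))) \<longlonglongrightarrow> 1 / (s\<^sup>2 + \<tau>)"
    by (simp add: fisher_integral_centred_gaussian[OF \<tau> s])
  have "(\<lambda>k. (block_var (B (r k)) + \<tau>) * block_fisher (B (r k)) - 1) \<longlonglongrightarrow> (s\<^sup>2 + \<tau>) * (1 / (s\<^sup>2 + \<tau>)) - 1"
    by (intro tendsto_intros lim Jlim)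
  moreover have "s\<^sup>2 + \<tau> > 0" using \<tau> by (simp add: add_nonneg_pos)
  ultimately have "(\<lambda>k. \<bar>(block_var (B (r k)) + \<tau>) * block_fisher (B (r k)) - 1\<bar>) \<longlonglongrightarrow> 0"
    by (intro tendsto_rabs_zero) simp
  then have "\<forall>\<^sub>F k in sequentially. \<bar>(block_var (B (r k)) + \<tau>) * block_fisher (B (r k)) - 1\<bar> < e"
    using e by (rule order_tendstoD(2))
  then obtain k where "\<bar>(block_var (B (r k)) + \<tau>) * block_fisher (B (r k)) - 1\<bar> < e"
    using eventually_happens'[OF sequentially_bot] by blast
  then show False using bad[of "r k"] by simp
qed

text \<open>
  The gap is the mean of the positive part of \<open>y\<^sup>2 - b\<close>, which is at most \<open>y ^ 4 / b\<close>, and the fourth moment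
  of \<open>N(0, p)\<close> is \<open>3 * p\<^sup>2\<close>.
\<close>

lemma gaussian_truncation_gap:
  assumes p: "p > 0" and b: "b > 0"
  shows "p - (\<integral>y. normal_density 0 (sqrt p) y * min (y\<^sup>2) b \<partial>lborel) \<le> 3 * p\<^sup>2 / b"
proof -
  let ?d = "normal_density 0 (sqrt p)"
  have \<sigma>: "sqrt p > 0" using p by simp
  have i2: "integrable lborel (\<lambda>y. ?d y * y\<^sup>2)" and i4: "integrable lborel (\<lambda>y. ?d y * y ^ 4)"
    using integrable_normal_moment[OF \<sigma>, of 0 2] integrable_normal_moment[OF \<sigma>, of 0 4] by simp_all
  have m2: "(\<integral>y. ?d y * y\<^sup>2 \<partial>lborel) = p"
    using integral_normal_moment_even[OF \<sigma>, of 0 1] p by (simp add: fact_numeral)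
  have m4: "(\<integral>y. ?d y * y ^ 4 \<partial>lborel) = 3 * p\<^sup>2"
    using integral_normal_moment_even[OF \<sigma>, of 0 2] p by (simp add: fact_numeral power2_eq_square field_simps)
  have im: "integrable lborel (\<lambda>y. ?d y * min (y\<^sup>2) b)"
  proof (rule Bochner_Integration.integrable_bound[OF i2])
    show "AE y in lborel. norm (?d y * min (y\<^sup>2) b) \<le> norm (?d y * y\<^sup>2)"
      using b by (intro always_eventually allI) (auto simp: abs_mult intro!: mult_left_mono)
  qed simp
  have "p - (\<integral>y. ?d y * min (y\<^sup>2) b \<partial>lborel) = (\<integral>y. ?d y * y\<^sup>2 - ?d y * min (y\<^sup>2) b \<partial>lborel)"
    using i2 im by (simp add: m2)
  also have "\<dots> \<le> (\<integral>y. ?d y * y ^ 4 / b \<partial>lborel)"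
  proof (rule integral_mono)
    fix y :: real
    have "y\<^sup>2 - min (y\<^sup>2) b \<le> y ^ 4 / b"
    proof (cases "y\<^sup>2 \<le> b")
      case True then show ?thesis using b by simp
    next
      case False
      then have "y\<^sup>2 * b \<le> y\<^sup>2 * y\<^sup>2" by (intro mult_left_mono) auto
      then have "y\<^sup>2 \<le> y ^ 4 / b" using b by (simp add: le_divide_eq power_add[symmetric])
      then show ?thesis using False b by simp
    qed
    then have "?d y * (y\<^sup>2 - min (y\<^sup>2) b) \<le> ?d y * (y ^ 4 / b)" by (rule mult_left_mono) simp
    then show "?d y * y\<^sup>2 - ?d y * min (y\<^sup>2) b \<le> ?d y * y ^ 4 / b" by (simp add: right_diff_distrib)
  qed (use i2 im i4 in auto)
  also have "\<dots> = 3 * p\<^sup>2 / b" by (simp add: m4)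
  finally show ?thesis .
qed

text \<open>
  Where \<open>V\<^sup>2 \<ge> 2 * b\<close> one has \<open>V\<^sup>2 \<le> 2 * (V\<^sup>2 - min (V\<^sup>2) b)\<close>, so the tail is controlled by a second moment and by the
  expectation of a bounded function of \<open>V\<close>. Both converge along subsequences, to values for
  \<open>N(0, s\<^sup>2 + \<tau>)\<close> with \<open>s\<^sup>2\<close> at most the susceptibility.
\<close>

lemma tails_small_for_large_blocks:
  assumes e: "e > 0"
  shows "\<exists>a N. \<forall>B. finite B \<longrightarrow> card B \<ge> N \<longrightarrow> expectation (\<lambda>\<omega>. (perturbed_sum B \<omega>)\<^sup>2 * indicator {\<omega>. \<bar>perturbed_sum B \<omega>\<bar> \<ge> a} \<omega>) \<le> e"
proof -
  \<comment> \<open>with this value the limiting bound \<open>2 * (3 * (susceptibility + \<tau>)\<^sup>2 / b)\<close> equals \<open>e / 2\<close>\<close>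
  define b where "b = 12 * (susceptibility + \<tau>)\<^sup>2 / e"
  have susceptibility\<tau>: "susceptibility + \<tau> > 0" using susceptibility_nonneg \<tau> by simp
  then have b: "b > 0" using e by (simp add: b_def)
  define a where "a = sqrt (2 * b)"
  define q where "q y = min (y\<^sup>2) b" for y :: real
  have q: "q \<in> borel_measurable borel" "\<bar>q y\<bar> \<le> b" for y using b unfolding q_def by auto
  let ?T = "\<lambda>B. expectation (\<lambda>\<omega>. (perturbed_sum B \<omega>)\<^sup>2 * indicator {\<omega>. \<bar>perturbed_sum B \<omega>\<bar> \<ge> a} \<omega>)"
  have upper: "?T B \<le> 2 * (block_var B + \<tau> - (\<integral>y. smoothed \<tau> 1 (distr M borel (block_sum B)) y * q y \<partial>lborel))"
    if B: "finite B" "B \<noteq> {}" for B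
  proof -
    have qi: "integrable M (\<lambda>\<omega>. q (perturbed_sum B \<omega>))"
      using q by (intro integrable_const_bound[of _ b]) (auto simp: q_def)
    have "?T B \<le> expectation (\<lambda>\<omega>. 2 * ((perturbed_sum B \<omega>)\<^sup>2 - q (perturbed_sum B \<omega>)))"
    proof (rule integral_mono)
      show "integrable M (\<lambda>\<omega>. (perturbed_sum B \<omega>)\<^sup>2 * indicator {\<omega>. \<bar>perturbed_sum B \<omega>\<bar> \<ge> a} \<omega>)"
        by (rule Bochner_Integration.integrable_bound[OF perturbed_sum_square_integrable[OF B]]) (auto simp: indicator_def)
      show "integrable M (\<lambda>\<omega>. 2 * ((perturbed_sum B \<omega>)\<^sup>2 - q (perturbed_sum B \<omega>)))"
        using qi perturbed_sum_square_integrable[OF B] by simp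
      show "(perturbed_sum B \<omega>)\<^sup>2 * indicator {\<omega>. \<bar>perturbed_sum B \<omega>\<bar> \<ge> a} \<omega> \<le> 2 * ((perturbed_sum B \<omega>)\<^sup>2 - q (perturbed_sum B \<omega>))" for \<omega>
      proof (cases "\<bar>perturbed_sum B \<omega>\<bar> \<ge> a")
        case True
        then have "a\<^sup>2 \<le> (perturbed_sum B \<omega>)\<^sup>2" using b abs_le_square_iff[of a "perturbed_sum B \<omega>"] by (simp add: a_def)
        then have "2 * b \<le> (perturbed_sum B \<omega>)\<^sup>2" using b by (simp add: a_def)
        moreover have "q (perturbed_sum B \<omega>) \<le> b" by (simp add: q_def)
        ultimately show ?thesis using True by simp
      qed (simp add: q_def)
    qed
    also have "\<dots> = 2 * (block_var B + \<tau> - expectation (\<lambda>\<omega>. q (perturbed_sum B \<omega>)))"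
      using qi perturbed_sum_square_integrable[OF B] by (simp add: perturbed_sum_second_moment[OF B])
    finally show ?thesis by (simp add: expectation_perturbed_sum[OF B q(1)])
  qed
  have "\<exists>N. \<forall>B. finite B \<longrightarrow> card B \<ge> N \<longrightarrow> ?T B \<le> e"
  proof (rule ccontr)
    assume "\<not> ?thesis"
    then have "\<forall>k. \<exists>B. finite B \<and> card B \<ge> Suc k \<and> \<not> ?T B \<le> e" by blast
    then obtain B where B: "\<And>k. finite (B k)" "\<And>k. card (B k) \<ge> Suc k" and bad: "\<And>k. \<not> ?T (B k) \<le> e"
      by metis
    have ne: "B k \<noteq> {}" for k using B(2)[of k] by auto
    have B': "card (B k) \<ge> k" for k using B(2)[of k] by simp
    obtain r s where s: "s \<ge> 0" "s\<^sup>2 \<le> susceptibility" and lim: "(\<lambda>k. block_var (B (r k))) \<longlonglongrightarrow> s\<^sup>2"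
      and weak: "weak_conv_m (\<lambda>k. distr M borel (block_sum (B (r k)))) (centred_gaussian s)"
      using gaussian_subsequence[OF B(1) B'] by metis
    have "(\<lambda>k. \<integral>y. smoothed \<tau> 1 (distr M borel (block_sum (B (r k)))) y * q y \<partial>lborel) \<longlonglongrightarrow> (\<integral>y. smoothed \<tau> 1 (centred_gaussian s) y * q y \<partial>lborel)"
      by (rule integral_smoothed_tendsto[OF \<tau> real_distribution_block_sum real_distribution_centred_gaussian weak, of susceptibility _ b])
        (use block_sum_second_moment_distr block_var_le B q in auto)
    then have qlim: "(\<lambda>k. \<integral>y. smoothed \<tau> 1 (distr M borel (block_sum (B (r k)))) y * q y \<partial>lborel) \<longlonglongrightarrow> (\<integral>y. normal_density 0 (sqrt (s\<^sup>2 + \<tau>)) y * q y \<partial>lborel)"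
      by (simp add: smoothed_centred_gaussian[OF \<tau> s(1)])
    let ?L = "2 * (s\<^sup>2 + \<tau> - (\<integral>y. normal_density 0 (sqrt (s\<^sup>2 + \<tau>)) y * q y \<partial>lborel))"
    have "(\<lambda>k. 2 * (block_var (B (r k)) + \<tau> - (\<integral>y. smoothed \<tau> 1 (distr M borel (block_sum (B (r k)))) y * q y \<partial>lborel))) \<longlonglongrightarrow> ?L"
      by (intro tendsto_intros lim qlim)
    moreover have "e \<le> 2 * (block_var (B (r k)) + \<tau> - (\<integral>y. smoothed \<tau> 1 (distr M borel (block_sum (B (r k)))) y * q y \<partial>lborel))" for k
      using upper[OF B(1) ne, of "r k"] bad[of "r k"] by linarith
    ultimately have "e \<le> ?L" by (intro LIMSEQ_le_const) auto
    also have "?L \<le> 2 * (3 * (s\<^sup>2 + \<tau>)\<^sup>2 / b)"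
      unfolding q_def using \<tau> b by (intro mult_left_mono gaussian_truncation_gap) (auto simp: add_nonneg_pos)
    also have "\<dots> \<le> 2 * (3 * (susceptibility + \<tau>)\<^sup>2 / b)"
      using s \<tau> b by (intro mult_left_mono divide_right_mono power_mono) auto
    also have "\<dots> = e / 2" using e susceptibility\<tau> by (simp add: b_def)
    finally show False using e by simp
  qed
  then show ?thesis by blast
qed

text \<open>
  A family with finitely many blocks of each bounded size: the finitely many small blocks are
  treated one at a time.
\<close>

lemma tails_uniformly_small:
  assumes \<B>: "\<And>B. B \<in> \<B> \<Longrightarrow> finite B \<and> B \<noteq> {}" and small: "\<And>N. finite {B \<in> \<B>. card B < N}" and e: "e > 0"
  shows "\<exists>a. \<forall>B\<in>\<B>. expectation (\<lambda>\<omega>. (perturbed_sum B \<omega>)\<^sup>2 * indicator {\<omega>. \<bar>perturbed_sum B \<omega>\<bar> \<ge> a} \<omega>) \<le> e"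
proof -
  let ?T = "\<lambda>B a. expectation (\<lambda>\<omega>. (perturbed_sum B \<omega>)\<^sup>2 * indicator {\<omega>. \<bar>perturbed_sum B \<omega>\<bar> \<ge> a} \<omega>)"
  obtain a N where aN: "\<And>B. finite B \<Longrightarrow> card B \<ge> N \<Longrightarrow> ?T B a \<le> e"
    using tails_small_for_large_blocks[OF e] by metis
  have "\<exists>a. ?T B a \<le> e" if "B \<in> \<B>" for B
    using tail_second_moment_small[OF perturbed_sum_measurable perturbed_sum_square_integrable e] \<B>[OF that] by blast
  then obtain f where f: "\<And>B. B \<in> \<B> \<Longrightarrow> ?T B (f B) \<le> e" by metis
  define m where "m = Max (insert a (f ` {B \<in> \<B>. card B < N}))"
  have "?T B m \<le> e" if B: "B \<in> \<B>" for B
  proof -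
    have mono: "x \<le> m \<Longrightarrow> ?T B m \<le> ?T B x" for x
      using \<B>[OF B] by (intro tail_second_moment_mono perturbed_sum_measurable perturbed_sum_square_integrable) auto
    show ?thesis
    proof (cases "card B < N")
      case True
      then have "f B \<le> m" unfolding m_def using small[of N] B by (intro Max_ge) auto
      then show ?thesis using mono f[OF B] by (meson order_trans)
    next
      case False
      have "a \<le> m" unfolding m_def using small[of N] by (intro Max_ge) auto
      then show ?thesis using mono aN[of B] \<B>[OF B] False by (meson order_trans not_less)
    qed
  qed
  then show ?thesis by blast
qed

end

section \<open>Boxes in the lattice\<close>

lemma bij_betw_vec_lambda_PiE:
  fixes F :: "'d::finite \<Rightarrow> 'b set"
  shows "bij_betw vec_lambda (PiE UNIV F) {y. \<forall>i. y $ i \<in> F i}"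
  by (rule bij_betw_byWitness[where f' = vec_nth]) auto

lemma finite_box_sites: "finite (box_sites x)"
  and card_box_sites: "card (box_sites x) = box_size x"
proof -
  have eq: "box_sites x = {y. \<forall>i. y $ i \<in> {1..int (x $ i)}}" by (auto simp: box_sites_def)
  note bij = bij_betw_vec_lambda_PiE[of "\<lambda>i. {1..int (x $ i)}", folded eq]
  have "finite (PiE UNIV (\<lambda>i. {1..int (x $ i)}))" by (intro finite_PiE) auto
  then show "finite (box_sites x)" using bij_betw_finite[OF bij] by simp
  show "card (box_sites x) = box_size x"
    using bij_betw_same_card[OF bij] by (simp add: card_PiE box_size_def)
qed

lemma box_size_pos: "(\<And>i. 0 < x $ i) \<Longrightarrow> 0 < box_size x"
  unfolding box_size_def by (rule prod_pos) auto

lemma finite_small_boxes: "finite {x :: nat ^ 'd. (\<forall>i. 0 < x $ i) \<and> box_size x < N}"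
proof (rule finite_subset)
  show "{x :: nat ^ 'd. (\<forall>i. 0 < x $ i) \<and> box_size x < N} \<subseteq> {x. \<forall>i. x $ i \<in> {..<N}}"
  proof safe
    fix x :: "nat ^ 'd" and i assume pos: "\<forall>i. 0 < x $ i" and N: "box_size x < N"
    have "x $ i dvd box_size x" unfolding box_size_def by (rule dvd_prodI) auto
    then have "x $ i \<le> box_size x" using box_size_pos pos by (intro dvd_imp_le) auto
    then show "x $ i < N" using N by simp
  qed
  have "finite (PiE (UNIV :: 'd set) (\<lambda>i. {..<N}))" by (intro finite_PiE) auto
  then show "finite {x :: nat ^ 'd. \<forall>i. x $ i \<in> {..<N}}"
    using bij_betw_finite[OF bij_betw_vec_lambda_PiE[of "\<lambda>i::'d. {..<N}"]] by simp
qed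

lemma box_of_size_exists:
  assumes "n > 0"
  shows "\<exists>x :: nat ^ 'd. (\<forall>i. 0 < x $ i) \<and> box_size x = n"
proof -
  obtain j :: 'd where True by blast
  have "box_size (\<chi> i. if i = j then n else 1) = n"
    unfolding box_size_def by (simp add: prod.delta)
  then show ?thesis using assms by (intro exI[of _ "\<chi> i. if i = j then n else 1"]) auto
qed

theorem theorem1p7:
  fixes M :: "'a measure"
    and X Z :: "int ^ 'd \<Rightarrow> 'a \<Rightarrow> real"
    and \<tau> :: real
    and V :: "nat ^ 'd \<Rightarrow> 'a \<Rightarrow> real"
  assumes "prob_space M"
    and "\<And>u. X u \<in> borel_measurable M"
    and "stationary M X"
    and "\<And>u. integrable M (\<lambda>\<omega>. (X u \<omega>)\<^sup>2)"
    and "\<And>u. (\<integral>\<omega>. X u \<omega> \<partial>M) = 0"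
    and "FKG M X"
    and "(\<lambda>u. covariance M (X 0) (X u)) summable_on UNIV"
    and "\<tau> > 0"
    and "\<And>u. distributed M lborel (Z u) (\<lambda>z. ennreal (normal_density 0 (sqrt \<tau>) z))"
    and "prob_space.indep_vars M (\<lambda>_. borel) Z UNIV"
    and "prob_space.indep_var M (\<Pi>\<^sub>M u\<in>UNIV. borel) (\<lambda>\<omega> u. X u \<omega>) (\<Pi>\<^sub>M u\<in>UNIV. borel) (\<lambda>\<omega> u. Z u \<omega>)"
  defines "V \<equiv> normalized_sum (\<lambda>u \<omega>. X u \<omega> + Z u \<omega>)"
  shows "((\<lambda>n::nat. SUP x\<in>{x. (\<forall>i. 0 < x $ i) \<and> box_size x = n}.
            std_fisher_information M (V x)) \<longlonglongrightarrow> 0) \<longleftrightarrow>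
         (\<exists>\<psi> :: real \<Rightarrow> real. (\<psi> \<longlongrightarrow> 0) at_top \<and>
            (\<forall>x. (\<forall>i. 0 < x $ i) \<longrightarrow> V x \<in> tail_class M \<psi>))"
proof -
  interpret prob_space M by fact
  interpret perturbed_FKG_field M X Z \<tau>
    using assms(2-11) by unfold_locales auto
  let ?P = "{x :: nat ^ 'd. \<forall>i. 0 < x $ i}"
  define B where "B x = box_sites x" for x :: "nat ^ 'd"
  have B: "finite (B x)" "card (B x) = box_size x" for x
    by (simp_all add: B_def finite_box_sites card_box_sites)
  have ne: "B x \<noteq> {}" if "x \<in> ?P" for x
    using box_size_pos[of x] that B(2)[of x] by auto
  have V: "V x = perturbed_sum (B x)" for x
    by (auto simp: V_def normalized_sum_def perturbed_sum_def block_sum_def block_noise_def B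
        sum.distrib add_divide_distrib simp flip: B_def)
  have "(\<lambda>n::nat. SUP x\<in>{x. (\<forall>i. 0 < x $ i) \<and> box_size x = n}. std_fisher_information M (V x)) \<longlonglongrightarrow> 0"
  proof -
    let ?S = "\<lambda>n::nat. SUP x\<in>{x. (\<forall>i. 0 < x $ i) \<and> box_size x = n}. std_fisher_information M (V x)"
    have bounds: "\<forall>\<^sub>F n in sequentially. ereal (- e) \<le> ?S n \<and> ?S n \<le> ereal e" if e: "e > 0" for e :: real
    proof -
      obtain N where N: "\<And>B. finite B \<Longrightarrow> card B \<ge> N \<Longrightarrow> \<bar>(block_var B + \<tau>) * block_fisher B - 1\<bar> \<le> e"
        using standardised_fisher_small[OF e] by metis
      have std: "ereal (- e) \<le> std_fisher_information M (V x) \<and> std_fisher_information M (V x) \<le> ereal e"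
        if x: "x \<in> ?P" "box_size x \<ge> N" for x
        using N[OF B(1), of x] x(2) unfolding V std_fisher_perturbed_sum[OF B(1) ne[OF x(1)]] B(2)
        by (simp add: abs_le_iff)
      show ?thesis
        using eventually_ge_at_top[of "Suc N"]
      proof eventually_elim
        case (elim n)
        obtain x :: "nat ^ 'd" where x: "\<forall>i. 0 < x $ i" "box_size x = n"
          using box_of_size_exists[of n] elim by auto
        have "ereal (- e) \<le> std_fisher_information M (V x)" using std[of x] x elim by simp
        also have "\<dots> \<le> ?S n" using x by (intro SUP_upper) simp
        finally have "ereal (- e) \<le> ?S n" .
        moreover have "?S n \<le> ereal e"
          by (rule SUP_least) (use std elim in auto)
        ultimately show ?case by simp
      qed
    qed
    show ?thesis
    proof (rule order_tendstoI)
      fix a :: ereal assume "a < 0"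
      then obtain e where e: "a < ereal e" "ereal e < 0" using ereal_dense2 by blast
      from bounds[of "- e"] e(2) have "\<forall>\<^sub>F n in sequentially. ereal e \<le> ?S n"
        by (auto elim: eventually_mono)
      then show "\<forall>\<^sub>F n in sequentially. a < ?S n" using e(1) by (auto elim: eventually_mono)
    next
      fix a :: ereal assume "0 < a"
      then obtain e where e: "0 < ereal e" "ereal e < a" using ereal_dense2 by blast
      from bounds[of e] e(1) have "\<forall>\<^sub>F n in sequentially. ?S n \<le> ereal e"
        by (auto elim: eventually_mono)
      then show "\<forall>\<^sub>F n in sequentially. ?S n < a" using e(2) by (auto elim: eventually_mono)
    qed
  qed
  moreover have "\<exists>\<psi> :: real \<Rightarrow> real. (\<psi> \<longlongrightarrow> 0) at_top \<and> (\<forall>x. (\<forall>i. 0 < x $ i) \<longrightarrow> V x \<in> tail_class M \<psi>)"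
  proof -
    let ?T = "\<lambda>x a. expectation (\<lambda>\<omega>. (V x \<omega>)\<^sup>2 * indicator {\<omega>. \<bar>V x \<omega>\<bar> \<ge> a} \<omega>)"
    \<comment> \<open>the supremum \<open>\<psi>\<close> of these ratios is the least admissible function; the variances are at least \<open>\<tau>\<close>, so the standardised tails are controlled by the absolute ones\<close>
    define t where "t x R = ?T x (R * sqrt (variance (V x))) / variance (V x)" for x R
    define \<psi> where "\<psi> R = (SUP x\<in>?P. t x R)" for R
    have var: "variance (V x) = block_var (B x) + \<tau>" if "x \<in> ?P" for x
      unfolding V by (rule perturbed_sum_variance[OF B(1) ne[OF that]])
    have var_ge: "\<tau> \<le> variance (V x)" if "x \<in> ?P" for x
      unfolding var[OF that] using block_var_nonneg by simp
    have var_pos: "0 < variance (V x)" if "x \<in> ?P" for x using var_ge[OF that] \<tau> by linarith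
    have Vm: "V x \<in> borel_measurable M" for x unfolding V by (rule perturbed_sum_measurable)
    have Vi: "integrable M (\<lambda>\<omega>. (V x \<omega>)\<^sup>2)" if "x \<in> ?P" for x
      unfolding V by (rule perturbed_sum_square_integrable[OF B(1) ne[OF that]])
    have t0: "0 \<le> t x R" if "x \<in> ?P" for x R
      unfolding t_def using var_pos[OF that] by (intro divide_nonneg_pos integral_nonneg_AE) auto
    have t1: "t x R \<le> 1" if "x \<in> ?P" for x R
    proof -
      have "?T x (R * sqrt (variance (V x))) \<le> expectation (\<lambda>\<omega>. (V x \<omega>)\<^sup>2)"
        using Vi[OF that] Vm[of x]
        by (intro integral_mono Bochner_Integration.integrable_bound[OF Vi[OF that]]) (auto simp: indicator_def)
      also have "\<dots> = variance (V x)"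
        unfolding var[OF that] unfolding V by (rule perturbed_sum_second_moment[OF B(1) ne[OF that]])
      finally show ?thesis unfolding t_def using var_pos[OF that] by (simp add: divide_le_eq)
    qed
    have bdd: "bdd_above ((\<lambda>x. t x R) ` ?P)" for R using t1 by (intro bdd_aboveI2[of _ _ 1]) auto
    obtain x1 :: "nat ^ 'd" where x1: "x1 \<in> ?P" using box_of_size_exists[of 1] by auto
    have \<psi>_nonneg: "0 \<le> \<psi> R" for R
      unfolding \<psi>_def by (rule cSUP_upper2[OF bdd x1 t0[OF x1]])
    have lim: "(\<psi> \<longlongrightarrow> 0) at_top"
    proof (rule order_tendstoI)
      fix e :: real assume e: "0 < e"
      have pos: "e / 2 * \<tau> > 0" using e \<tau> by simp
      have small: "finite {A \<in> B ` ?P. card A < N}" for N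
        by (rule finite_subset[OF _ finite_imageI[OF finite_small_boxes[of N], of B]]) (auto simp: B)
      have "\<exists>a. \<forall>A\<in>B ` ?P. expectation (\<lambda>\<omega>. (perturbed_sum A \<omega>)\<^sup>2 * indicator {\<omega>. \<bar>perturbed_sum A \<omega>\<bar> \<ge> a} \<omega>) \<le> e / 2 * \<tau>"
        by (rule tails_uniformly_small[OF _ small pos]) (use B(1) ne in auto)
      then obtain a where a: "\<And>x. x \<in> ?P \<Longrightarrow> ?T x a \<le> e / 2 * \<tau>"
        unfolding V by blast
      show "\<forall>\<^sub>F R in at_top. \<psi> R < e"
        using eventually_ge_at_top[of "\<bar>a\<bar> / sqrt \<tau>"]
      proof eventually_elim
        case (elim R)
        have "t x R \<le> e / 2" if x: "x \<in> ?P" for x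
        proof -
          have "0 \<le> \<bar>a\<bar> / sqrt \<tau>" using \<tau> by simp
          then have R: "R \<ge> 0" using elim by linarith
          have "a \<le> R * sqrt \<tau>" using elim \<tau> by (simp add: divide_le_eq)
          also have "\<dots> \<le> R * sqrt (variance (V x))"
            using var_ge[OF x] R by (intro mult_left_mono) auto
          finally have "?T x (R * sqrt (variance (V x))) \<le> ?T x a"
            by (rule tail_second_moment_mono[OF Vm Vi[OF x]])
          also have "\<dots> \<le> e / 2 * \<tau>" by (rule a[OF x])
          also have "\<dots> \<le> e / 2 * variance (V x)" using var_ge[OF x] e by (intro mult_left_mono) auto
          finally show ?thesis unfolding t_def using var_pos[OF x] by (simp add: divide_le_eq)
        qed
        then have "\<psi> R \<le> e / 2" unfolding \<psi>_def using x1 by (intro cSUP_least) auto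
        then show ?case using e by simp
      qed
    next
      fix e :: real assume "e < 0"
      then show "\<forall>\<^sub>F R in at_top. e < \<psi> R" using \<psi>_nonneg by (intro always_eventually allI) (meson less_le_trans)
    qed
    have "V x \<in> tail_class M \<psi>" if x: "x \<in> ?P" for x
    proof -
      have "?T x (R * sqrt (variance (V x))) \<le> variance (V x) * \<psi> R" for R
      proof -
        have "t x R \<le> \<psi> R" unfolding \<psi>_def by (rule cSUP_upper[OF x bdd])
        then show ?thesis unfolding t_def using var_pos[OF x] by (simp add: divide_le_eq mult.commute)
      qed
      then show ?thesis using Vm Vi[OF x] by (simp add: tail_class_def)
    qed
    with lim show ?thesis by blast
  qed
  ultimately show ?thesis by blast
qed

end
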